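(* Let $p$ be a prime, let $k \geq 1$ with $3k \leq n-1$, let $M$ be a closed $n$-manifold, and let $x \in H^k(M;\mathbb{Z}_p)$ induce periodicity, with associated periodic subquotient $\bar H^*$. Then there exist an integer $m \geq 0$, elements $x_1, \ldots, x_m \in \bar H^k$ and non-trivial subalgebras $\bar H^*_{x_1}, \ldots, \bar H^*_{x_m}$ of $\bar H^*$ such that all of the following hold: (1) $\bar H^* = \bar H^*_{x_1} \oplus \cdots \oplus \bar H^*_{x_m}$. (2) For each $i$, multiplication by $x_i$ induces periodicity when restricted to $\bar H^*_{x_i}$ and induces zero when restricted to $\bar H^*_{x_j}$ for all $j \neq i$. (3) The periodicity in (2) is irreducible in the sense that, for each $i$, if $x_i = a + b$ with $a, b \in \bar H^k$, then $a$ or $b$ also induces periodicity on $\bar H^*_{x_i}$.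
   Context: Closed manifolds are compact, without boundary, and connected; $\mathbb{Z}_p = \mathbb{Z}/p\mathbb{Z}$. An element $x \in H^k(M;\mathbb{Z}_p)$ with $3k \leq n-1$ induces periodicity in degrees $1 \leq * \leq n-1$ if the maps $H^i(M;\mathbb{Z}_p) \to H^{i+k}(M;\mathbb{Z}_p)$ given by cup product with $x$ are surjective for $1 \leq i < n-1-k$ and injective for $1 < i \leq n-1-k$. Given such $x$, the periodic subquotient is the graded $\mathbb{Z}_p$-vector space $\bar H^*$ with $\bar H^1 = H^1(M;\mathbb{Z}_p)/\ker(x)$, $\bar H^i = H^i(M;\mathbb{Z}_p)$ for $1 < i < n-1$, and $\bar H^{n-1} = \mathrm{im}(x) \subseteq H^{n-1}(M;\mathbb{Z}_p)$, where $\ker(x)$ and $\mathrm{im}(x)$ are the kernel and image of multiplication by $x$ on $H^1(M;\mathbb{Z}_p)$ and into $H^{n-1}(M;\mathbb{Z}_p)$; $\bar H^i = 0$ in all other degrees. The cup product descends to $\bar H^*$ (products landing in degrees above $n-1$ are zero), and multiplication by $x$ gives isomorphisms $\bar H^i \to \bar H^{i+k}$ for all $1 \leq i \leq n-1-k$. For a graded subalgebra $S^* \subseteq \bar H^*$ and $a \in \bar H^k$, we say $a$ induces periodicity on $S^*$ if multiplication by $a$ restricts to isomorphisms $S^i \to S^{i+k}$ for all $1 \leq i \leq n-1-k$. *)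

theory Defs
  imports
    "HOL-Algebra.Module"
    "HOL-Algebra.QuotRing"
    "HOL-Number_Theory.Residues"
    "HOL-Analysis.Analysis"
    "HOL-Homology.Homology"
begin

section \<open>Closed manifolds\<close>

definition topological_manifold :: "nat \<Rightarrow> 'a topology \<Rightarrow> bool" where
  "topological_manifold n M \<longleftrightarrow>
     Hausdorff_space M \<and> second_countable M \<and>
     (\<forall>x \<in> topspace M. \<exists>U V. openin M U \<and> x \<in> U \<and> openin (Euclidean_space n) V \<and>
        subtopology M U homeomorphic_space subtopology (Euclidean_space n) V)"

definition closed_manifold :: "nat \<Rightarrow> 'a topology \<Rightarrow> bool" where
  "closed_manifold n M \<longleftrightarrow> topological_manifold n M \<and> compact_space M \<and> connected_space M"


section \<open>Quotient modules\<close>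

text \<open>Records of type \<^typ>\<open>('r, 'b) module\<close> carry ring multiplication fields that the locale
  \<^locale>\<open>module\<close> does not use. They are left undefined throughout.\<close>

definition quotient_module :: "('r, 'b) module \<Rightarrow> 'b set \<Rightarrow> ('r, 'b set) module" where
  "quotient_module V N =
     \<lparr>carrier = a_rcosets\<^bsub>V\<^esub> N, monoid.mult = undefined, one = undefined,
      ring.zero = N, ring.add = set_add V,
      module.smult = (\<lambda>r A. \<Union>a\<in>A. N +>\<^bsub>V\<^esub> (r \<odot>\<^bsub>V\<^esub> a))\<rparr>"


section \<open>Singular cohomology and cup product\<close>

type_synonym ('a, 'r) cochain = "((nat \<Rightarrow> real) \<Rightarrow> 'a) \<Rightarrow> 'r"

definition cochain_module ::
  "('r, 'm) ring_scheme \<Rightarrow> 'a topology \<Rightarrow> nat \<Rightarrow> ('r, ('a, 'r) cochain) module" where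
  "cochain_module R X k =
     \<lparr>carrier = singular_simplex_set k X \<rightarrow>\<^sub>E carrier R, monoid.mult = undefined, one = undefined,
      ring.zero = (\<lambda>\<sigma>\<in>singular_simplex_set k X. \<zero>\<^bsub>R\<^esub>),
      ring.add = (\<lambda>c d. \<lambda>\<sigma>\<in>singular_simplex_set k X. c \<sigma> \<oplus>\<^bsub>R\<^esub> d \<sigma>),
      module.smult = (\<lambda>r c. \<lambda>\<sigma>\<in>singular_simplex_set k X. r \<otimes>\<^bsub>R\<^esub> c \<sigma>)\<rparr>"

text \<open>The coboundary of a \<open>k\<close>-cochain; it is the transpose of \<^const>\<open>chain_boundary\<close>.\<close>

definition coboundary ::
  "('r, 'm) ring_scheme \<Rightarrow> 'a topology \<Rightarrow> nat \<Rightarrow> ('a, 'r) cochain \<Rightarrow> ('a, 'r) cochain" where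
  "coboundary R X k c =
     (\<lambda>\<sigma>\<in>singular_simplex_set (Suc k) X.
        \<Oplus>\<^bsub>R\<^esub>i\<in>{..Suc k}. (if even i then c (singular_face (Suc k) i \<sigma>)
                          else \<ominus>\<^bsub>R\<^esub> c (singular_face (Suc k) i \<sigma>)))"

definition cocycles :: "('r, 'm) ring_scheme \<Rightarrow> 'a topology \<Rightarrow> nat \<Rightarrow> ('a, 'r) cochain set" where
  "cocycles R X k =
     {c \<in> carrier (cochain_module R X k). coboundary R X k c = \<zero>\<^bsub>cochain_module R X (Suc k)\<^esub>}"

definition coboundaries :: "('r, 'm) ring_scheme \<Rightarrow> 'a topology \<Rightarrow> nat \<Rightarrow> ('a, 'r) cochain set" where
  "coboundaries R X k =
     (case k of 0 \<Rightarrow> {\<zero>\<^bsub>cochain_module R X 0\<^esub>}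
      | Suc j \<Rightarrow> coboundary R X j ` carrier (cochain_module R X j))"

definition cohomology ::
  "('r, 'm) ring_scheme \<Rightarrow> 'a topology \<Rightarrow> nat \<Rightarrow> ('r, ('a, 'r) cochain set) module" where
  "cohomology R X k =
     quotient_module (cochain_module R X k \<lparr>carrier := cocycles R X k\<rparr>) (coboundaries R X k)"

text \<open>The faces spanned by the first \<open>i + 1\<close> and the last \<open>j + 1\<close> vertices of an
  \<open>(i + j)\<close>-simplex. The library's standard simplices are nested (coordinates beyond the dimension
  are zero), so the front face is a plain restriction.\<close>

definition front_face :: "nat \<Rightarrow> ((nat \<Rightarrow> real) \<Rightarrow> 'a) \<Rightarrow> (nat \<Rightarrow> real) \<Rightarrow> 'a" where
  "front_face i \<sigma> = restrict \<sigma> (standard_simplex i)"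

definition back_face :: "nat \<Rightarrow> nat \<Rightarrow> ((nat \<Rightarrow> real) \<Rightarrow> 'a) \<Rightarrow> (nat \<Rightarrow> real) \<Rightarrow> 'a" where
  "back_face i j \<sigma> = (\<lambda>t\<in>standard_simplex j. \<sigma> (\<lambda>l. if l < i then 0 else t (l - i)))"

definition cochain_cup ::
  "('r, 'm) ring_scheme \<Rightarrow> 'a topology \<Rightarrow> nat \<Rightarrow> nat
     \<Rightarrow> ('a, 'r) cochain \<Rightarrow> ('a, 'r) cochain \<Rightarrow> ('a, 'r) cochain" where
  "cochain_cup R X i j a b =
     (\<lambda>\<sigma>\<in>singular_simplex_set (i + j) X. a (front_face i \<sigma>) \<otimes>\<^bsub>R\<^esub> b (back_face i j \<sigma>))"

text \<open>As in \<^const>\<open>rcoset_mult\<close>, products of cosets are written as the union over all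
  representatives.\<close>

definition cup ::
  "('r, 'm) ring_scheme \<Rightarrow> 'a topology \<Rightarrow> nat \<Rightarrow> nat
     \<Rightarrow> ('a, 'r) cochain set \<Rightarrow> ('a, 'r) cochain set \<Rightarrow> ('a, 'r) cochain set" where
  "cup R X i j A B =
     (\<Union>a\<in>A. \<Union>b\<in>B. coboundaries R X (i + j) +>\<^bsub>cochain_module R X (i + j)\<^esub> cochain_cup R X i j a b)"


section \<open>Graded algebras\<close>

text \<open>A graded algebra is given by its homogeneous parts and the products
  \<open>part A i \<times> part A j \<rightarrow> part A (i + j)\<close>; the parts share one type of elements, so the degrees
  are explicit arguments of the product. There need not be a unit.\<close>

record ('r, 'b) graded_algebra =
  part :: "nat \<Rightarrow> ('r, 'b) module"
  gmult :: "nat \<Rightarrow> nat \<Rightarrow> 'b \<Rightarrow> 'b \<Rightarrow> 'b"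

definition cohomology_algebra ::
  "('r, 'm) ring_scheme \<Rightarrow> 'a topology \<Rightarrow> ('r, ('a, 'r) cochain set) graded_algebra" where
  "cohomology_algebra R X = \<lparr>part = cohomology R X, gmult = cup R X\<rparr>"

definition graded_subalgebra ::
  "('r, 'm) ring_scheme \<Rightarrow> ('r, 'b) graded_algebra \<Rightarrow> (nat \<Rightarrow> 'b set) \<Rightarrow> bool" where
  "graded_subalgebra R A S \<longleftrightarrow>
     (\<forall>d. submodule (S d) R (part A d)) \<and>
     (\<forall>i j. \<forall>a \<in> S i. \<forall>b \<in> S j. gmult A i j a b \<in> S (i + j))"

definition nontrivial_subalgebra :: "('r, 'b) graded_algebra \<Rightarrow> (nat \<Rightarrow> 'b set) \<Rightarrow> bool" where
  "nontrivial_subalgebra A S \<longleftrightarrow> (\<exists>d. S d \<noteq> {\<zero>\<^bsub>part A d\<^esub>})"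

text \<open>Internal direct sum of graded subalgebras \<open>S 1, \<dots>, S m\<close>: in each degree every element is
  uniquely a sum of elements of the \<open>S i\<close>, and multiplication is componentwise, i.e. products
  of elements of different summands vanish. For \<open>m = 0\<close> this says that \<open>A\<close> is zero.\<close>

definition internal_direct_sum ::
  "('r, 'b) graded_algebra \<Rightarrow> nat \<Rightarrow> (nat \<Rightarrow> nat \<Rightarrow> 'b set) \<Rightarrow> bool" where
  "internal_direct_sum A m S \<longleftrightarrow>
     (\<forall>d. \<forall>h \<in> carrier (part A d).
        \<exists>!s. s \<in> (\<Pi>\<^sub>E i\<in>{1..m}. S i d) \<and> h = (\<Oplus>\<^bsub>part A d\<^esub>i\<in>{1..m}. s i)) \<and>
     (\<forall>i \<in> {1..m}. \<forall>j \<in> {1..m}. i \<noteq> j \<longrightarrow>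
        (\<forall>d e. \<forall>a \<in> S i d. \<forall>b \<in> S j e. gmult A d e a b = \<zero>\<^bsub>part A (d + e)\<^esub>))"


section \<open>Periodicity\<close>

text \<open>Multiplication by \<open>x\<close> is left multiplication; by graded commutativity of the cup product
  this affects the maps only by a sign.\<close>

definition induces_periodicity ::
  "('r, 'b) graded_algebra \<Rightarrow> nat \<Rightarrow> nat \<Rightarrow> 'b \<Rightarrow> bool" where
  "induces_periodicity H n k x \<longleftrightarrow>
     3 * k \<le> n - 1 \<and> x \<in> carrier (part H k) \<and>
     (\<forall>i. 1 \<le> i \<and> i < n - 1 - k \<longrightarrow>
        gmult H k i x ` carrier (part H i) = carrier (part H (k + i))) \<and>
     (\<forall>i. 1 < i \<and> i \<le> n - 1 - k \<longrightarrow> inj_on (gmult H k i x) (carrier (part H i)))"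

text \<open>The periodic subquotient has homogeneous parts \<open>N i / K i\<close> with \<open>K i\<close> and \<open>N i\<close> as
  follows; where the definition in the literature takes no quotient, \<open>K i\<close> is the zero subspace
  and classes are singletons.\<close>

definition psq_numerator ::
  "('r, 'b) graded_algebra \<Rightarrow> nat \<Rightarrow> nat \<Rightarrow> 'b \<Rightarrow> nat \<Rightarrow> 'b set" where
  "psq_numerator H n k x i =
     (if 1 \<le> i \<and> i < n - 1 then carrier (part H i)
      else if i = n - 1 then gmult H k (n - 1 - k) x ` carrier (part H (n - 1 - k))
      else {\<zero>\<^bsub>part H i\<^esub>})"

definition psq_denominator ::
  "('r, 'b) graded_algebra \<Rightarrow> nat \<Rightarrow> 'b \<Rightarrow> nat \<Rightarrow> 'b set" where
  "psq_denominator H k x i =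
     (if i = 1 then {y \<in> carrier (part H 1). gmult H k 1 x y = \<zero>\<^bsub>part H (k + 1)\<^esub>}
      else {\<zero>\<^bsub>part H i\<^esub>})"

definition periodic_subquotient ::
  "('r, 'b) graded_algebra \<Rightarrow> nat \<Rightarrow> nat \<Rightarrow> 'b \<Rightarrow> ('r, 'b set) graded_algebra" where
  "periodic_subquotient H n k x =
     \<lparr>part = (\<lambda>i. quotient_module (part H i \<lparr>carrier := psq_numerator H n k x i\<rparr>)
                    (psq_denominator H k x i)),
      gmult = (\<lambda>i j A B.
        if i + j \<le> n - 1
        then \<Union>a\<in>A. \<Union>b\<in>B. psq_denominator H k x (i + j) +>\<^bsub>part H (i + j)\<^esub> gmult H i j a b
        else psq_denominator H k x (i + j))\<rparr>"

text \<open>For \<open>S\<close> a graded subalgebra and \<open>a\<close> of degree \<open>k\<close>. Multiplication by \<open>a\<close> is linear, so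
  bijections are isomorphisms.\<close>

definition induces_periodicity_on ::
  "('r, 'b) graded_algebra \<Rightarrow> nat \<Rightarrow> nat \<Rightarrow> 'b \<Rightarrow> (nat \<Rightarrow> 'b set) \<Rightarrow> bool" where
  "induces_periodicity_on A n k a S \<longleftrightarrow>
     (\<forall>i. 1 \<le> i \<and> i \<le> n - 1 - k \<longrightarrow> bij_betw (gmult A k i a) (S i) (S (k + i)))"

end

theory Submission
  imports Defs
begin

text \<open>
  Multiplication by \<open>x\<close> is bijective on the periodic subquotient \<open>Q\<close>, so \<open>r * s = x\<^sup>-\<^sup>1 (r s)\<close> is a
  multiplication on its part of degree \<open>k\<close>. It makes this part a commutative ring with unit \<open>x\<close>, and
  \<open>x\<^sup>-\<^sup>1 r\<close> defines an action of this ring on every degree of \<open>Q\<close>. The ring is finite, so its unit is a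
  sum of orthogonal primitive idempotents \<open>x\<^sub>1, \<dots>, x\<^sub>m\<close>, and \<open>Q\<close> splits into the images of these
  idempotents. Since the action passes through products, the images are subalgebras that annihilate
  each other. On the image of \<open>x\<^sub>i\<close> the element \<open>x\<^sub>i\<close> acts as the unit, hence multiplies as \<open>x\<close> does,
  and on the other images it acts as zero. In a finite ring the corner at a primitive idempotent is
  local, so \<open>x\<^sub>i = a + b\<close> makes \<open>a\<close> or \<open>b\<close> invertible there, and an invertible element induces
  periodicity. This is the lemma \<open>decomposition\<close> of the locale \<open>periodic_algebra\<close>; it rests on
  \<open>sum_of_primitive_idempotents\<close> and \<open>primitive_idempotent_local\<close>.

  Three facts about cohomology enter. First, the cup product is associative and bilinear and descends
  to classes. Second, it is graded commutative (\<open>int_cup_graded_commute\<close>); otherwise the ring in degree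
  \<open>k\<close> could be a matrix ring, which has no such splitting. The signs do no harm: for odd \<open>k\<close> and odd
  \<open>p\<close> they force \<open>x x = 0\<close>, hence \<open>Q = 0\<close>. Third, the cohomology of a closed manifold with
  coefficients in \<open>\<int>/p\<close> is finite in each degree (\<open>finitely_many_classes\<close>). This is where compactness
  and the manifold structure are used: by the Mayer--Vietoris argument, restriction from a
  neighbourhood of a compact set to a smaller one has finite image in cohomology, because this holds
  for small contractible sets.

  Cochains with values in \<open>\<int>/p\<close> are treated as integer valued functions on simplices modulo \<open>p\<close>, and
  identities between them are verified on lists of vertices of a simplex.
\<close>


section \<open>Primitive idempotents of a finite commutative ring\<close>

context cring
begin

definition primitive_idempotent :: "'a \<Rightarrow> bool" where
  "primitive_idempotent f \<longleftrightarrow> f \<in> carrier R \<and> f \<otimes> f = f \<and> f \<noteq> \<zero> \<and>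
     (\<forall>g \<in> carrier R. g \<otimes> g = g \<and> g \<otimes> f = g \<longrightarrow> g = \<zero> \<or> g = f)"

lemma primitive_idempotentD:
  assumes "primitive_idempotent f"
  shows "f \<in> carrier R" "f \<otimes> f = f" "f \<noteq> \<zero>"
  using assms by (auto simp: primitive_idempotent_def)

text \<open>Induction on the size of the corner \<open>e R\<close>: an idempotent that is not primitive has a proper
  sub-idempotent \<open>g\<close>, and \<open>e = g + (e - g)\<close> splits the corner into two smaller ones.\<close>

lemma sum_of_primitive_idempotents:
  assumes fin: "finite (carrier R)" and "e \<in> carrier R" "e \<otimes> e = e"
  shows "\<exists>F. finite F \<and> (\<forall>f \<in> F. primitive_idempotent f \<and> f \<otimes> e = f) \<and>
           (\<forall>f \<in> F. \<forall>g \<in> F. f \<noteq> g \<longrightarrow> f \<otimes> g = \<zero>) \<and> (\<Oplus>f\<in>F. f) = e"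
  using assms(2,3)
proof (induction "card {r \<in> carrier R. r \<otimes> e = r}" arbitrary: e rule: less_induct)
  case less
  note e = less.prems
  consider "e = \<zero>" | "primitive_idempotent e"
    | g where "g \<in> carrier R" "g \<otimes> g = g" "g \<otimes> e = g" "g \<noteq> \<zero>" "g \<noteq> e"
    using e unfolding primitive_idempotent_def by blast
  then show ?case
  proof cases
    case 1
    show ?thesis by (rule exI[of _ "{}"]) (simp add: 1)
  next
    case 2
    with e show ?thesis by (intro exI[of _ "{e}"]) simp
  next
    case (3 g)
    define h where "h = e \<ominus> g"
    have h: "h \<in> carrier R" using e 3 by (simp add: h_def)
    have gh: "g \<otimes> h = \<zero>"
      using e 3 by (simp add: h_def minus_eq r_distr r_minus r_neg)
    have eh: "e \<otimes> h = h"
      using e 3 by (simp add: h_def minus_eq r_distr r_minus m_comm)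
    have hh: "h \<otimes> h = h"
    proof -
      have "h \<otimes> h = e \<otimes> h \<ominus> g \<otimes> h"
        using e 3 h by (subst (1) h_def) (simp add: minus_eq l_distr l_minus)
      then show ?thesis using gh eh h by (simp add: minus_eq)
    qed
    have smaller: "card {r \<in> carrier R. r \<otimes> f = r} < card {r \<in> carrier R. r \<otimes> e = r}"
      if f: "f \<in> carrier R" "f \<otimes> e = f" "f \<noteq> e" for f
    proof (rule psubset_card_mono)
      show "finite {r \<in> carrier R. r \<otimes> e = r}" using fin by simp
      have "r \<otimes> e = r" if "r \<in> carrier R" "r \<otimes> f = r" for r
        using that f e by (metis m_assoc)
      moreover have "e \<otimes> f \<noteq> e" using f e by (metis m_comm)
      ultimately show "{r \<in> carrier R. r \<otimes> f = r} \<subset> {r \<in> carrier R. r \<otimes> e = r}"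
        using e by blast
    qed
    have he: "h \<otimes> e = h" using eh h e by (simp add: m_comm)
    have "h \<noteq> e"
    proof
      assume "h = e"
      then have "g \<otimes> e = \<zero>" using gh by simp
      with 3 show False by simp
    qed
    from less.hyps[OF smaller[OF \<open>g \<in> carrier R\<close> \<open>g \<otimes> e = g\<close> \<open>g \<noteq> e\<close>]] 3
    obtain F where F: "finite F" "\<forall>f \<in> F. primitive_idempotent f \<and> f \<otimes> g = f"
        "\<forall>f \<in> F. \<forall>g \<in> F. f \<noteq> g \<longrightarrow> f \<otimes> g = \<zero>" "(\<Oplus>f\<in>F. f) = g" by blast
    from less.hyps[OF smaller[OF h he \<open>h \<noteq> e\<close>] h hh]
    obtain F' where F': "finite F'" "\<forall>f \<in> F'. primitive_idempotent f \<and> f \<otimes> h = f"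
        "\<forall>f \<in> F'. \<forall>g \<in> F'. f \<noteq> g \<longrightarrow> f \<otimes> g = \<zero>" "(\<Oplus>f\<in>F'. f) = h" by blast
    have carr: "f \<in> carrier R" if "f \<in> F \<union> F'" for f
      using that F(2) F'(2) primitive_idempotentD by blast
    have orth: "f \<otimes> f' = \<zero>" if "f \<in> F" "f' \<in> F'" for f f'
    proof -
      have cc: "f \<in> carrier R" "f' \<in> carrier R" using that carr by auto
      have "f \<otimes> f' = (f \<otimes> g) \<otimes> (f' \<otimes> h)" using that F(2) F'(2) by simp
      also have "\<dots> = (f \<otimes> f') \<otimes> (g \<otimes> h)"
        using cc 3 h by (simp add: m_ac)
      also have "\<dots> = \<zero>" using gh cc by simp
      finally show ?thesis .
    qed
    have disj: "F \<inter> F' = {}"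
    proof -
      have False if "f \<in> F" "f \<in> F'" for f
        using orth[OF that] F(2) that(1) primitive_idempotentD by metis
      then show ?thesis by blast
    qed
    show ?thesis
    proof (intro exI[of _ "F \<union> F'"] conjI ballI impI)
      show "finite (F \<union> F')" using F F' by simp
      show "primitive_idempotent f" if "f \<in> F \<union> F'" for f using that F(2) F'(2) by blast
      show "f \<otimes> e = f" if "f \<in> F \<union> F'" for f
        using that F(2) F'(2) carr[OF that] 3 e h he by (metis Un_iff m_assoc)
      show "f \<otimes> g' = \<zero>" if "f \<in> F \<union> F'" "g' \<in> F \<union> F'" "f \<noteq> g'" for f g'
        using that F(3) F'(3) orth carr by (metis Un_iff m_comm)
      have "(\<Oplus>f\<in>F \<union> F'. f) = g \<oplus> h"
        using finsum_Un_disjoint[OF F(1) F'(1) disj, of "\<lambda>f. f"] carr F(4) F'(4) by auto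
      also have "\<dots> = e"
        using e 3 by (simp add: h_def minus_eq r_neg2 a_lcomm r_neg)
      finally show "(\<Oplus>f\<in>F \<union> F'. f) = e" .
    qed
  qed
qed

text \<open>By finiteness the powers of \<open>a\<close> are eventually periodic. An exponent that is a multiple of the
  period and lies beyond the preperiod gives an idempotent.\<close>

lemma idempotent_power_exists:
  assumes fin: "finite (carrier R)" and a: "a \<in> carrier R"
  shows "\<exists>N \<ge> (1::nat). a [^] N \<otimes> a [^] N = a [^] N"
proof -
  have "\<not> inj_on (\<lambda>i::nat. a [^] i) UNIV"
    using fin a by (metis (no_types, lifting) finite_subset image_subsetI nat_pow_closed range_inj_infinite)
  then obtain i j :: nat where ij: "i < j" "a [^] i = a [^] j"
    by (metis (no_types, lifting) injI linorder_neqE_nat)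
  define d where "d = j - i"
  have per1: "a [^] (m + d) = a [^] m" if "i \<le> m" for m
  proof -
    have "a [^] (m + d) = a [^] (m - i) \<otimes> a [^] j"
      using that ij a by (simp add: d_def nat_pow_mult)
    also have "\<dots> = a [^] m" using that a ij(2)[symmetric] by (simp add: nat_pow_mult)
    finally show ?thesis .
  qed
  have per: "a [^] (m + l * d) = a [^] m" if "i \<le> m" for m l
  proof (induction l)
    case (Suc l)
    have "a [^] (m + Suc l * d) = a [^] ((m + l * d) + d)" by (simp add: algebra_simps)
    also have "\<dots> = a [^] (m + l * d)" using that by (intro per1) simp
    finally show ?case using Suc by simp
  qed simp
  \<comment> \<open>A multiple of the period \<open>d\<close> that is at least \<open>i\<close>.\<close>
  define N where "N = Suc i * d"
  have "d \<ge> 1" using ij by (simp add: d_def)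
  have "Suc i * 1 \<le> Suc i * d" using \<open>d \<ge> 1\<close> by (intro mult_le_mono) auto
  then have "i \<le> N" "N \<ge> 1" by (auto simp: N_def)
  then show ?thesis using per[of N "Suc i"] a by (intro exI[of _ N]) (simp add: nat_pow_mult N_def)
qed

text \<open>A corner \<open>f R\<close> at a primitive idempotent of a finite ring is local: some power of \<open>a f\<close> is an
  idempotent of the corner, so \<open>a f\<close> is a unit of the corner or nilpotent, and in the latter case
  \<open>f - a f\<close> is a unit by the geometric series.\<close>

lemma primitive_idempotent_local:
  assumes fin: "finite (carrier R)" and f: "primitive_idempotent f"
    and ab: "a \<in> carrier R" "b \<in> carrier R" "f = a \<oplus> b"
  shows "(\<exists>c \<in> carrier R. a \<otimes> c \<otimes> f = f) \<or> (\<exists>c \<in> carrier R. b \<otimes> c \<otimes> f = f)"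
proof -
  have fR: "f \<in> carrier R" "f \<otimes> f = f" using primitive_idempotentD[OF f] by auto
  define s where "s = a \<otimes> f"
  have s: "s \<in> carrier R" "s \<otimes> f = s" using ab fR by (auto simp: s_def m_assoc)
  have bf: "b \<otimes> f = f \<ominus> s"
  proof -
    have "f = s \<oplus> b \<otimes> f" using ab fR by (metis l_distr s_def)
    then show ?thesis
      using ab s fR by (metis a_minus_def add.inv_solve_left m_closed a_comm add.m_closed a_inv_closed)
  qed
  obtain N :: nat where N: "N \<ge> 1" "s [^] N \<otimes> s [^] N = s [^] N"
    using idempotent_power_exists[OF fin s(1)] by blast
  obtain N' where N': "N = Suc N'" using N(1) by (cases N) auto
  have "s [^] N \<otimes> f = s [^] N" using s fR by (simp add: N' m_assoc)
  then have "s [^] N = \<zero> \<or> s [^] N = f"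
    using f N(2) s unfolding primitive_idempotent_def by simp
  then show ?thesis
  proof
    assume "s [^] N = f"
    then have "a \<otimes> s [^] N' \<otimes> f = f"
      using N' ab fR s by (simp add: s_def m_ac)
    then show ?thesis using s by blast
  next
    assume z: "s [^] N = \<zero>"
    have geo: "\<exists>c \<in> carrier R. (f \<ominus> s) \<otimes> c = f \<ominus> s [^] Suc n" for n
    proof (induction n)
      case 0
      have "(f \<ominus> s) \<otimes> f = f \<ominus> s" using s fR by (simp add: minus_eq l_distr l_minus)
      then show ?case using fR s by auto
    next
      case (Suc n)
      then obtain c where c: "c \<in> carrier R" "(f \<ominus> s) \<otimes> c = f \<ominus> s [^] Suc n" by blast
      have fs: "f \<otimes> s [^] Suc n = s [^] Suc n"
        using s fR by (metis m_assoc m_comm nat_pow_Suc nat_pow_closed)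
      have "(f \<ominus> s) \<otimes> (c \<oplus> s [^] Suc n) = (f \<ominus> s [^] Suc n) \<oplus> (f \<otimes> s [^] Suc n \<ominus> s \<otimes> s [^] Suc n)"
        using c s fR by (simp add: r_distr l_distr minus_eq l_minus del: nat_pow_Suc)
      also have "\<dots> = f \<ominus> s \<otimes> s [^] Suc n"
        using s fR unfolding fs by (simp add: minus_eq a_assoc l_neg r_neg1 del: nat_pow_Suc)
      also have "\<dots> = f \<ominus> s [^] Suc (Suc n)" using s by (metis m_comm nat_pow_Suc nat_pow_closed)
      finally show ?case using c s by (meson add.m_closed nat_pow_closed)
    qed
    from geo[of N'] obtain c where c: "c \<in> carrier R" "(f \<ominus> s) \<otimes> c = f \<ominus> s [^] N"
      unfolding N' by blast
    then have "b \<otimes> f \<otimes> c = f" using z fR bf by (simp add: minus_eq)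
    then have "b \<otimes> c \<otimes> f = f" using c ab fR by (simp add: m_ac)
    then show ?thesis using c by blast
  qed
qed

end

section \<open>Decomposing a periodic graded algebra\<close>

locale graded_commutative_algebra = R: cring R for R :: "('r, 'm) ring_scheme" (structure) +
  fixes A :: "('r, 'b) graded_algebra"
  assumes part_module: "\<And>d. module R (part A d)"
    and gmult_closed: "\<And>i j a b. \<lbrakk>a \<in> carrier (part A i); b \<in> carrier (part A j)\<rbrakk>
          \<Longrightarrow> gmult A i j a b \<in> carrier (part A (i + j))"
    and gmult_l_distr: "\<And>i j a a' b.
          \<lbrakk>a \<in> carrier (part A i); a' \<in> carrier (part A i); b \<in> carrier (part A j)\<rbrakk>
          \<Longrightarrow> gmult A i j (a \<oplus>\<^bsub>part A i\<^esub> a') b = gmult A i j a b \<oplus>\<^bsub>part A (i + j)\<^esub> gmult A i j a' b"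
    and gmult_r_distr: "\<And>i j a b b'.
          \<lbrakk>a \<in> carrier (part A i); b \<in> carrier (part A j); b' \<in> carrier (part A j)\<rbrakk>
          \<Longrightarrow> gmult A i j a (b \<oplus>\<^bsub>part A j\<^esub> b') = gmult A i j a b \<oplus>\<^bsub>part A (i + j)\<^esub> gmult A i j a b'"
    and gmult_smult: "\<And>i j r a b.
          \<lbrakk>r \<in> carrier R; a \<in> carrier (part A i); b \<in> carrier (part A j)\<rbrakk>
          \<Longrightarrow> gmult A i j a (r \<odot>\<^bsub>part A j\<^esub> b) = r \<odot>\<^bsub>part A (i + j)\<^esub> gmult A i j a b"
    and gmult_assoc: "\<And>i j l a b c.
          \<lbrakk>a \<in> carrier (part A i); b \<in> carrier (part A j); c \<in> carrier (part A l)\<rbrakk>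
          \<Longrightarrow> gmult A (i + j) l (gmult A i j a b) c = gmult A i (j + l) a (gmult A j l b c)"
    and gmult_commute: "\<And>i j a b.
          \<lbrakk>a \<in> carrier (part A i); b \<in> carrier (part A j)\<rbrakk>
          \<Longrightarrow> gmult A i j a b =
              (if even (i * j) then gmult A j i b a else \<ominus>\<^bsub>part A (i + j)\<^esub> gmult A j i b a)"
begin

sublocale M: module R "part A d" for d
  by (rule part_module)

lemma gmult_r_null [simp]:
  assumes "a \<in> carrier (part A i)"
  shows "gmult A i j a \<zero>\<^bsub>part A j\<^esub> = \<zero>\<^bsub>part A (i + j)\<^esub>"
proof -
  have "gmult A i j a \<zero>\<^bsub>part A j\<^esub> \<oplus>\<^bsub>part A (i + j)\<^esub> gmult A i j a \<zero>\<^bsub>part A j\<^esub> = gmult A i j a \<zero>\<^bsub>part A j\<^esub>"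
    using gmult_r_distr[OF assms M.zero_closed M.zero_closed, of j] by simp
  then show ?thesis
    using gmult_closed[OF assms M.zero_closed] M.add.l_cancel_one by blast
qed

lemma gmult_l_null [simp]:
  assumes "b \<in> carrier (part A j)"
  shows "gmult A i j \<zero>\<^bsub>part A i\<^esub> b = \<zero>\<^bsub>part A (i + j)\<^esub>"
proof -
  have "gmult A i j \<zero>\<^bsub>part A i\<^esub> b \<oplus>\<^bsub>part A (i + j)\<^esub> gmult A i j \<zero>\<^bsub>part A i\<^esub> b = gmult A i j \<zero>\<^bsub>part A i\<^esub> b"
    using gmult_l_distr[OF M.zero_closed M.zero_closed assms, of i] by simp
  then show ?thesis
    using gmult_closed[OF M.zero_closed assms] M.add.l_cancel_one by blast
qed

end

text \<open>The properties of the periodic subquotient from which the decomposition follows. Products of total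
  degree above \<open>n - 1\<close> vanish because the parts in these degrees are zero.\<close>

locale periodic_algebra = graded_commutative_algebra R A + K: field R
  for R :: "('r, 'm) ring_scheme" (structure) and A :: "('r, 'b) graded_algebra" +
  fixes n k :: nat and x :: 'b
  assumes k_pos: "1 \<le> k" and k_small: "3 * k \<le> n - 1"
    and x_closed: "x \<in> carrier (part A k)"
    and x_bij: "\<And>d. \<lbrakk>1 \<le> d; d \<le> n - 1 - k\<rbrakk>
          \<Longrightarrow> bij_betw (gmult A k d x) (carrier (part A d)) (carrier (part A (k + d)))"
    and outside: "\<And>d. d = 0 \<or> n \<le> d \<Longrightarrow> carrier (part A d) = {\<zero>\<^bsub>part A d\<^esub>}"
    and finite_degree_k: "finite (carrier (part A k))"

text \<open>The sign in graded commutativity has no effect in degree \<open>k\<close>: if \<open>k\<close> is odd and the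
  characteristic is not 2, then \<open>x x = - x x\<close> forces \<open>x = 0\<close>, and periodicity makes the whole
  algebra zero.\<close>

locale strict_periodic_algebra = periodic_algebra R A n k x
  for R :: "('r, 'm) ring_scheme" (structure) and A :: "('r, 'b) graded_algebra"
    and n k :: nat and x :: 'b +
  assumes strict_commute: "\<And>d r y. \<lbrakk>r \<in> carrier (part A k); y \<in> carrier (part A d)\<rbrakk>
          \<Longrightarrow> gmult A k d r y = gmult A d k y r"
begin

lemma strict_commute_assoc:
  assumes "r \<in> carrier (part A k)" "s \<in> carrier (part A k)" "y \<in> carrier (part A d)"
  shows "gmult A k (k + d) r (gmult A k d s y) = gmult A k (k + d) s (gmult A k d r y)"
  using assms gmult_assoc strict_commute by metis

lemma x_cancel:
  assumes "1 \<le> d" "d \<le> n - 1 - k" "y \<in> carrier (part A d)" "z \<in> carrier (part A d)"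
    "gmult A k d x y = gmult A k d x z"
  shows "y = z"
  using x_bij[OF assms(1,2)] assms(3-5) by (meson bij_betw_def inj_onD)

lemma x_divides:
  assumes "1 \<le> d" "d \<le> n - 1 - k" "y \<in> carrier (part A (k + d))"
  obtains z where "z \<in> carrier (part A d)" "y = gmult A k d x z"
  using x_bij[OF assms(1,2)] assms(3) by (auto simp: bij_betw_def image_iff)

text \<open>The action of \<open>r\<close> in degree \<open>k\<close> on degree \<open>d\<close> given by \<open>x\<^sup>-\<^sup>1 r\<close>. In the top degrees, where
  multiplication by \<open>r\<close> leaves the range, it is computed as \<open>r x\<^sup>-\<^sup>1\<close>.\<close>

definition act :: "nat \<Rightarrow> 'b \<Rightarrow> 'b \<Rightarrow> 'b" where
  "act d r h =
     (if d = 0 \<or> n \<le> d then \<zero>\<^bsub>part A d\<^esub>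
      else if d \<le> n - 1 - k then inv_into (carrier (part A d)) (gmult A k d x) (gmult A k d r h)
      else gmult A k (d - k) r (inv_into (carrier (part A (d - k))) (gmult A k (d - k) x) h))"

lemma act_low:
  assumes "1 \<le> d" "d \<le> n - 1 - k" "r \<in> carrier (part A k)" "h \<in> carrier (part A d)"
  shows "act d r h \<in> carrier (part A d)" "gmult A k d x (act d r h) = gmult A k d r h"
proof -
  have *: "gmult A k d r h \<in> gmult A k d x ` carrier (part A d)"
    using x_bij[OF assms(1,2)] gmult_closed[OF assms(3,4)] by (simp add: bij_betw_def)
  have "act d r h = inv_into (carrier (part A d)) (gmult A k d x) (gmult A k d r h)"
    using assms(1,2) by (auto simp: act_def)
  then show "act d r h \<in> carrier (part A d)" "gmult A k d x (act d r h) = gmult A k d r h"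
    using inv_into_into[OF *] f_inv_into_f[OF *] by auto
qed

text \<open>Where both descriptions of the action apply they agree, because multiplications by elements of
  degree \<open>k\<close> commute with each other.\<close>

lemma act_shift:
  assumes d: "1 \<le> d" "d \<le> n - 1 - k" and r: "r \<in> carrier (part A k)" and h: "h \<in> carrier (part A d)"
  shows "act (k + d) r (gmult A k d x h) = gmult A k d r h"
proof (cases "k + d \<le> n - 1 - k")
  case True
  have xh: "gmult A k d x h \<in> carrier (part A (k + d))"
    using x_closed h by (rule gmult_closed)
  show ?thesis
  proof (rule x_cancel[OF _ True])
    show "gmult A k (k + d) x (act (k + d) r (gmult A k d x h)) = gmult A k (k + d) x (gmult A k d r h)"
      using act_low(2)[OF _ True r xh] d strict_commute_assoc[OF r x_closed h] by simp
  qed (use d act_low(1)[OF _ True r xh] gmult_closed[OF r h] in auto)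
next
  case False
  have "inj_on (gmult A k d x) (carrier (part A d))"
    using x_bij[OF d] by (simp add: bij_betw_def)
  moreover have "\<not> n \<le> k + d" using d k_small k_pos by linarith
  ultimately show ?thesis using False d h k_pos by (simp add: act_def)
qed


lemma degree_cases:
  obtains "d = 0 \<or> n \<le> d" | "1 \<le> d" "d \<le> k" "d \<le> n - 1 - k" "k + d \<le> n - 1 - k"
    | e where "d = k + e" "1 \<le> e" "e \<le> n - 1 - k"
proof -
  consider "d = 0 \<or> n \<le> d" | "1 \<le> d" "d \<le> k" | "d < n" "k < d" by linarith
  then show ?thesis
  proof cases
    case 1 then show ?thesis by (rule that(1))
  next
    case 2 then show ?thesis using k_small by (intro that(2)) linarith+
  next
    case 3 then show ?thesis using k_small by (intro that(3)[of "d - k"]) linarith+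
  qed
qed

text \<open>Every degree in the range is a translate by multiples of \<open>k\<close> of a degree between \<open>1\<close> and \<open>k\<close>,
  where multiplication by \<open>x\<close> can be performed twice.\<close>

lemma periodic_induct [consumes 1, case_names outside base step]:
  assumes h: "h \<in> carrier (part A d)"
    and "\<And>d. d = 0 \<or> n \<le> d \<Longrightarrow> P d \<zero>\<^bsub>part A d\<^esub>"
    and "\<And>d h. \<lbrakk>1 \<le> d; d \<le> n - 1 - k; k + d \<le> n - 1 - k; h \<in> carrier (part A d)\<rbrakk> \<Longrightarrow> P d h"
    and step: "\<And>d h. \<lbrakk>1 \<le> d; d \<le> n - 1 - k; h \<in> carrier (part A d); P d h\<rbrakk>
           \<Longrightarrow> P (k + d) (gmult A k d x h)"
  shows "P d h"
  using h
proof (induction d arbitrary: h rule: less_induct)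
  case (less d)
  show ?case
  proof (cases d rule: degree_cases)
    case 1
    then have "h = \<zero>\<^bsub>part A d\<^esub>" using outside less.prems by auto
    with assms(2)[OF 1] show ?thesis by simp
  next
    case 2 with assms(3) less.prems show ?thesis by simp
  next
    case (3 e)
    then obtain g where "g \<in> carrier (part A e)" "h = gmult A k e x g"
      using x_divides less.prems by metis
    then show ?thesis using less.IH[of e g] step 3 k_pos by simp
  qed
qed

lemma act_outside [simp]: "d = 0 \<or> n \<le> d \<Longrightarrow> act d r h = \<zero>\<^bsub>part A d\<^esub>"
  by (auto simp: act_def)

lemma act_closed [simp]:
  assumes r: "r \<in> carrier (part A k)" and h: "h \<in> carrier (part A d)"
  shows "act d r h \<in> carrier (part A d)"
  using h by (induction rule: periodic_induct) (use r in \<open>auto simp: act_low act_shift gmult_closed\<close>)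

lemma act_x_mult:
  assumes "1 \<le> d" "d \<le> n - 1 - k" "r \<in> carrier (part A k)" "h \<in> carrier (part A d)"
  shows "act (k + d) r (gmult A k d x h) = gmult A k d x (act d r h)"
  using act_shift[OF assms] act_low(2)[OF assms] by (metis)

lemma act_unit: "h \<in> carrier (part A d) \<Longrightarrow> act d x h = h"
proof (induction rule: periodic_induct)
  case (base d h)
  then show ?case by - (rule x_cancel[of d], simp_all add: act_low x_closed)
qed (simp_all add: act_shift x_closed)

lemma act_l_distr:
  assumes "h \<in> carrier (part A d)" "r \<in> carrier (part A k)" "s \<in> carrier (part A k)"
  shows "act d (r \<oplus>\<^bsub>part A k\<^esub> s) h = act d r h \<oplus>\<^bsub>part A d\<^esub> act d s h"
  using assms(1)
proof (induction rule: periodic_induct)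
  case (base d h)
  then show ?case using assms(2,3)
    by - (rule x_cancel[of d], simp_all add: act_low gmult_r_distr gmult_l_distr x_closed)
next
  case (step d h)
  then show ?case using assms(2,3) by (simp add: act_shift gmult_l_distr)
qed auto

lemma act_r_distr:
  assumes h: "h \<in> carrier (part A d)" and g: "g \<in> carrier (part A d)" and r: "r \<in> carrier (part A k)"
  shows "act d r (h \<oplus>\<^bsub>part A d\<^esub> g) = act d r h \<oplus>\<^bsub>part A d\<^esub> act d r g"
proof (cases d rule: degree_cases)
  case 1
  then show ?thesis using assms by (simp add: outside)
next
  case 2
  then show ?thesis using assms
    by - (rule x_cancel[of d], simp_all add: act_low gmult_r_distr x_closed)
next
  case (3 e)
  obtain h' g' where "h' \<in> carrier (part A e)" "h = gmult A k e x h'"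
    "g' \<in> carrier (part A e)" "g = gmult A k e x g'"
    using 3 h g x_divides by metis
  then show ?thesis
    using 3 r by (simp add: act_shift gmult_r_distr[OF x_closed, symmetric])
      (simp add: gmult_r_distr r)
qed

lemma act_smult:
  assumes h: "h \<in> carrier (part A d)" and c: "c \<in> carrier R" and r: "r \<in> carrier (part A k)"
  shows "act d r (c \<odot>\<^bsub>part A d\<^esub> h) = c \<odot>\<^bsub>part A d\<^esub> act d r h"
proof (cases d rule: degree_cases)
  case 1
  then show ?thesis using assms by (simp add: outside)
next
  case 2
  then show ?thesis using assms
    by - (rule x_cancel[of d], simp_all add: act_low gmult_smult x_closed)
next
  case (3 e)
  obtain h' where "h' \<in> carrier (part A e)" "h = gmult A k e x h'"
    using 3 h x_divides by metis
  then show ?thesis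
    using 3 r c by (simp add: act_shift gmult_smult[OF _ x_closed, symmetric])
      (simp add: gmult_smult r)
qed

text \<open>In the low degrees, multiplying by \<open>x\<close> twice turns both sides into \<open>r s h\<close>.\<close>

lemma act_act:
  assumes "h \<in> carrier (part A d)" "r \<in> carrier (part A k)" "s \<in> carrier (part A k)"
  shows "act d r (act d s h) = act d (act k r s) h"
  using assms(1)
proof (induction rule: periodic_induct)
  case (base d h)
  have kN: "1 \<le> k" "k \<le> n - 1 - k" using k_pos k_small by linarith+
  note cl = assms(2,3) x_closed base
  let ?xx = "\<lambda>h. gmult A k (k + d) x (gmult A k d x h)"
  have "?xx (act d r (act d s h)) = gmult A k (k + d) r (gmult A k d s h)"
    using cl by (simp add: act_low strict_commute_assoc)
  also have "\<dots> = gmult A (k + k) d (gmult A k k r s) h"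
    using cl by (simp add: gmult_assoc)
  also have "\<dots> = gmult A (k + k) d (gmult A k k x (act k r s)) h"
    using cl kN act_low(2)[of k r s] by simp
  also have "\<dots> = ?xx (act d (act k r s) h)"
    using cl kN gmult_assoc[of x k "act k r s" k h d] act_low(2)[of d "act k r s" h] by simp
  finally have "gmult A k d x (act d r (act d s h)) = gmult A k d x (act d (act k r s) h)"
    using cl by - (rule x_cancel[of "k + d"], auto intro: gmult_closed)
  then show ?case using cl by - (rule x_cancel[of d], auto)
next
  case (step d h)
  then show ?case using assms(2,3) by (simp add: act_x_mult)
qed auto

lemma act_commute:
  assumes "r \<in> carrier (part A k)" "s \<in> carrier (part A k)"
  shows "act k r s = act k s r"
proof -
  have "1 \<le> k" "k \<le> n - 1 - k" using k_pos k_small by linarith+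
  then show ?thesis
    using assms act_low strict_commute[of r s k] by - (rule x_cancel[of k], auto)
qed

lemma act_null [simp]:
  assumes "r \<in> carrier (part A k)"
  shows "act d r \<zero>\<^bsub>part A d\<^esub> = \<zero>\<^bsub>part A d\<^esub>"
proof -
  have "act d r \<zero>\<^bsub>part A d\<^esub> \<oplus>\<^bsub>part A d\<^esub> act d r \<zero>\<^bsub>part A d\<^esub> = act d r \<zero>\<^bsub>part A d\<^esub>"
    using act_r_distr[OF M.zero_closed M.zero_closed assms, of d] by simp
  then show ?thesis
    using act_closed[OF assms M.zero_closed] M.add.l_cancel_one by blast
qed

lemma act_null_left [simp]:
  assumes "h \<in> carrier (part A d)"
  shows "act d \<zero>\<^bsub>part A k\<^esub> h = \<zero>\<^bsub>part A d\<^esub>"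
proof -
  have "act d \<zero>\<^bsub>part A k\<^esub> h \<oplus>\<^bsub>part A d\<^esub> act d \<zero>\<^bsub>part A k\<^esub> h = act d \<zero>\<^bsub>part A k\<^esub> h"
    using act_l_distr[OF assms M.zero_closed M.zero_closed] by simp
  then show ?thesis
    using act_closed[OF M.zero_closed assms] M.add.l_cancel_one by blast
qed

text \<open>If the product lies in a degree above \<open>n - 1 - k\<close>, then it cannot be multiplied by \<open>x\<close> any more. But
  this bound is at least \<open>2 k\<close>, so one of the two factors has degree above \<open>k\<close> and is therefore itself
  a multiple of \<open>x\<close>; this \<open>x\<close> is moved to the front and replaced by \<open>r\<close>.\<close>

lemma act_gmult:
  assumes r: "r \<in> carrier (part A k)" and y: "y \<in> carrier (part A d)" and z: "z \<in> carrier (part A e)"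
    and de: "1 \<le> d" "1 \<le> e" "d + e \<le> n - 1"
  shows "act (d + e) r (gmult A d e y z) = gmult A d e (act d r y) z" (is ?l)
    and "act (d + e) r (gmult A d e y z) = gmult A d e y (act e r z)" (is ?r)
proof -
  have yr: "gmult A (d + k) e' (gmult A d k y s) z = gmult A (k + d) e' (gmult A k d s y) z"
    if "s \<in> carrier (part A k)" for s e' z
    using strict_commute[OF that y] by (simp add: add.commute)
  have swap: "gmult A d (k + e') y (gmult A k e' s z) = gmult A k (d + e') s (gmult A d e' y z)"
    if "s \<in> carrier (part A k)" "z \<in> carrier (part A e')" for s e' z
    using gmult_assoc[OF y that] gmult_assoc[OF that(1) y that(2)] yr[OF that(1)] by simp
  consider "d + e \<le> n - 1 - k" "d \<le> n - 1 - k" "e \<le> n - 1 - k"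
    | d' where "d = k + d'" "1 \<le> d'" "d' \<le> n - 1 - k" "e \<le> n - 1 - k" "d' + e \<le> n - 1 - k"
    | e' where "e = k + e'" "1 \<le> e'" "e' \<le> n - 1 - k" "d \<le> n - 1 - k" "d + e' \<le> n - 1 - k"
  proof -
    have "d + e \<le> n - 1 - k \<or> k < d \<or> k < e" using k_small by linarith
    then show thesis
    proof (elim disjE)
      assume "k < d" then show thesis using that(2)[of "d - k"] de by linarith
    next
      assume "k < e" then show thesis using that(3)[of "e - k"] de by linarith
    qed (use that(1) in linarith)
  qed
  note cases = this
  have lr: "?l \<and> ?r"
  proof (cases rule: cases)
    case 1
    have c: "act (d + e) r (gmult A d e y z) \<in> carrier (part A (d + e))"
      "gmult A d e (act d r y) z \<in> carrier (part A (d + e))"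
      "gmult A d e y (act e r z) \<in> carrier (part A (d + e))"
      using r y z by (auto intro!: act_closed gmult_closed)
    have "gmult A k (d + e) x (act (d + e) r (gmult A d e y z)) = gmult A k (d + e) r (gmult A d e y z)"
      using 1 r y z de by (simp add: act_low gmult_closed)
    moreover have "\<dots> = gmult A k (d + e) x (gmult A d e (act d r y) z)"
      using 1 r y z de x_closed gmult_assoc[of r k y d z e] gmult_assoc[of x k "act d r y" d z e]
      by (simp add: act_low)
    moreover have "gmult A k (d + e) r (gmult A d e y z) = gmult A k (d + e) x (gmult A d e y (act e r z))"
      using 1 r z de x_closed swap[of r z e] swap[of x "act e r z" e] by (simp add: act_low)
    ultimately show ?thesis using 1 de c x_cancel[of "d + e"] by simp
  next
    case (2 d')
    obtain y' where y': "y' \<in> carrier (part A d')" "y = gmult A k d' x y'"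
      using x_divides y 2 by metis
    have y'c: "gmult A d' k y' s = gmult A k d' s y'" if "s \<in> carrier (part A k)" for s
      using strict_commute[OF that y'(1)] by simp
    have sw: "gmult A d' (k + e) y' (gmult A k e s z) = gmult A k (d' + e) s (gmult A d' e y' z)"
      if "s \<in> carrier (part A k)" "z \<in> carrier (part A e)" for s z
      using gmult_assoc[OF y'(1) that] gmult_assoc[OF that(1) y'(1) that(2)] y'c[OF that(1)]
      by (simp add: add.commute)
    have "gmult A d e y z = gmult A k (d' + e) x (gmult A d' e y' z)"
      using y' z 2 x_closed by (simp add: gmult_assoc)
    then have lhs: "act (d + e) r (gmult A d e y z) = gmult A k (d' + e) r (gmult A d' e y' z)"
      using act_shift[of "d' + e" r "gmult A d' e y' z"] 2 y' z r by (simp add: gmult_closed add.assoc)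
    have "gmult A d e (act d r y) z = gmult A k (d' + e) r (gmult A d' e y' z)"
      using y' z 2 r by (simp add: act_shift gmult_assoc)
    moreover have "gmult A d e y (act e r z) = gmult A k (d' + e) x (gmult A d' e y' (act e r z))"
      using y' z 2 r x_closed by (simp add: gmult_assoc)
    moreover have "\<dots> = gmult A k (d' + e) r (gmult A d' e y' z)"
      using sw[OF x_closed, of "act e r z"] sw[OF r z] r z 2 de by (simp add: act_low)
    ultimately show ?thesis using lhs by simp
  next
    case (3 e')
    obtain z' where z': "z' \<in> carrier (part A e')" "z = gmult A k e' x z'"
      using x_divides z 3 by metis
    have "gmult A d e y z = gmult A k (d + e') x (gmult A d e' y z')"
      using swap[OF x_closed z'(1)] z' 3 by simp
    then have lhs: "act (d + e) r (gmult A d e y z) = gmult A k (d + e') r (gmult A d e' y z')"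
      using act_shift[of "d + e'" r "gmult A d e' y z'"] 3 y z' r by (simp add: gmult_closed ac_simps)
    have "gmult A d e y (act e r z) = gmult A k (d + e') r (gmult A d e' y z')"
      using z' 3 r swap[OF r z'(1)] by (simp add: act_shift)
    moreover have "gmult A d e (act d r y) z = gmult A (k + d) e' (gmult A k d x (act d r y)) z'"
      using gmult_assoc[of "act d r y" d x k z' e'] strict_commute[OF x_closed, of "act d r y" d]
        r y z' x_closed 3 by (simp add: add.commute)
    moreover have "\<dots> = gmult A k (d + e') r (gmult A d e' y z')"
      using r y z' 3 de by (simp add: act_low gmult_assoc)
    ultimately show ?thesis using lhs by simp
  qed
  then show ?l ?r by auto
qed

end

definition periodic_decomposition ::
  "('r, 'm) ring_scheme \<Rightarrow> ('r, 'b) graded_algebra \<Rightarrow> nat \<Rightarrow> nat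
     \<Rightarrow> nat \<Rightarrow> (nat \<Rightarrow> 'b) \<Rightarrow> (nat \<Rightarrow> nat \<Rightarrow> 'b set) \<Rightarrow> bool" where
  "periodic_decomposition R A n k m xs S \<longleftrightarrow>
      (\<forall>i \<in> {1..m}. xs i \<in> carrier (part A k)) \<and>
      (\<forall>i \<in> {1..m}. graded_subalgebra R A (S i) \<and> nontrivial_subalgebra A (S i)) \<and>
      internal_direct_sum A m S \<and>
      (\<forall>i \<in> {1..m}. induces_periodicity_on A n k (xs i) (S i) \<and>
         (\<forall>j \<in> {1..m}. j \<noteq> i \<longrightarrow>
            (\<forall>d. \<forall>s \<in> S j d. gmult A k d (xs i) s = \<zero>\<^bsub>part A (k + d)\<^esub>))) \<and>
      (\<forall>i \<in> {1..m}. \<forall>a \<in> carrier (part A k). \<forall>b \<in> carrier (part A k).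
         xs i = a \<oplus>\<^bsub>part A k\<^esub> b \<longrightarrow>
           induces_periodicity_on A n k a (S i) \<or> induces_periodicity_on A n k b (S i))"


context strict_periodic_algebra
begin

text \<open>The commutative ring on the part of degree \<open>k\<close> whose primitive idempotents give the decomposition.\<close>

definition degree_ring :: "'b ring" where
  "degree_ring = \<lparr>carrier = carrier (part A k), monoid.mult = act k, one = x,
     ring.zero = \<zero>\<^bsub>part A k\<^esub>, ring.add = (\<oplus>\<^bsub>part A k\<^esub>)\<rparr>"

lemma degree_ring_simps [simp]:
  "carrier degree_ring = carrier (part A k)" "monoid.mult degree_ring = act k"
  "\<one>\<^bsub>degree_ring\<^esub> = x" "\<zero>\<^bsub>degree_ring\<^esub> = \<zero>\<^bsub>part A k\<^esub>"
  "ring.add degree_ring = (\<oplus>\<^bsub>part A k\<^esub>)"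
  by (simp_all add: degree_ring_def)

lemma cring_degree_ring: "cring degree_ring"
proof (rule cringI)
  show "abelian_group degree_ring"
  proof (rule abelian_groupI)
    show "\<exists>y\<in>carrier degree_ring. y \<oplus>\<^bsub>degree_ring\<^esub> a = \<zero>\<^bsub>degree_ring\<^esub>"
      if "a \<in> carrier degree_ring" for a
      using that M.l_neg[of a k] by (intro bexI[of _ "\<ominus>\<^bsub>part A k\<^esub> a"]) auto
  qed (auto simp: M.a_ac)
  show "comm_monoid degree_ring"
  proof (rule comm_monoidI)
    show "a \<otimes>\<^bsub>degree_ring\<^esub> b = b \<otimes>\<^bsub>degree_ring\<^esub> a"
      if "a \<in> carrier degree_ring" "b \<in> carrier degree_ring" for a b
      using that act_commute by simp
  qed (simp_all add: x_closed act_unit act_act)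
qed (simp add: act_l_distr)

sublocale D: cring degree_ring
  by (rule cring_degree_ring)

lemma finsum_degree_ring: "finsum degree_ring f F = finsum (part A k) f F"
  by (simp add: finsum_def finprod_def degree_ring_def foldD_def)

lemma act_finsum_left:
  assumes "finite F" "\<And>i. i \<in> F \<Longrightarrow> e i \<in> carrier (part A k)" "h \<in> carrier (part A d)"
  shows "act d (\<Oplus>\<^bsub>part A k\<^esub>i\<in>F. e i) h = (\<Oplus>\<^bsub>part A d\<^esub>i\<in>F. act d (e i) h)"
  using assms(1,2)
proof (induction F rule: finite_induct)
  case (insert i F)
  then show ?case using assms(3)
    by (simp add: M.finsum_insert act_l_distr Pi_def M.finsum_closed)
qed (use assms(3) in simp)

lemma act_finsum_right:
  assumes "finite F" "\<And>i. i \<in> F \<Longrightarrow> s i \<in> carrier (part A d)" "r \<in> carrier (part A k)"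
  shows "act d r (\<Oplus>\<^bsub>part A d\<^esub>i\<in>F. s i) = (\<Oplus>\<^bsub>part A d\<^esub>i\<in>F. act d r (s i))"
  using assms(1,2)
proof (induction F rule: finite_induct)
  case (insert i F)
  then show ?case using assms(3)
    by (simp add: M.finsum_insert act_r_distr Pi_def M.finsum_closed)
qed (use assms(3) in simp)

definition summand :: "'b \<Rightarrow> nat \<Rightarrow> 'b set" where
  "summand e d = {h \<in> carrier (part A d). act d e h = h}"

lemma gmult_as_act:
  assumes "r \<in> carrier (part A k)" "h \<in> carrier (part A d)"
  shows "gmult A k d r h =
    (if 1 \<le> d \<and> d \<le> n - 1 - k then gmult A k d x (act d r h) else \<zero>\<^bsub>part A (k + d)\<^esub>)"
proof (cases "1 \<le> d \<and> d \<le> n - 1 - k")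
  case True then show ?thesis using assms by (simp add: act_low)
next
  case False
  then consider "d = 0" | "n \<le> k + d" using k_small k_pos by linarith
  then have "gmult A k d r h = \<zero>\<^bsub>part A (k + d)\<^esub>"
  proof cases
    case 1
    then have "h = \<zero>\<^bsub>part A d\<^esub>" using outside assms by auto
    then show ?thesis using assms by simp
  next
    case 2
    then show ?thesis using outside gmult_closed[OF assms] by auto
  qed
  with False show ?thesis by auto
qed

context
  fixes e assumes e: "e \<in> carrier (part A k)" "act k e e = e"
begin

lemma act_idem: "h \<in> carrier (part A d) \<Longrightarrow> act d e (act d e h) = act d e h"
  using e by (simp add: act_act)

lemma submodule_summand: "submodule (summand e d) R (part A d)"
proof (rule M.submoduleI)
  show "\<ominus>\<^bsub>part A d\<^esub> a \<in> summand e d" if "a \<in> summand e d" for a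
  proof -
    have a: "a \<in> carrier (part A d)" "act d e a = a" using that by (auto simp: summand_def)
    have "act d e (\<ominus>\<^bsub>part A d\<^esub> a) \<oplus>\<^bsub>part A d\<^esub> a = act d e (\<ominus>\<^bsub>part A d\<^esub> a \<oplus>\<^bsub>part A d\<^esub> a)"
      using a e by (simp add: act_r_distr)
    then have "act d e (\<ominus>\<^bsub>part A d\<^esub> a) \<oplus>\<^bsub>part A d\<^esub> a = \<zero>\<^bsub>part A d\<^esub>"
      using a e by (simp add: M.l_neg)
    then have "act d e (\<ominus>\<^bsub>part A d\<^esub> a) = \<ominus>\<^bsub>part A d\<^esub> a"
      using a e by (intro M.minus_equality[symmetric]) auto
    then show ?thesis using a by (simp add: summand_def)
  qed
qed (use e in \<open>auto simp: summand_def act_r_distr act_smult\<close>)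

lemma graded_subalgebra_summand: "graded_subalgebra R A (summand e)"
  unfolding graded_subalgebra_def
proof (intro conjI allI ballI)
  fix i j a b assume ab: "a \<in> summand e i" "b \<in> summand e j"
  then have c: "a \<in> carrier (part A i)" "b \<in> carrier (part A j)" "act i e a = a"
    by (auto simp: summand_def)
  have ge: "gmult A i j a b \<in> carrier (part A (i + j))" using c by (intro gmult_closed)
  consider "1 \<le> i \<and> 1 \<le> j \<and> i + j \<le> n - 1" | "i = 0" | "j = 0" | "n \<le> i + j" by linarith
  then have "act (i + j) e (gmult A i j a b) = gmult A i j a b"
  proof cases
    case 1 then show ?thesis using act_gmult(1)[OF e(1) c(1,2)] c by simp
  next
    case 2 then have "a = \<zero>\<^bsub>part A i\<^esub>" using outside c by auto
    then show ?thesis using c e by simp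
  next
    case 3 then have "b = \<zero>\<^bsub>part A j\<^esub>" using outside c by auto
    then show ?thesis using c e by simp
  next
    case 4 then show ?thesis using ge outside e by auto
  qed
  with ge show "gmult A i j a b \<in> summand e (i + j)" by (simp add: summand_def)
qed (rule submodule_summand)

text \<open>Multiplication by \<open>a\<close> is the action of \<open>a\<close> followed by multiplication by \<open>x\<close>. On the summand of \<open>e\<close>
  the action of \<open>a\<close> is invertible with inverse the action of \<open>c\<close>.\<close>

lemma induces_periodicity_on_summand:
  assumes ac: "a \<in> carrier (part A k)" "c \<in> carrier (part A k)" "act k (act k a c) e = e"
  shows "induces_periodicity_on A n k a (summand e)"
  unfolding induces_periodicity_on_def
proof (intro allI impI)
  fix d assume d: "1 \<le> d \<and> d \<le> n - 1 - k"
  have ce: "act d c (act d e h) = act d e (act d c h)" "act d a (act d e h) = act d e (act d a h)"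
    if "h \<in> carrier (part A d)" for h
    using that e ac act_commute[OF ac(1) e(1)] act_commute[OF ac(2) e(1)] by (simp_all add: act_act)
  have ca: "act d a (act d c h) = h" if "h \<in> summand e d" for h
  proof -
    have h: "h \<in> carrier (part A d)" "act d e h = h" using that by (auto simp: summand_def)
    have "act d a (act d c h) = act d (act k a c) h" using h ac by (simp add: act_act)
    also have "\<dots> = act d (act k a c) (act d e h)" using h by simp
    also have "\<dots> = act d (act k (act k a c) e) h" by (rule act_act[OF h(1) act_closed[OF ac(1,2)] e(1)])
    finally show ?thesis by (simp only: ac(3) h(2))
  qed
  have ac': "act d c (act d a h) = h" if "h \<in> summand e d" for h
    using ca[OF that] that ac act_commute[OF ac(1,2)] by (simp add: act_act summand_def)
  have 1: "bij_betw (act d a) (summand e d) (summand e d)"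
  proof (rule bij_betw_byWitness[where f' = "act d c"])
    show "act d a ` summand e d \<subseteq> summand e d" "act d c ` summand e d \<subseteq> summand e d"
      using ce ac by (auto simp: summand_def) metis+
  qed (use ca ac' in auto)
  have 2: "bij_betw (gmult A k d x) (summand e d) (summand e (k + d))"
    unfolding bij_betw_def
  proof
    show "inj_on (gmult A k d x) (summand e d)"
      using d x_bij[of d] by (auto simp: bij_betw_def summand_def intro: inj_on_subset)
    show "gmult A k d x ` summand e d = summand e (k + d)"
    proof (intro equalityI subsetI)
      fix y assume "y \<in> gmult A k d x ` summand e d"
      then show "y \<in> summand e (k + d)"
        using d e by (auto simp: summand_def act_x_mult gmult_closed x_closed)
    next
      fix y assume y: "y \<in> summand e (k + d)"
      then obtain z where z: "z \<in> carrier (part A d)" "y = gmult A k d x z"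
        using x_divides[of d y] d by (auto simp: summand_def)
      have "gmult A k d x (act d e z) = gmult A k d x z"
        using y z d e by (simp add: summand_def act_x_mult)
      then have "act d e z = z" using x_cancel[of d] d z e by simp
      then show "y \<in> gmult A k d x ` summand e d" using z by (auto simp: summand_def)
    qed
  qed
  have "bij_betw (gmult A k d x \<circ> act d a) (summand e d) (summand e (k + d))"
    using 1 2 by (rule bij_betw_trans)
  moreover have "(gmult A k d x \<circ> act d a) h = gmult A k d a h" if "h \<in> summand e d" for h
    using that d ac by (simp add: act_low summand_def)
  ultimately show "bij_betw (gmult A k d a) (summand e d) (summand e (k + d))"
    by (simp cong: bij_betw_cong)
qed

end

lemma act_orthogonal:
  assumes "e \<in> carrier (part A k)" "f \<in> carrier (part A k)" "act k e f = \<zero>\<^bsub>part A k\<^esub>"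
    "s \<in> summand f d"
  shows "act d e s = \<zero>\<^bsub>part A d\<^esub>"
proof -
  have s: "s \<in> carrier (part A d)" "act d f s = s" using assms(4) by (auto simp: summand_def)
  then have "act d e s = act d (act k e f) s" using assms act_act[OF s(1)] by metis
  then show ?thesis using assms s by simp
qed

text \<open>Since \<open>e\<close> fixes \<open>y\<close> and its action can be moved from one factor of a product to the other,
  \<open>y z = y (e z)\<close>, and \<open>e\<close> kills the summand of \<open>f\<close>.\<close>

lemma summands_orthogonal:
  assumes e: "e \<in> carrier (part A k)" and f: "f \<in> carrier (part A k)"
    and ef: "act k e f = \<zero>\<^bsub>part A k\<^esub>" and y: "y \<in> summand e d" and z: "z \<in> summand f d'"
  shows "gmult A d d' y z = \<zero>\<^bsub>part A (d + d')\<^esub>"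
proof -
  have c: "y \<in> carrier (part A d)" "z \<in> carrier (part A d')" "act d e y = y"
    using y z by (auto simp: summand_def)
  have ge: "gmult A d d' y z \<in> carrier (part A (d + d'))" using c by (intro gmult_closed)
  consider "1 \<le> d \<and> 1 \<le> d' \<and> d + d' \<le> n - 1" | "d = 0" | "d' = 0" | "n \<le> d + d'" by linarith
  then show ?thesis
  proof cases
    case 1
    then have "gmult A d d' y z = gmult A d d' y (act d' e z)"
      using act_gmult[OF e c(1,2)] c by simp
    also have "act d' e z = \<zero>\<^bsub>part A d'\<^esub>" using act_orthogonal[OF e f ef z] .
    finally show ?thesis using c by simp
  next
    case 2 then have "y = \<zero>\<^bsub>part A d\<^esub>" using outside c by auto
    then show ?thesis using c by simp
  next
    case 3 then have "z = \<zero>\<^bsub>part A d'\<^esub>" using outside c by auto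
    then show ?thesis using c by simp
  next
    case 4 then show ?thesis using ge outside by auto
  qed
qed

text \<open>The component of \<open>h\<close> in the \<open>i\<close>-th summand is the image of \<open>h\<close> under the \<open>i\<close>-th idempotent; conversely,
  applying that idempotent to any decomposition of \<open>h\<close> isolates its \<open>i\<close>-th term.\<close>

lemma internal_direct_sum_summands:
  assumes e: "\<And>i. i \<in> {1..m} \<Longrightarrow> e i \<in> carrier (part A k)"
    and idem: "\<And>i. i \<in> {1..m} \<Longrightarrow> act k (e i) (e i) = e i"
    and orth: "\<And>i j. \<lbrakk>i \<in> {1..m}; j \<in> {1..m}; i \<noteq> j\<rbrakk> \<Longrightarrow> act k (e i) (e j) = \<zero>\<^bsub>part A k\<^esub>"
    and one: "(\<Oplus>\<^bsub>part A k\<^esub>i\<in>{1..m}. e i) = x"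
  shows "internal_direct_sum A m (\<lambda>i. summand (e i))"
  unfolding internal_direct_sum_def
proof (intro conjI allI ballI impI)
  fix d h assume h: "h \<in> carrier (part A d)"
  show "\<exists>!s. s \<in> (\<Pi>\<^sub>E i\<in>{1..m}. summand (e i) d) \<and> h = (\<Oplus>\<^bsub>part A d\<^esub>i\<in>{1..m}. s i)"
  proof (rule ex1I[of _ "\<lambda>i\<in>{1..m}. act d (e i) h"])
    have "(\<Oplus>\<^bsub>part A d\<^esub>i\<in>{1..m}. (\<lambda>i\<in>{1..m}. act d (e i) h) i) = (\<Oplus>\<^bsub>part A d\<^esub>i\<in>{1..m}. act d (e i) h)"
      using e h by (intro M.finsum_cong') auto
    also have "\<dots> = act d (\<Oplus>\<^bsub>part A k\<^esub>i\<in>{1..m}. e i) h"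
      using e h by (intro act_finsum_left[symmetric]) auto
    also have "\<dots> = h" using h by (simp only: one act_unit)
    finally show "(\<lambda>i\<in>{1..m}. act d (e i) h) \<in> (\<Pi>\<^sub>E i\<in>{1..m}. summand (e i) d) \<and>
        h = (\<Oplus>\<^bsub>part A d\<^esub>i\<in>{1..m}. (\<lambda>i\<in>{1..m}. act d (e i) h) i)"
      using e idem h by (auto simp: summand_def act_idem)
  next
    fix s assume s: "s \<in> (\<Pi>\<^sub>E i\<in>{1..m}. summand (e i) d) \<and> h = (\<Oplus>\<^bsub>part A d\<^esub>i\<in>{1..m}. s i)"
    have sc: "s i \<in> summand (e i) d" "s i \<in> carrier (part A d)" if "i \<in> {1..m}" for i
      using that s by (auto simp: summand_def PiE_iff)
    have "act d (e j) h = s j" if j: "j \<in> {1..m}" for j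
    proof -
      have "act d (e j) h = (\<Oplus>\<^bsub>part A d\<^esub>i\<in>{1..m}. act d (e j) (s i))"
        using s sc e[OF j] act_finsum_right[of "{1..m}" s d "e j"] by simp
      also have "\<dots> = (\<Oplus>\<^bsub>part A d\<^esub>i\<in>{1..m}. if j = i then s i else \<zero>\<^bsub>part A d\<^esub>)"
      proof (rule M.finsum_cong')
        show "act d (e j) (s i) = (if j = i then s i else \<zero>\<^bsub>part A d\<^esub>)" if i: "i \<in> {1..m}" for i
          using act_orthogonal[OF e[OF j] e[OF i] orth[OF j i] sc(1)[OF i]] sc(1)[OF i]
          by (auto simp: summand_def)
      qed (use sc in auto)
      also have "\<dots> = s j" using j sc(2) by (intro M.add.finprod_singleton) auto
      finally show ?thesis .
    qed
    with s show "s = (\<lambda>i\<in>{1..m}. act d (e i) h)" by (auto simp: PiE_iff extensional_def)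
  qed
next
  fix i j d d' a b
  assume "i \<in> {1..m}" "j \<in> {1..m}" "i \<noteq> j" "a \<in> summand (e i) d" "b \<in> summand (e j) d'"
  then show "gmult A d d' a b = \<zero>\<^bsub>part A (d + d')\<^esub>"
    using summands_orthogonal e orth by blast
qed

lemma strict_periodic_decomposition: "\<exists>m xs S. periodic_decomposition R A n k m xs S"
proof -
  have fin: "finite (carrier degree_ring)" using finite_degree_k by simp
  obtain F where F: "finite F" "\<forall>f\<in>F. D.primitive_idempotent f"
    "\<forall>f\<in>F. \<forall>g\<in>F. f \<noteq> g \<longrightarrow> act k f g = \<zero>\<^bsub>part A k\<^esub>" "(\<Oplus>\<^bsub>part A k\<^esub>f\<in>F. f) = x"
    using D.sum_of_primitive_idempotents[OF fin, of x] x_closed act_unit[OF x_closed]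
    by (auto simp: finsum_degree_ring)
  obtain e where e: "bij_betw e {1..card F} F"
    using ex_bij_betw_nat_finite_1[OF F(1)] by blast
  define m where "m = card F"
  have eF: "e i \<in> F" if "i \<in> {1..m}" for i using that e by (auto simp: bij_betw_def m_def)
  have prim: "D.primitive_idempotent (e i)" if "i \<in> {1..m}" for i using eF[OF that] F(2) by blast
  have ec: "e i \<in> carrier (part A k)" "act k (e i) (e i) = e i" "e i \<noteq> \<zero>\<^bsub>part A k\<^esub>"
    if "i \<in> {1..m}" for i
    using D.primitive_idempotentD[OF prim[OF that]] by auto
  have orth: "act k (e i) (e j) = \<zero>\<^bsub>part A k\<^esub>" if "i \<in> {1..m}" "j \<in> {1..m}" "i \<noteq> j" for i j
    using F(3) eF that e by (metis bij_betw_def inj_onD m_def)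
  have one: "(\<Oplus>\<^bsub>part A k\<^esub>i\<in>{1..m}. e i) = x"
  proof -
    have "inj_on e {1..m}" "e ` {1..m} = F" using e by (auto simp: bij_betw_def m_def)
    moreover have "(\<lambda>f. f) \<in> e ` {1..m} \<rightarrow> carrier (part A k)" using ec(1) by blast
    ultimately show ?thesis using M.finsum_reindex[of "\<lambda>f. f" e "{1..m}" k] F(4) by simp
  qed
  have local: "induces_periodicity_on A n k a (summand (e i)) \<or> induces_periodicity_on A n k b (summand (e i))"
    if i: "i \<in> {1..m}" and ab: "a \<in> carrier (part A k)" "b \<in> carrier (part A k)" "e i = a \<oplus>\<^bsub>part A k\<^esub> b" for i a b
    using D.primitive_idempotent_local[OF fin prim[OF i], of a b] ab ec[OF i]
      induces_periodicity_on_summand by auto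
  have self: "induces_periodicity_on A n k (e i) (summand (e i))" if i: "i \<in> {1..m}" for i
    using induces_periodicity_on_summand[of "e i" "e i" x] ec[OF i] x_closed act_unit
      act_commute[OF ec(1)[OF i] x_closed] by simp
  have vanish: "gmult A k d (e i) s = \<zero>\<^bsub>part A (k + d)\<^esub>"
    if "i \<in> {1..m}" "j \<in> {1..m}" "j \<noteq> i" "s \<in> summand (e j) d" for i j d s
    using gmult_as_act[OF ec(1)[OF that(1)], of s d] act_orthogonal[OF ec(1) ec(1) orth that(4)] that x_closed
    by (auto simp: summand_def)
  have nontriv: "nontrivial_subalgebra A (summand (e i))" if i: "i \<in> {1..m}" for i
    unfolding nontrivial_subalgebra_def using ec[OF i]
    by (intro exI[of _ k]) (auto simp: summand_def)
  show ?thesis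
    using ec orth one self vanish nontriv local
      internal_direct_sum_summands[of m e] graded_subalgebra_summand
    unfolding periodic_decomposition_def
    by (intro exI[of _ m] exI[of _ e] exI[of _ "\<lambda>i. summand (e i)"]) blast
qed

end

context periodic_algebra
begin

theorem decomposition: "\<exists>m xs S. periodic_decomposition R A n k m xs S"
proof (cases "even k \<or> \<one> \<oplus> \<one> = \<zero>")
  case True
  have neg: "\<ominus>\<^bsub>part A d\<^esub> y = y" if "\<one> \<oplus> \<one> = \<zero>" "y \<in> carrier (part A d)" for d y
  proof -
    have "y \<oplus>\<^bsub>part A d\<^esub> y = (\<one> \<oplus> \<one>) \<odot>\<^bsub>part A d\<^esub> y"
      using that(2) by (simp only: M.smult_l_distr R.one_closed M.smult_one)
    then show ?thesis using that by (intro M.minus_equality) auto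
  qed
  interpret S: strict_periodic_algebra R A n k x
  proof unfold_locales
    show "gmult A k d r y = gmult A d k y r"
      if "r \<in> carrier (part A k)" "y \<in> carrier (part A d)" for d r y
      using gmult_commute[OF that] True neg[OF _ gmult_closed[OF that(2,1)]]
      by (auto simp: add.commute)
  qed
  show ?thesis by (rule S.strict_periodic_decomposition)
next
  case False
  have kN: "1 \<le> k" "k \<le> n - 1 - k" using k_pos k_small by linarith+
  have inj: "y = z" if "1 \<le> d" "d \<le> n - 1 - k" "y \<in> carrier (part A d)" "z \<in> carrier (part A d)"
      "gmult A k d x y = gmult A k d x z" for d y z
    using x_bij[OF that(1,2)] that(3-5) by (meson bij_betw_def inj_onD)
  \<comment> \<open>Here \<open>k\<close> is odd and the characteristic is not 2, so \<open>q = - q\<close> forces \<open>x x = 0\<close> and then \<open>x = 0\<close>.\<close>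
  define q where "q = gmult A k k x x"
  have q: "q \<in> carrier (part A (k + k))" using x_closed by (simp add: q_def gmult_closed)
  have "q = \<ominus>\<^bsub>part A (k + k)\<^esub> q"
    using gmult_commute[OF x_closed x_closed] False by (simp add: q_def)
  then have "(\<one> \<oplus> \<one>) \<odot>\<^bsub>part A (k + k)\<^esub> q = \<zero>\<^bsub>part A (k + k)\<^esub>"
    using q M.r_neg[OF q] by (simp add: M.smult_l_distr)
  moreover have "inv (\<one> \<oplus> \<one>) \<otimes> (\<one> \<oplus> \<one>) = \<one>" "inv (\<one> \<oplus> \<one>) \<in> carrier R"
    using False K.field_Units by auto
  ultimately have "q = \<zero>\<^bsub>part A (k + k)\<^esub>"
    using q M.smult_assoc1[of "inv (\<one> \<oplus> \<one>)" "\<one> \<oplus> \<one>" q "k + k"] by simp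
  then have x0: "x = \<zero>\<^bsub>part A k\<^esub>"
    using inj[OF kN x_closed M.zero_closed] x_closed by (simp add: q_def)
  have low: "carrier (part A d) = {\<zero>\<^bsub>part A d\<^esub>}" if "1 \<le> d" "d \<le> n - 1 - k" for d
    using inj[OF that _ M.zero_closed] x0 x_closed by auto
  have zero: "carrier (part A d) = {\<zero>\<^bsub>part A d\<^esub>}" for d
  proof -
    consider "d = 0 \<or> n \<le> d" | "1 \<le> d" "d \<le> n - 1 - k" | "d < n" "n - 1 - k < d" by linarith
    then show ?thesis
    proof cases
      case 3
      then have "1 \<le> d - k" "d - k \<le> n - 1 - k" "k + (d - k) = d" using k_small k_pos by linarith+
      then show ?thesis using x_bij[of "d - k"] low[of "d - k"] x_closed by (auto simp: bij_betw_def)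
    qed (use outside low in auto)
  qed
  have "internal_direct_sum A 0 (\<lambda>_ _. {})"
    using zero by (auto simp: internal_direct_sum_def)
  then show ?thesis unfolding periodic_decomposition_def by (intro exI[of _ 0]) auto
qed

end

section \<open>Quotients of graded algebras\<close>

lemma UN_eq_const:
  assumes "A \<noteq> {}" "\<And>a. a \<in> A \<Longrightarrow> F a = C"
  shows "(\<Union>a\<in>A. F a) = C"
  using assms by auto

text \<open>The quotient \<open>Z / N\<close> of two submodules of \<open>V\<close>. Its cosets can be formed in \<open>V\<close>.\<close>

locale submodule_pair = M: module R V for R :: "('r, 'm) ring_scheme" and V :: "('r, 'b) module" +
  fixes Z N :: "'b set"
  assumes Z: "submodule Z R V" and N: "submodule N R V" and NZ: "N \<subseteq> Z"
begin

abbreviation "Q \<equiv> quotient_module (V\<lparr>carrier := Z\<rparr>) N"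

lemma coset_restrict: "S +>\<^bsub>V\<lparr>carrier := Z\<rparr>\<^esub> a = S +>\<^bsub>V\<^esub> a"
  by (simp add: a_r_coset_def')

lemma Z_carrier: "Z \<subseteq> carrier V" and N_carrier: "N \<subseteq> carrier V"
  using M.submoduleE(1)[OF Z] M.submoduleE(1)[OF N] .

lemma Z_closed:
  "\<zero>\<^bsub>V\<^esub> \<in> Z" "a \<in> Z \<Longrightarrow> b \<in> Z \<Longrightarrow> a \<oplus>\<^bsub>V\<^esub> b \<in> Z" "a \<in> Z \<Longrightarrow> \<ominus>\<^bsub>V\<^esub> a \<in> Z"
  "r \<in> carrier R \<Longrightarrow> a \<in> Z \<Longrightarrow> r \<odot>\<^bsub>V\<^esub> a \<in> Z"
  using M.submoduleE[OF Z] Z unfolding submodule_def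
  by (auto dest: subgroup.one_closed)

lemma N_closed:
  "\<zero>\<^bsub>V\<^esub> \<in> N" "a \<in> N \<Longrightarrow> b \<in> N \<Longrightarrow> a \<oplus>\<^bsub>V\<^esub> b \<in> N" "a \<in> N \<Longrightarrow> \<ominus>\<^bsub>V\<^esub> a \<in> N"
  "r \<in> carrier R \<Longrightarrow> a \<in> N \<Longrightarrow> r \<odot>\<^bsub>V\<^esub> a \<in> N"
  using M.submoduleE[OF N] N unfolding submodule_def
  by (auto dest: subgroup.one_closed)

lemma coset_eq: "N +>\<^bsub>V\<^esub> a = {b \<in> carrier V. b \<ominus>\<^bsub>V\<^esub> a \<in> N}" if "a \<in> carrier V"
proof (intro equalityI subsetI)
  fix b assume "b \<in> N +>\<^bsub>V\<^esub> a"
  then obtain c where c: "c \<in> N" "b = c \<oplus>\<^bsub>V\<^esub> a" by (auto simp: a_r_coset_def')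
  then have "c \<in> carrier V" using N_carrier by blast
  then show "b \<in> {b \<in> carrier V. b \<ominus>\<^bsub>V\<^esub> a \<in> N}"
    using c that by (auto simp: a_minus_def M.a_assoc M.r_neg)
next
  fix b assume b: "b \<in> {b \<in> carrier V. b \<ominus>\<^bsub>V\<^esub> a \<in> N}"
  then have "b = (b \<ominus>\<^bsub>V\<^esub> a) \<oplus>\<^bsub>V\<^esub> a" using that by (simp add: a_minus_def M.a_assoc M.l_neg)
  then show "b \<in> N +>\<^bsub>V\<^esub> a" using b by (auto simp: a_r_coset_def')
qed

lemma coset_eq_iff:
  assumes "a \<in> carrier V" "b \<in> carrier V"
  shows "N +>\<^bsub>V\<^esub> a = N +>\<^bsub>V\<^esub> b \<longleftrightarrow> a \<ominus>\<^bsub>V\<^esub> b \<in> N"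
proof
  assume "N +>\<^bsub>V\<^esub> a = N +>\<^bsub>V\<^esub> b"
  moreover have "a \<in> N +>\<^bsub>V\<^esub> a" using assms N_closed(1) by (simp add: coset_eq a_minus_def M.r_neg)
  ultimately show "a \<ominus>\<^bsub>V\<^esub> b \<in> N" using assms by (simp add: coset_eq)
next
  assume ab: "a \<ominus>\<^bsub>V\<^esub> b \<in> N"
  have "c \<ominus>\<^bsub>V\<^esub> a \<in> N \<longleftrightarrow> c \<ominus>\<^bsub>V\<^esub> b \<in> N" if c: "c \<in> carrier V" for c
  proof -
    have e: "c \<ominus>\<^bsub>V\<^esub> b = (c \<ominus>\<^bsub>V\<^esub> a) \<oplus>\<^bsub>V\<^esub> (a \<ominus>\<^bsub>V\<^esub> b)"
      using assms c by (simp add: a_minus_def M.a_assoc M.r_neg1)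
    have y: "a \<ominus>\<^bsub>V\<^esub> b \<in> carrier V" "c \<ominus>\<^bsub>V\<^esub> a \<in> carrier V" using assms c by auto
    have e': "c \<ominus>\<^bsub>V\<^esub> a = (c \<ominus>\<^bsub>V\<^esub> b) \<oplus>\<^bsub>V\<^esub> \<ominus>\<^bsub>V\<^esub> (a \<ominus>\<^bsub>V\<^esub> b)"
      unfolding e using y by (simp add: M.a_assoc M.r_neg)
    show ?thesis using e e' N_closed ab by metis
  qed
  then show "N +>\<^bsub>V\<^esub> a = N +>\<^bsub>V\<^esub> b" using assms by (auto simp: coset_eq)
qed

lemma mem_coset: "b \<in> carrier V \<Longrightarrow> a \<in> carrier V \<Longrightarrow> b \<in> N +>\<^bsub>V\<^esub> a \<longleftrightarrow> N +>\<^bsub>V\<^esub> b = N +>\<^bsub>V\<^esub> a"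
  unfolding coset_eq_iff by (simp add: coset_eq)

lemma coset_self: "a \<in> carrier V \<Longrightarrow> a \<in> N +>\<^bsub>V\<^esub> a"
  by (simp add: mem_coset)

lemma coset_subset_Z: "a \<in> Z \<Longrightarrow> b \<in> N +>\<^bsub>V\<^esub> a \<Longrightarrow> b \<in> Z"
  using Z_closed(2) NZ by (auto simp: a_r_coset_def')

lemma Q_carrier: "carrier Q = (\<lambda>a. N +>\<^bsub>V\<^esub> a) ` Z"
  by (auto simp: quotient_module_def A_RCOSETS_def' a_r_coset_def')

lemma Q_zero: "\<zero>\<^bsub>Q\<^esub> = N +>\<^bsub>V\<^esub> \<zero>\<^bsub>V\<^esub>"
  using N_carrier by (auto simp: quotient_module_def coset_eq a_minus_def)

lemma Q_zero': "\<zero>\<^bsub>Q\<^esub> = N"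
  by (simp add: quotient_module_def)

lemma Q_add:
  assumes "a \<in> Z" "b \<in> Z"
  shows "(N +>\<^bsub>V\<^esub> a) \<oplus>\<^bsub>Q\<^esub> (N +>\<^bsub>V\<^esub> b) = N +>\<^bsub>V\<^esub> (a \<oplus>\<^bsub>V\<^esub> b)"
proof -
  have ab: "a \<in> carrier V" "b \<in> carrier V" using assms Z_carrier by auto
  have "(N +>\<^bsub>V\<^esub> a) \<oplus>\<^bsub>Q\<^esub> (N +>\<^bsub>V\<^esub> b) = {c \<oplus>\<^bsub>V\<^esub> a \<oplus>\<^bsub>V\<^esub> (d \<oplus>\<^bsub>V\<^esub> b) |c d. c \<in> N \<and> d \<in> N}"
    by (auto simp: quotient_module_def set_add_def' a_r_coset_def' )
  also have "\<dots> = N +>\<^bsub>V\<^esub> (a \<oplus>\<^bsub>V\<^esub> b)"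
  proof (intro equalityI subsetI)
    fix y assume "y \<in> {c \<oplus>\<^bsub>V\<^esub> a \<oplus>\<^bsub>V\<^esub> (d \<oplus>\<^bsub>V\<^esub> b) |c d. c \<in> N \<and> d \<in> N}"
    then obtain c d where cd: "c \<in> N" "d \<in> N" "y = c \<oplus>\<^bsub>V\<^esub> a \<oplus>\<^bsub>V\<^esub> (d \<oplus>\<^bsub>V\<^esub> b)" by blast
    moreover have "c \<in> carrier V" "d \<in> carrier V" using cd N_carrier by auto
    ultimately have "y = (c \<oplus>\<^bsub>V\<^esub> d) \<oplus>\<^bsub>V\<^esub> (a \<oplus>\<^bsub>V\<^esub> b)" using ab by (simp add: M.a_ac)
    then show "y \<in> N +>\<^bsub>V\<^esub> (a \<oplus>\<^bsub>V\<^esub> b)" using cd N_closed by (auto simp: a_r_coset_def')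
  next
    fix y assume "y \<in> N +>\<^bsub>V\<^esub> (a \<oplus>\<^bsub>V\<^esub> b)"
    then obtain c where c: "c \<in> N" "y = c \<oplus>\<^bsub>V\<^esub> (a \<oplus>\<^bsub>V\<^esub> b)" by (auto simp: a_r_coset_def')
    then have "y = c \<oplus>\<^bsub>V\<^esub> a \<oplus>\<^bsub>V\<^esub> (\<zero>\<^bsub>V\<^esub> \<oplus>\<^bsub>V\<^esub> b)"
      using ab N_carrier by (auto simp: M.a_assoc)
    then show "y \<in> {c \<oplus>\<^bsub>V\<^esub> a \<oplus>\<^bsub>V\<^esub> (d \<oplus>\<^bsub>V\<^esub> b) |c d. c \<in> N \<and> d \<in> N}"
      using c N_closed(1) by blast
  qed
  finally show ?thesis .
qed

lemma Q_smult:
  assumes r: "r \<in> carrier R" and "a \<in> Z"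
  shows "r \<odot>\<^bsub>Q\<^esub> (N +>\<^bsub>V\<^esub> a) = N +>\<^bsub>V\<^esub> (r \<odot>\<^bsub>V\<^esub> a)"
proof -
  have a: "a \<in> carrier V" using assms Z_carrier by auto
  have "N +>\<^bsub>V\<^esub> (r \<odot>\<^bsub>V\<^esub> b) = N +>\<^bsub>V\<^esub> (r \<odot>\<^bsub>V\<^esub> a)" if "b \<in> N +>\<^bsub>V\<^esub> a" for b
  proof -
    have b: "b \<in> carrier V" "b \<ominus>\<^bsub>V\<^esub> a \<in> N" using that a by (auto simp: coset_eq)
    have "r \<odot>\<^bsub>V\<^esub> b \<ominus>\<^bsub>V\<^esub> r \<odot>\<^bsub>V\<^esub> a = r \<odot>\<^bsub>V\<^esub> (b \<ominus>\<^bsub>V\<^esub> a)"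
      using a b r by (simp add: a_minus_def M.smult_r_distr M.smult_r_minus)
    then show ?thesis using a b r N_closed(4) by (simp add: coset_eq_iff)
  qed
  moreover have "N +>\<^bsub>V\<^esub> a \<noteq> {}" using coset_self[OF a] by blast
  ultimately have "(\<Union>b\<in>N +>\<^bsub>V\<^esub> a. N +>\<^bsub>V\<^esub> (r \<odot>\<^bsub>V\<^esub> b)) = N +>\<^bsub>V\<^esub> (r \<odot>\<^bsub>V\<^esub> a)"
    by (rule UN_eq_const[rotated])
  then show ?thesis by (simp add: quotient_module_def coset_restrict)
qed

lemma module_Q: "module R Q"
proof (rule moduleI)
  show "cring R" by (rule module.axioms(1)[OF M.module_axioms])
  show "abelian_group Q"
  proof (rule abelian_groupI)
    show "\<exists>y\<in>carrier Q. y \<oplus>\<^bsub>Q\<^esub> A = \<zero>\<^bsub>Q\<^esub>" if A: "A \<in> carrier Q" for A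
    proof -
      obtain a where a: "a \<in> Z" "A = N +>\<^bsub>V\<^esub> a" using A by (auto simp: Q_carrier)
      then have "(N +>\<^bsub>V\<^esub> (\<ominus>\<^bsub>V\<^esub> a)) \<oplus>\<^bsub>Q\<^esub> A = \<zero>\<^bsub>Q\<^esub>"
        using Z_carrier by (auto simp: Q_add Z_closed Q_zero M.l_neg)
      then show ?thesis using a Z_closed(3) by (auto simp: Q_carrier)
    qed
    fix A B C assume "A \<in> carrier Q" "B \<in> carrier Q"
    then obtain a b where ab: "a \<in> Z" "A = N +>\<^bsub>V\<^esub> a" "b \<in> Z" "B = N +>\<^bsub>V\<^esub> b"
      by (auto simp: Q_carrier)
    have c: "a \<in> carrier V" "b \<in> carrier V" using ab Z_carrier by auto
    show "A \<oplus>\<^bsub>Q\<^esub> B \<in> carrier Q" using ab Z_closed(2) by (simp add: Q_add) (simp add: Q_carrier)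
    show "A \<oplus>\<^bsub>Q\<^esub> B = B \<oplus>\<^bsub>Q\<^esub> A" using ab c by (simp add: Q_add M.a_comm)
    assume "C \<in> carrier Q"
    then obtain d where d: "d \<in> Z" "C = N +>\<^bsub>V\<^esub> d" by (auto simp: Q_carrier)
    show "A \<oplus>\<^bsub>Q\<^esub> B \<oplus>\<^bsub>Q\<^esub> C = A \<oplus>\<^bsub>Q\<^esub> (B \<oplus>\<^bsub>Q\<^esub> C)"
      using ab d c Z_carrier Z_closed(2) by (auto simp: Q_add M.a_assoc)
  next
    show "\<zero>\<^bsub>Q\<^esub> \<in> carrier Q" using Z_closed by (auto simp: Q_zero Q_carrier)
    show "\<zero>\<^bsub>Q\<^esub> \<oplus>\<^bsub>Q\<^esub> A = A" if "A \<in> carrier Q" for A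
      using that Z_carrier Z_closed(1) by (auto simp: Q_carrier Q_zero Q_add)
  qed
  fix r s A B assume rs: "r \<in> carrier R" "s \<in> carrier R" and "A \<in> carrier Q" "B \<in> carrier Q"
  then obtain a b where ab: "a \<in> Z" "A = N +>\<^bsub>V\<^esub> a" "b \<in> Z" "B = N +>\<^bsub>V\<^esub> b"
    by (auto simp: Q_carrier)
  have c: "a \<in> carrier V" "b \<in> carrier V" using ab Z_carrier by auto
  show "r \<odot>\<^bsub>Q\<^esub> A \<in> carrier Q" using ab rs Z_closed(4) by (simp add: Q_smult) (simp add: Q_carrier)
  show "(r \<oplus>\<^bsub>R\<^esub> s) \<odot>\<^bsub>Q\<^esub> A = r \<odot>\<^bsub>Q\<^esub> A \<oplus>\<^bsub>Q\<^esub> s \<odot>\<^bsub>Q\<^esub> A"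
    using ab rs c by (simp add: Q_smult Q_add Z_closed M.smult_l_distr)
  show "r \<odot>\<^bsub>Q\<^esub> (A \<oplus>\<^bsub>Q\<^esub> B) = r \<odot>\<^bsub>Q\<^esub> A \<oplus>\<^bsub>Q\<^esub> r \<odot>\<^bsub>Q\<^esub> B"
    using ab rs c by (simp add: Q_smult Q_add Z_closed M.smult_r_distr)
  show "(r \<otimes>\<^bsub>R\<^esub> s) \<odot>\<^bsub>Q\<^esub> A = r \<odot>\<^bsub>Q\<^esub> (s \<odot>\<^bsub>Q\<^esub> A)"
    using ab rs c by (simp add: Q_smult Z_closed M.smult_assoc1)
next
  show "\<one>\<^bsub>R\<^esub> \<odot>\<^bsub>Q\<^esub> A = A" if "A \<in> carrier Q" for A
    using that Z_carrier by (auto simp: Q_carrier Q_smult)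
qed

lemma Q_minus:
  assumes "a \<in> Z"
  shows "\<ominus>\<^bsub>Q\<^esub> (N +>\<^bsub>V\<^esub> a) = N +>\<^bsub>V\<^esub> (\<ominus>\<^bsub>V\<^esub> a)"
proof -
  interpret Q: module R Q by (rule module_Q)
  have "(N +>\<^bsub>V\<^esub> (\<ominus>\<^bsub>V\<^esub> a)) \<oplus>\<^bsub>Q\<^esub> (N +>\<^bsub>V\<^esub> a) = \<zero>\<^bsub>Q\<^esub>"
    using assms Z_carrier by (auto simp: Q_add Z_closed Q_zero M.l_neg)
  then show ?thesis using assms Z_closed by (intro Q.minus_equality) (auto simp: Q_carrier)
qed

end

text \<open>A subalgebra \<open>Z\<close> of a graded algebra \<open>V\<close> modulo an ideal \<open>N\<close> of \<open>Z\<close>. Graded commutativity is required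
  up to \<open>N\<close> only, so that the locale covers both cocycles modulo coboundaries, where the cup product
  commutes only up to coboundaries, and the periodic subquotient.\<close>

locale graded_quotient =
  fixes R :: "('r, 'm) ring_scheme" and V :: "nat \<Rightarrow> ('r, 'b) module" and Z N :: "nat \<Rightarrow> 'b set"
    and f :: "nat \<Rightarrow> nat \<Rightarrow> 'b \<Rightarrow> 'b \<Rightarrow> 'b"
  assumes pair: "\<And>d. submodule_pair R (V d) (Z d) (N d)"
    and f_closed: "\<And>i j a b. \<lbrakk>a \<in> Z i; b \<in> Z j\<rbrakk> \<Longrightarrow> f i j a b \<in> Z (i + j)"
    and f_l_distr: "\<And>i j a a' b. \<lbrakk>a \<in> Z i; a' \<in> Z i; b \<in> Z j\<rbrakk>
          \<Longrightarrow> f i j (a \<oplus>\<^bsub>V i\<^esub> a') b = f i j a b \<oplus>\<^bsub>V (i + j)\<^esub> f i j a' b"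
    and f_r_distr: "\<And>i j a b b'. \<lbrakk>a \<in> Z i; b \<in> Z j; b' \<in> Z j\<rbrakk>
          \<Longrightarrow> f i j a (b \<oplus>\<^bsub>V j\<^esub> b') = f i j a b \<oplus>\<^bsub>V (i + j)\<^esub> f i j a b'"
    and f_smult: "\<And>i j r a b. \<lbrakk>r \<in> carrier R; a \<in> Z i; b \<in> Z j\<rbrakk>
          \<Longrightarrow> f i j a (r \<odot>\<^bsub>V j\<^esub> b) = r \<odot>\<^bsub>V (i + j)\<^esub> f i j a b"
    and f_assoc: "\<And>i j l a b c. \<lbrakk>a \<in> Z i; b \<in> Z j; c \<in> Z l\<rbrakk>
          \<Longrightarrow> f (i + j) l (f i j a b) c = f i (j + l) a (f j l b c)"
    and f_commute: "\<And>i j a b. \<lbrakk>a \<in> Z i; b \<in> Z j\<rbrakk>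
          \<Longrightarrow> f i j a b \<ominus>\<^bsub>V (i + j)\<^esub> (if even (i * j) then f j i b a else \<ominus>\<^bsub>V (i + j)\<^esub> f j i b a)
                \<in> N (i + j)"
    and f_ideal: "\<And>i j a b. \<lbrakk>a \<in> N i; b \<in> Z j\<rbrakk> \<Longrightarrow> f i j a b \<in> N (i + j)"
      "\<And>i j a b. \<lbrakk>a \<in> Z i; b \<in> N j\<rbrakk> \<Longrightarrow> f i j a b \<in> N (i + j)"
begin

sublocale P: submodule_pair R "V d" "Z d" "N d" for d
  by (rule pair)

lemma ZV: "a \<in> Z d \<Longrightarrow> a \<in> carrier (V d)" and NV: "a \<in> N d \<Longrightarrow> a \<in> carrier (V d)"
  and NZ: "a \<in> N d \<Longrightarrow> a \<in> Z d"
  by (rule subsetD[OF P.Z_carrier] subsetD[OF P.N_carrier] subsetD[OF P.NZ]; assumption)+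

lemma coset_product:
  assumes a: "a \<in> Z i" and b: "b \<in> Z j"
  shows "(\<Union>a'\<in>N i +>\<^bsub>V i\<^esub> a. \<Union>b'\<in>N j +>\<^bsub>V j\<^esub> b. N (i + j) +>\<^bsub>V (i + j)\<^esub> f i j a' b')
    = N (i + j) +>\<^bsub>V (i + j)\<^esub> f i j a b"
proof -
  have "N (i + j) +>\<^bsub>V (i + j)\<^esub> f i j a' b' = N (i + j) +>\<^bsub>V (i + j)\<^esub> f i j a b"
    if a': "a' \<in> N i +>\<^bsub>V i\<^esub> a" and b': "b' \<in> N j +>\<^bsub>V j\<^esub> b" for a' b'
  proof -
    obtain c d where c: "c \<in> N i" "a' = c \<oplus>\<^bsub>V i\<^esub> a" and d: "d \<in> N j" "b' = d \<oplus>\<^bsub>V j\<^esub> b"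
      using a' b' by (auto simp: a_r_coset_def')
    have "f i j a' b' = f i j c b' \<oplus>\<^bsub>V (i + j)\<^esub> (f i j a d \<oplus>\<^bsub>V (i + j)\<^esub> f i j a b)"
    proof -
      have z: "c \<in> Z i" "d \<in> Z j" "b' \<in> Z j" using b c d NZ P.Z_closed(2) by auto
      show ?thesis
        using f_l_distr[OF z(1) a z(3)] f_r_distr[OF a z(2) b] unfolding c(2) d(2) by simp
    qed
    then have "f i j a' b' = (f i j c b' \<oplus>\<^bsub>V (i + j)\<^esub> f i j a d) \<oplus>\<^bsub>V (i + j)\<^esub> f i j a b"
      using a b c d NZ P.Z_closed(2) ZV f_closed P.M.a_assoc by simp
    moreover have "f i j c b' \<oplus>\<^bsub>V (i + j)\<^esub> f i j a d \<in> N (i + j)"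
      using a b c d NZ P.Z_closed(2) by (intro P.N_closed f_ideal) auto
    ultimately have mem: "f i j a' b' \<in> N (i + j) +>\<^bsub>V (i + j)\<^esub> f i j a b"
      by (auto simp: a_r_coset_def')
    have "a' \<in> Z i" "b' \<in> Z j" using P.coset_subset_Z a b a' b' by auto
    then have "f i j a' b' \<in> carrier (V (i + j))" "f i j a b \<in> carrier (V (i + j))"
      using a b by (simp_all add: ZV f_closed)
    from iffD1[OF P.mem_coset[OF this] mem] show ?thesis .
  qed
  moreover have "N i +>\<^bsub>V i\<^esub> a \<noteq> {}" "N j +>\<^bsub>V j\<^esub> b \<noteq> {}"
    using P.coset_self[OF ZV[OF a]] P.coset_self[OF ZV[OF b]] by blast+
  ultimately show ?thesis by (simp cong: SUP_cong)
qed

theorem graded_commutative_algebra_quotient: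
  assumes part: "\<And>d. part A d = quotient_module (V d\<lparr>carrier := Z d\<rparr>) (N d)"
    and gmult: "\<And>i j a b. \<lbrakk>a \<in> Z i; b \<in> Z j\<rbrakk> \<Longrightarrow>
      gmult A i j (N i +>\<^bsub>V i\<^esub> a) (N j +>\<^bsub>V j\<^esub> b) = N (i + j) +>\<^bsub>V (i + j)\<^esub> f i j a b"
  shows "graded_commutative_algebra R A"
proof (intro graded_commutative_algebra.intro graded_commutative_algebra_axioms.intro)
  show "cring R" by (rule module.axioms(1)[OF P.M.module_axioms])
  show "module R (part A d)" for d unfolding part by (rule P.module_Q)
  have ex: "\<exists>a \<in> Z d. X = N d +>\<^bsub>V d\<^esub> a" if "X \<in> carrier (part A d)" for X d
    using that unfolding part P.Q_carrier by blast
  fix i j X Y assume "X \<in> carrier (part A i)" "Y \<in> carrier (part A j)"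
  then obtain a b where ab: "a \<in> Z i" "X = N i +>\<^bsub>V i\<^esub> a" "b \<in> Z j" "Y = N j +>\<^bsub>V j\<^esub> b"
    using ex by metis
  show "gmult A i j X Y \<in> carrier (part A (i + j))"
    using ab f_closed unfolding part P.Q_carrier by (auto simp: gmult)
  have ji: "f j i b a \<in> Z (i + j)" using f_closed[of b j a i] ab by (simp add: add.commute)
  have gji: "gmult A j i Y X = N (i + j) +>\<^bsub>V (i + j)\<^esub> f j i b a"
    using gmult[of b j a i] ab by (simp add: add.commute)
  show "gmult A i j X Y = (if even (i * j) then gmult A j i Y X else \<ominus>\<^bsub>part A (i + j)\<^esub> gmult A j i Y X)"
  proof -
    let ?g = "if even (i * j) then f j i b a else \<ominus>\<^bsub>V (i + j)\<^esub> f j i b a"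
    have "N (i + j) +>\<^bsub>V (i + j)\<^esub> f i j a b = N (i + j) +>\<^bsub>V (i + j)\<^esub> ?g"
      using f_commute[OF ab(1,3)] f_closed[OF ab(1,3)] ZV P.Z_closed(3)[OF ji] ji
      by (subst P.coset_eq_iff) auto
    then show ?thesis using ab ji gji by (auto simp: gmult part P.Q_minus)
  qed
  show "gmult A i j X (r \<odot>\<^bsub>part A j\<^esub> Y) = r \<odot>\<^bsub>part A (i + j)\<^esub> gmult A i j X Y" if "r \<in> carrier R" for r
    using ab that P.Z_closed(4) f_closed by (simp add: part P.Q_smult gmult f_smult)
  show "gmult A i j (X \<oplus>\<^bsub>part A i\<^esub> X') Y = gmult A i j X Y \<oplus>\<^bsub>part A (i + j)\<^esub> gmult A i j X' Y"
    if X': "X' \<in> carrier (part A i)" for X'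
  proof -
    obtain a' where "a' \<in> Z i" "X' = N i +>\<^bsub>V i\<^esub> a'" using ex[OF X'] by blast
    then show ?thesis using ab P.Z_closed(2) f_closed by (simp add: part P.Q_add gmult f_l_distr)
  qed
  show "gmult A i j X (Y \<oplus>\<^bsub>part A j\<^esub> Y') = gmult A i j X Y \<oplus>\<^bsub>part A (i + j)\<^esub> gmult A i j X Y'"
    if Y': "Y' \<in> carrier (part A j)" for Y'
  proof -
    obtain b' where "b' \<in> Z j" "Y' = N j +>\<^bsub>V j\<^esub> b'" using ex[OF Y'] by blast
    then show ?thesis using ab P.Z_closed(2) f_closed by (simp add: part P.Q_add gmult f_r_distr)
  qed
  show "gmult A (i + j) l (gmult A i j X Y) W = gmult A i (j + l) X (gmult A j l Y W)"
    if W: "W \<in> carrier (part A l)" for l W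
  proof -
    obtain c where "c \<in> Z l" "W = N l +>\<^bsub>V l\<^esub> c" using ex[OF W] by blast
    then show ?thesis using ab f_closed by (simp add: gmult f_assoc add.assoc)
  qed
qed

end

section \<open>The periodic subquotient\<close>

lemma (in graded_commutative_algebra) gmult_r_minus:
  assumes "a \<in> carrier (part A i)" "b \<in> carrier (part A j)"
  shows "gmult A i j a (\<ominus>\<^bsub>part A j\<^esub> b) = \<ominus>\<^bsub>part A (i + j)\<^esub> gmult A i j a b"
proof -
  have "gmult A i j a (\<ominus>\<^bsub>part A j\<^esub> b) \<oplus>\<^bsub>part A (i + j)\<^esub> gmult A i j a b
      = gmult A i j a (\<ominus>\<^bsub>part A j\<^esub> b \<oplus>\<^bsub>part A j\<^esub> b)"
    using assms by (simp add: gmult_r_distr)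
  also have "\<dots> = \<zero>\<^bsub>part A (i + j)\<^esub>" using assms by (simp add: M.l_neg)
  finally show ?thesis using assms by (intro M.minus_equality[symmetric]) (auto intro: gmult_closed)
qed

lemma (in graded_commutative_algebra) gmult_commute_past:
  assumes a: "a \<in> carrier (part A i)" and x: "x \<in> carrier (part A k)" and b: "b \<in> carrier (part A j)"
  shows "gmult A i (k + j) a (gmult A k j x b) =
    (if even (i * k) then gmult A k (i + j) x (gmult A i j a b)
     else gmult A k (i + j) x (\<ominus>\<^bsub>part A (i + j)\<^esub> gmult A i j a b))"
proof -
  have xa: "gmult A k i x a \<in> carrier (part A (i + k))" "gmult A i j a b \<in> carrier (part A (i + j))"
    using gmult_closed[OF x a] gmult_closed[OF a b] by (simp_all add: add.commute)
  have s: "gmult A (i + k) j (gmult A k i x a) b = gmult A k (i + j) x (gmult A i j a b)"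
    using gmult_assoc[OF x a b] by (simp add: add.commute)
  have m: "gmult A (i + k) j (\<ominus>\<^bsub>part A (i + k)\<^esub> gmult A k i x a) b
      = gmult A k (i + j) x (\<ominus>\<^bsub>part A (i + j)\<^esub> gmult A i j a b)"
  proof -
    have "gmult A (i + k) j (\<ominus>\<^bsub>part A (i + k)\<^esub> gmult A k i x a) b \<oplus>\<^bsub>part A (i + k + j)\<^esub> gmult A (i + k) j (gmult A k i x a) b
        = gmult A (i + k) j (\<ominus>\<^bsub>part A (i + k)\<^esub> gmult A k i x a \<oplus>\<^bsub>part A (i + k)\<^esub> gmult A k i x a) b"
      using xa b by (simp add: gmult_l_distr)
    also have "\<dots> = \<zero>\<^bsub>part A (i + k + j)\<^esub>" using xa b by (simp add: M.l_neg)
    finally have "gmult A (i + k) j (\<ominus>\<^bsub>part A (i + k)\<^esub> gmult A k i x a) b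
        = \<ominus>\<^bsub>part A (i + k + j)\<^esub> gmult A (i + k) j (gmult A k i x a) b"
      using xa b by (intro M.minus_equality[symmetric]) (auto intro: gmult_closed)
    then show ?thesis using s xa x gmult_r_minus[OF x xa(2)] by (simp add: ac_simps)
  qed
  have "gmult A i (k + j) a (gmult A k j x b) = gmult A (i + k) j (gmult A i k a x) b"
    using gmult_assoc[OF a x b] by simp
  then show ?thesis using gmult_commute[OF a x] s m by simp
qed

locale periodicity_inducing = graded_commutative_algebra R A
  for R :: "('r, 'm) ring_scheme" (structure) and A :: "('r, 'b) graded_algebra" +
  fixes n k :: nat and x :: 'b
  assumes k_pos: "1 \<le> k" and periodicity: "induces_periodicity A n k x"
begin

lemma k_small: "3 * k \<le> n - 1" and x_closed: "x \<in> carrier (part A k)"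
  using periodicity by (auto simp: induces_periodicity_def)

lemma x_surj:
  assumes "1 \<le> i" "i < n - 1 - k" "y \<in> carrier (part A (k + i))"
  obtains z where "z \<in> carrier (part A i)" "y = gmult A k i x z"
  using periodicity assms unfolding induces_periodicity_def by blast

lemma x_inj:
  assumes "1 < i" "i \<le> n - 1 - k" "y \<in> carrier (part A i)" "gmult A k i x y = \<zero>\<^bsub>part A (k + i)\<^esub>"
  shows "y = \<zero>\<^bsub>part A i\<^esub>"
proof -
  have "inj_on (gmult A k i x) (carrier (part A i))"
    using periodicity assms(1,2) unfolding induces_periodicity_def by blast
  moreover have "gmult A k i x y = gmult A k i x \<zero>\<^bsub>part A i\<^esub>" using assms(4) x_closed by simp
  ultimately show ?thesis by (rule inj_onD) (use assms(3) in auto)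
qed

abbreviation "num \<equiv> psq_numerator A n k x"
abbreviation "den \<equiv> psq_denominator A k x"

text \<open>Truncating products above degree \<open>n - 1\<close> makes the numerators of the periodic subquotient a
  subalgebra; their parts in these degrees are zero.\<close>

definition truncated_mult :: "nat \<Rightarrow> nat \<Rightarrow> 'b \<Rightarrow> 'b \<Rightarrow> 'b" where
  "truncated_mult i j a b = (if i + j \<le> n - 1 then gmult A i j a b else \<zero>\<^bsub>part A (i + j)\<^esub>)"

lemma num_closed: "a \<in> num i \<Longrightarrow> a \<in> carrier (part A i)"
proof -
  have "k + (n - 1 - k) = n - 1" using k_small by linarith
  then have "gmult A k (n - 1 - k) x ` carrier (part A (n - 1 - k)) \<subseteq> carrier (part A (n - 1))"
    using gmult_closed[OF x_closed, of _ "n - 1 - k"] by auto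
  then show "a \<in> num i \<Longrightarrow> a \<in> carrier (part A i)"
    by (auto simp only: psq_numerator_def M.zero_closed split: if_splits)
qed

lemma num_0: "num 0 = {\<zero>\<^bsub>part A 0\<^esub>}"
  using k_small k_pos by (auto simp: psq_numerator_def)

lemma num_middle: "1 \<le> i \<Longrightarrow> i < n - 1 \<Longrightarrow> num i = carrier (part A i)"
  by (simp add: psq_numerator_def)

lemma num_top: "num (n - 1) = gmult A k (n - 1 - k) x ` carrier (part A (n - 1 - k))"
  by (simp add: psq_numerator_def)

lemma submodule_zero: "submodule {\<zero>\<^bsub>part A d\<^esub>} R (part A d)"
  by (rule M.submoduleI) auto

lemma submodule_num: "submodule (num d) R (part A d)"
proof (cases "d = n - 1")
  case True
  define e where "e = n - 1 - k"
  have d: "d = k + e" using True k_small by (simp add: e_def)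
  have num: "num d = gmult A k e x ` carrier (part A e)" using num_top True by (simp add: e_def)
  show ?thesis unfolding num unfolding d
  proof (rule M.submoduleI)
    show "\<zero>\<^bsub>part A (k + e)\<^esub> \<in> gmult A k e x ` carrier (part A e)"
      using x_closed by (intro image_eqI[of _ _ "\<zero>\<^bsub>part A e\<^esub>"]) auto
  qed (auto simp: gmult_closed x_closed gmult_r_minus[OF x_closed, symmetric]
      gmult_r_distr[OF x_closed, symmetric] gmult_smult[OF _ x_closed, symmetric])
next
  case False
  then show ?thesis using submodule_zero M.carrier_is_submodule by (auto simp: psq_numerator_def)
qed

lemma submodule_den: "submodule (den d) R (part A d)"
proof (cases "d = 1")
  case True
  have "submodule {y \<in> carrier (part A 1). gmult A k 1 x y = \<zero>\<^bsub>part A (k + 1)\<^esub>} R (part A 1)"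
    by (rule M.submoduleI)
      (auto simp: x_closed gmult_r_minus gmult_r_distr gmult_smult
        simp del: One_nat_def)
  then show ?thesis using True by (simp add: psq_denominator_def)
qed (simp add: psq_denominator_def submodule_zero)

lemma den_subset_num: "den d \<subseteq> num d"
  using k_small k_pos submodule_num[of d] M.submoduleE(1,2)
  by (auto simp: psq_denominator_def num_middle simp del: One_nat_def dest!: submodule.axioms(1) subgroup.one_closed)

lemma den_zero: "d \<noteq> 1 \<Longrightarrow> den d = {\<zero>\<^bsub>part A d\<^esub>}"
  by (simp add: psq_denominator_def)

lemma zero_in_den: "\<zero>\<^bsub>part A d\<^esub> \<in> den d" and zero_in_num: "\<zero>\<^bsub>part A d\<^esub> \<in> num d"
  using subgroup.one_closed[OF submodule.axioms(1)[OF submodule_den]] den_subset_num by auto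

lemma truncated_mult_cases:
  assumes a: "a \<in> num i" and b: "b \<in> num j"
  obtains "truncated_mult i j a b = \<zero>\<^bsub>part A (i + j)\<^esub>"
    | "1 \<le> i" "i < n - 1" "1 \<le> j" "j < n - 1" "i + j \<le> n - 1"
      "truncated_mult i j a b = gmult A i j a b"
proof -
  consider "i + j > n - 1" | "i = 0" | "j = 0" | "1 \<le> i" "1 \<le> j" "i + j \<le> n - 1" by linarith
  then show thesis
  proof cases
    case 4 with that(2) show thesis by (simp add: truncated_mult_def)
  qed (use that(1) a b num_0 num_closed[OF a] num_closed[OF b] in \<open>auto simp: truncated_mult_def\<close>)
qed

text \<open>Only the top degree \<open>n - 1\<close> is restrictive, where the numerator consists of the multiples of \<open>x\<close>. As
  \<open>n - 1 > 2 k\<close>, one of the factors has degree above \<open>k\<close>, so it is a multiple of \<open>x\<close>, and \<open>x\<close> can be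
  moved to the front of the product.\<close>

lemma truncated_mult_closed:
  assumes a: "a \<in> num i" and b: "b \<in> num j"
  shows "truncated_mult i j a b \<in> num (i + j)"
proof (cases rule: truncated_mult_cases[OF a b])
  case 1 then show ?thesis using zero_in_num by simp
next
  case 2
  note ac = num_closed[OF a] and bc = num_closed[OF b]
  show ?thesis
  proof (cases "i + j < n - 1")
    case True
    then show ?thesis using 2 gmult_closed[OF ac bc] by (simp add: num_middle)
  next
    case False
    then have top: "i + j = n - 1" using 2 by simp
    have "k < i \<or> k < j" using top k_small k_pos by linarith
    then obtain z where z: "z \<in> carrier (part A (n - 1 - k))" "gmult A i j a b = gmult A k (n - 1 - k) x z"
    proof
      assume "k < i"
      then have i: "i = k + (i - k)" "1 \<le> i - k" "i - k < n - 1 - k" "i - k + j = n - 1 - k"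
        using 2 top by linarith+
      then obtain a' where a': "a' \<in> carrier (part A (i - k))" "a = gmult A k (i - k) x a'"
        using x_surj[of "i - k" a] ac by metis
      then show ?thesis
        using gmult_assoc[OF x_closed a'(1) bc] gmult_closed[OF a'(1) bc] i by (intro that) auto
    next
      assume "k < j"
      then have j: "j = k + (j - k)" "1 \<le> j - k" "j - k < n - 1 - k" "i + (j - k) = n - 1 - k"
        using 2 top by linarith+
      then obtain b' where b': "b' \<in> carrier (part A (j - k))" "b = gmult A k (j - k) x b'"
        using x_surj[of "j - k" b] bc by metis
      have "gmult A i (j - k) a b' \<in> carrier (part A (i + (j - k)))" by (rule gmult_closed[OF ac b'(1)])
      then have c: "gmult A i (j - k) a b' \<in> carrier (part A (n - 1 - k))" by (simp only: j(4))
      have past: "gmult A i j a b = (if even (i * k) then gmult A k (n - 1 - k) x (gmult A i (j - k) a b')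
          else gmult A k (n - 1 - k) x (\<ominus>\<^bsub>part A (n - 1 - k)\<^esub> gmult A i (j - k) a b'))"
        using gmult_commute_past[OF ac x_closed b'(1)] unfolding j(4) j(1)[symmetric] b'(2)[symmetric] .
      show ?thesis
      proof (cases "even (i * k)")
        case True
        with past show ?thesis by (intro that[OF c]) simp
      next
        case False
        with past c show ?thesis by (intro that[of "\<ominus>\<^bsub>part A (n - 1 - k)\<^esub> gmult A i (j - k) a b'"]) simp_all
      qed
    qed
    then show ?thesis using 2 top num_top by simp
  qed
qed

text \<open>Let \<open>a\<close> be in the kernel of \<open>x\<close> on degree 1. If \<open>a b\<close> has degree at most \<open>n - 1 - k\<close>, then \<open>x a b = 0\<close>
  gives \<open>a b = 0\<close> by injectivity. Otherwise \<open>b = x b'\<close>, and \<open>a b\<close> agrees with \<open>x a b' = 0\<close> up to sign.\<close>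

lemma truncated_mult_kernel:
  assumes a: "a \<in> den i" and b: "b \<in> num j"
  shows "truncated_mult i j a b = \<zero>\<^bsub>part A (i + j)\<^esub>"
proof (cases rule: truncated_mult_cases[OF subsetD[OF den_subset_num a] b])
  case 2
  have ac: "a \<in> carrier (part A i)" and bc: "b \<in> carrier (part A j)"
    using a b den_subset_num num_closed by auto
  show ?thesis
  proof (cases "i = 1")
    case False
    then show ?thesis using a bc 2 by (simp add: den_zero)
  next
    case True
    have xa: "gmult A k 1 x a = \<zero>\<^bsub>part A (k + 1)\<^esub>"
      using a True by (simp add: psq_denominator_def)
    have ac: "a \<in> carrier (part A 1)" using ac True by simp
    have "gmult A 1 j a b = \<zero>\<^bsub>part A (1 + j)\<^esub>"
    proof (cases "1 + j \<le> n - 1 - k")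
      case T: True
      have "gmult A k (1 + j) x (gmult A 1 j a b) = \<zero>\<^bsub>part A (k + (1 + j))\<^esub>"
        using gmult_assoc[OF x_closed ac bc] xa bc by (simp add: add.assoc)
      then show ?thesis using T 2 x_inj gmult_closed[OF ac bc] by simp
    next
      case F: False
      then have j: "j = k + (j - k)" "1 \<le> j - k" "j - k < n - 1 - k"
        using 2 True k_small k_pos by linarith+
      then obtain b' where b': "b' \<in> carrier (part A (j - k))" "b = gmult A k (j - k) x b'"
        using x_surj[of "j - k" b] bc by metis
      have ab: "gmult A 1 (j - k) a b' \<in> carrier (part A (1 + (j - k)))" using ac b'(1) by (rule gmult_closed)
      have 0: "gmult A k (1 + (j - k)) x (gmult A 1 (j - k) a b') = \<zero>\<^bsub>part A (k + (1 + (j - k)))\<^esub>"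
        using gmult_assoc[OF x_closed ac b'(1)] xa b'(1) by (simp add: add.assoc)
      then have "gmult A 1 (k + (j - k)) a b = \<zero>\<^bsub>part A (k + (1 + (j - k)))\<^esub>"
        using gmult_commute_past[OF ac x_closed b'(1)] gmult_r_minus[OF x_closed ab] b'(2)
        by (simp split: if_splits)
      then show ?thesis using j(1) by simp
    qed
    then show ?thesis using 2 True by simp
  qed
qed

lemma truncated_mult_commute:
  assumes a: "a \<in> num i" and b: "b \<in> num j"
  shows "truncated_mult i j a b = (if even (i * j) then truncated_mult j i b a
     else \<ominus>\<^bsub>part A (i + j)\<^esub> truncated_mult j i b a)"
proof -
  have "\<zero>\<^bsub>part A (i + j)\<^esub> = \<ominus>\<^bsub>part A (i + j)\<^esub> \<zero>\<^bsub>part A (i + j)\<^esub>"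
    by (rule M.minus_equality[symmetric]) auto
  then show ?thesis
    using gmult_commute[OF num_closed[OF a] num_closed[OF b]]
    unfolding truncated_mult_def add.commute[of j i] by presburger
qed

lemma graded_quotient_periodic: "graded_quotient R (part A) num den truncated_mult"
proof (rule graded_quotient.intro)
  show "submodule_pair R (part A d) (num d) (den d)" for d
    by (intro submodule_pair.intro part_module submodule_pair_axioms.intro submodule_num submodule_den den_subset_num)
  fix i j a b assume a: "a \<in> num i" and b: "b \<in> num j"
  note ac = num_closed[OF a] and bc = num_closed[OF b]
  show cl: "truncated_mult i j a b \<in> num (i + j)" by (rule truncated_mult_closed[OF a b])
  show "truncated_mult i j (a \<oplus>\<^bsub>part A i\<^esub> a') b = truncated_mult i j a b \<oplus>\<^bsub>part A (i + j)\<^esub> truncated_mult i j a' b"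
    if a': "a' \<in> num i" for a'
    using gmult_l_distr[OF ac num_closed[OF a'] bc] by (simp add: truncated_mult_def)
  show "truncated_mult i j a (b \<oplus>\<^bsub>part A j\<^esub> b') = truncated_mult i j a b \<oplus>\<^bsub>part A (i + j)\<^esub> truncated_mult i j a b'"
    if b': "b' \<in> num j" for b'
    using gmult_r_distr[OF ac bc num_closed[OF b']] by (simp add: truncated_mult_def)
  show "truncated_mult i j a (r \<odot>\<^bsub>part A j\<^esub> b) = r \<odot>\<^bsub>part A (i + j)\<^esub> truncated_mult i j a b"
    if r: "r \<in> carrier R" for r
    using gmult_smult[OF r ac bc] r by (simp add: truncated_mult_def)
  show "truncated_mult (i + j) l (truncated_mult i j a b) c = truncated_mult i (j + l) a (truncated_mult j l b c)"
    if c: "c \<in> num l" for l c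
    using gmult_assoc[OF ac bc num_closed[OF c]] by (auto simp: truncated_mult_def add.assoc)
  show "truncated_mult i j a b \<ominus>\<^bsub>part A (i + j)\<^esub> (if even (i * j) then truncated_mult j i b a
      else \<ominus>\<^bsub>part A (i + j)\<^esub> truncated_mult j i b a) \<in> den (i + j)"
    unfolding truncated_mult_commute[OF a b, symmetric]
    using num_closed[OF cl] zero_in_den by (simp add: a_minus_def M.r_neg)
next
  fix i j a b assume "a \<in> den i" "b \<in> num j"
  then show "truncated_mult i j a b \<in> den (i + j)" using truncated_mult_kernel zero_in_den by simp
next
  fix i j a b assume a: "a \<in> num i" and b: "b \<in> den j"
  have "truncated_mult j i b a = \<zero>\<^bsub>part A (i + j)\<^esub>"
    using truncated_mult_kernel[OF b a] by (simp add: add.commute)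
  then have "truncated_mult i j a b = \<zero>\<^bsub>part A (i + j)\<^esub>"
    using truncated_mult_commute[OF a subsetD[OF den_subset_num b]] by (simp split: if_splits)
  then show "truncated_mult i j a b \<in> den (i + j)" using zero_in_den by simp
qed

sublocale G: graded_quotient R "part A" num den truncated_mult
  by (rule graded_quotient_periodic)

abbreviation "psq \<equiv> periodic_subquotient A n k x"

lemma psq_part: "part psq d = quotient_module (part A d\<lparr>carrier := num d\<rparr>) (den d)"
  by (simp add: periodic_subquotient_def)

lemma psq_carrier: "carrier (part psq d) = (\<lambda>a. den d +>\<^bsub>part A d\<^esub> a) ` num d"
  unfolding psq_part by (rule G.P.Q_carrier)

lemma psq_gmult:
  assumes a: "a \<in> num i" and b: "b \<in> num j"
  shows "gmult psq i j (den i +>\<^bsub>part A i\<^esub> a) (den j +>\<^bsub>part A j\<^esub> b)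
    = den (i + j) +>\<^bsub>part A (i + j)\<^esub> truncated_mult i j a b"
proof (cases "i + j \<le> n - 1")
  case True
  then have "truncated_mult i j = gmult A i j" by (intro ext) (simp add: truncated_mult_def)
  then show ?thesis using G.coset_product[OF a b] True by (simp add: periodic_subquotient_def)
next
  case False
  then show ?thesis using G.P.Q_zero[of "i + j"] G.P.Q_zero'[of "i + j"]
    by (simp add: periodic_subquotient_def truncated_mult_def)
qed

lemma periodic_algebra_psq:
  assumes "field R" and "finite (carrier (part A k))"
  shows "periodic_algebra R psq n k (den k +>\<^bsub>part A k\<^esub> x)"
proof (intro periodic_algebra.intro periodic_algebra_axioms.intro)
  show "graded_commutative_algebra R psq"
    by (rule G.graded_commutative_algebra_quotient[OF psq_part psq_gmult])
  show "field R" by fact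
  show "1 \<le> k" "3 * k \<le> n - 1" by (rule k_pos, rule k_small)
  have numk: "num k = carrier (part A k)" using k_pos k_small by (intro num_middle) linarith+
  show "den k +>\<^bsub>part A k\<^esub> x \<in> carrier (part psq k)"
    using x_closed numk by (auto simp: psq_carrier)
  show "finite (carrier (part psq k))" using assms(2) numk by (simp add: psq_carrier)
  show "carrier (part psq d) = {\<zero>\<^bsub>part psq d\<^esub>}" if "d = 0 \<or> n \<le> d" for d
  proof -
    have "num d = {\<zero>\<^bsub>part A d\<^esub>}" using that k_pos k_small by (auto simp: psq_numerator_def)
    moreover have "\<zero>\<^bsub>part psq d\<^esub> = den d +>\<^bsub>part A d\<^esub> \<zero>\<^bsub>part A d\<^esub>"
      unfolding psq_part by (rule G.P.Q_zero)
    ultimately show ?thesis by (simp add: psq_carrier)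
  qed
  fix d assume d: "1 \<le> d" "d \<le> n - 1 - k"
  have numd: "num d = carrier (part A d)" using d k_pos k_small by (intro num_middle) linarith+
  have kd: "k + d \<le> n - 1" "k + d \<noteq> 1" using d k_pos k_small by linarith+
  have mult: "gmult psq k d (den k +>\<^bsub>part A k\<^esub> x) (den d +>\<^bsub>part A d\<^esub> h)
      = den (k + d) +>\<^bsub>part A (k + d)\<^esub> gmult A k d x h" if "h \<in> carrier (part A d)" for h
    using psq_gmult[of x k h d] that x_closed numk numd kd(1) by (simp add: truncated_mult_def)
  show "bij_betw (gmult psq k d (den k +>\<^bsub>part A k\<^esub> x)) (carrier (part psq d)) (carrier (part psq (k + d)))"
    unfolding bij_betw_def
  proof
    show "inj_on (gmult psq k d (den k +>\<^bsub>part A k\<^esub> x)) (carrier (part psq d))"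
    proof (rule inj_onI)
      fix H H' assume H: "H \<in> carrier (part psq d)" "H' \<in> carrier (part psq d)"
        and eq: "gmult psq k d (den k +>\<^bsub>part A k\<^esub> x) H = gmult psq k d (den k +>\<^bsub>part A k\<^esub> x) H'"
      obtain h h' where h: "h \<in> carrier (part A d)" "H = den d +>\<^bsub>part A d\<^esub> h"
        "h' \<in> carrier (part A d)" "H' = den d +>\<^bsub>part A d\<^esub> h'"
        using H unfolding psq_carrier numd by blast
      have c: "gmult A k d x h \<in> carrier (part A (k + d))" "gmult A k d x h' \<in> carrier (part A (k + d))"
        using h x_closed by (auto intro: gmult_closed)
      have "gmult A k d x h \<ominus>\<^bsub>part A (k + d)\<^esub> gmult A k d x h' \<in> den (k + d)"
        using eq mult h c G.P.coset_eq_iff by simp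
      then have "gmult A k d x (h \<ominus>\<^bsub>part A d\<^esub> h') = \<zero>\<^bsub>part A (k + d)\<^esub>"
        using h x_closed kd by (simp add: den_zero a_minus_def gmult_r_distr gmult_r_minus)
      moreover have hh: "h \<ominus>\<^bsub>part A d\<^esub> h' \<in> carrier (part A d)" using h by simp
      ultimately have "h \<ominus>\<^bsub>part A d\<^esub> h' \<in> den d"
        using x_inj[of d "h \<ominus>\<^bsub>part A d\<^esub> h'"] d by (cases "d = 1") (auto simp: psq_denominator_def)
      then show "H = H'" using h G.P.coset_eq_iff by simp
    qed
    have numkd: "num (k + d) = gmult A k d x ` carrier (part A d)"
    proof (cases "k + d = n - 1")
      case True
      then have "d = n - 1 - k" by simp
      then show ?thesis using num_top True by simp
    next
      case False
      then have lt: "d < n - 1 - k" "k + d < n - 1" using kd by linarith+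
      then have "carrier (part A (k + d)) = gmult A k d x ` carrier (part A d)"
        using periodicity d unfolding induces_periodicity_def by auto
      then show ?thesis using num_middle[of "k + d"] lt d by simp
    qed
    show "gmult psq k d (den k +>\<^bsub>part A k\<^esub> x) ` carrier (part psq d) = carrier (part psq (k + d))"
      unfolding psq_carrier numkd numd image_image using mult by (intro image_cong) auto
  qed
qed

end


section \<open>Cochains on lists of vertices\<close>

text \<open>The coboundary in the ordered simplicial cochain complex of a vertex set: the alternating sum over
  the deletions of one entry (see \<open>list_bd_sum\<close>). Recursion on the first vertex lets the identities
  below be proved by induction without index calculations.\<close>

fun list_bd :: "('v list \<Rightarrow> int) \<Rightarrow> 'v list \<Rightarrow> int" where
  "list_bd f [] = 0"
| "list_bd f (v # l) = f l - list_bd (\<lambda>l'. f (v # l')) l"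

lemma list_bd_diff: "list_bd (\<lambda>l. f l - g l) l = list_bd f l - list_bd g l"
  by (induction l arbitrary: f g) auto

lemma list_bd_mult: "list_bd (\<lambda>l. c * f l) l = c * list_bd f l"
  by (induction l arbitrary: f) (auto simp: algebra_simps)

lemma list_bd_list_bd: "list_bd (list_bd f) l = 0"
proof (induction l arbitrary: f)
  case (Cons v l)
  have "list_bd (\<lambda>l'. list_bd f (v # l')) l = list_bd (\<lambda>l'. f l' - list_bd (\<lambda>l''. f (v # l'')) l') l"
    by simp
  then show ?case using Cons by (simp add: list_bd_diff)
qed simp

lemma list_bd_map: "list_bd (\<lambda>l'. f (map h l')) l = list_bd f (map h l)"
proof (induction l arbitrary: f)
  case (Cons v l)
  then show ?case using Cons[of "\<lambda>l'. f (h v # l')"] by simp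
qed simp

lemma list_bd_dvd:
  assumes "\<And>l'. \<lbrakk>length l = Suc (length l'); set l' \<subseteq> set l\<rbrakk> \<Longrightarrow> q dvd f l'"
  shows "q dvd list_bd f l"
  using assms
proof (induction l arbitrary: f)
  case (Cons v l)
  have "q dvd list_bd (\<lambda>l'. f (v # l')) l"
    by (rule Cons.IH, rule Cons.prems) auto
  moreover have "q dvd f l" using Cons.prems[of l] by auto
  ultimately show ?case by simp
qed simp

lemma list_bd_cong:
  assumes "\<And>l'. \<lbrakk>length l = Suc (length l'); set l' \<subseteq> set l\<rbrakk> \<Longrightarrow> f l' = g l'"
  shows "list_bd f l = list_bd g l"
  using list_bd_dvd[of l 0 "\<lambda>l. f l - g l"] assms by (simp add: list_bd_diff)

lemma list_bd_sum:
  "list_bd f l = (\<Sum>j<length l. (-1) ^ j * f (take j l @ drop (Suc j) l))"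
proof (induction l arbitrary: f)
  case (Cons v l)
  show ?case
    by (simp add: Cons sum.lessThan_Suc_shift sum_negf del: sum.lessThan_Suc)
qed simp

definition list_cup :: "nat \<Rightarrow> ('v list \<Rightarrow> int) \<Rightarrow> ('v list \<Rightarrow> int) \<Rightarrow> 'v list \<Rightarrow> int" where
  "list_cup i f g l = f (take (Suc i) l) * g (drop i l)"

lemma list_bd_list_cup:
  assumes "length l \<ge> i + 2"
  shows "list_bd (list_cup i f g) l =
    list_bd f (take (i + 2) l) * g (drop (i + 1) l) + (-1) ^ i * (f (take (i + 1) l) * list_bd g (drop i l))"
  using assms
proof (induction i arbitrary: f l)
  case 0
  then obtain v w l' where l: "l = v # w # l'"
    by (metis Suc_le_length_iff add_2_eq_Suc' numeral_2_eq_2 plus_nat.add_0)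
  have "list_bd (list_cup 0 f g) l =
      f [w] * g (w # l') - list_bd (\<lambda>l'. f [v] * g (v # l')) (w # l')"
    unfolding l list_cup_def by (simp del: list_bd.simps add: list_bd.simps(2)[of _ v])
  also have "\<dots> = f [w] * g (w # l') - f [v] * list_bd (\<lambda>l'. g (v # l')) (w # l')"
    by (simp only: list_bd_mult)
  finally show ?case by (simp add: l algebra_simps)
next
  case (Suc i)
  then obtain v l' where l: "l = v # l'" by (cases l) auto
  have "list_bd (list_cup (Suc i) f g) l =
      f (take (i + 2) l') * g (drop (i + 1) l') - list_bd (list_cup i (\<lambda>l. f (v # l)) g) l'"
    by (simp add: l list_cup_def[abs_def])
  then show ?case
    using Suc.IH[of l' "\<lambda>l. f (v # l)"] Suc.prems by (simp add: l algebra_simps)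
qed

text \<open>The sign of the permutation that reverses \<open>n\<close> vertices.\<close>

definition flip_sign :: "nat \<Rightarrow> int" where
  "flip_sign n = (-1) ^ (n * (n - 1) div 2)"

lemma flip_sign_Suc: "flip_sign (Suc n) = (-1) ^ n * flip_sign n"
proof (cases n)
  case (Suc m)
  have "Suc n * n div 2 = n + n * (n - 1) div 2"
    using Suc by (simp add: algebra_simps)
  then show ?thesis by (simp add: flip_sign_def power_add)
qed (simp add: flip_sign_def)

lemma list_bd_append_last:
  "list_bd g (l @ [v]) = list_bd (\<lambda>l'. g (l' @ [v])) l + (-1) ^ length l * g l"
  by (induction l arbitrary: g) (auto simp: algebra_simps)

lemma list_bd_rev:
  "list_bd (\<lambda>l'. g (rev l')) l = (-1) ^ (length l + 1) * list_bd g (rev l)"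
proof (induction l arbitrary: g)
  case (Cons v l)
  have "list_bd (\<lambda>l'. g (rev l')) (v # l) = g (rev l) - list_bd (\<lambda>l'. (\<lambda>m. g (m @ [v])) (rev l')) l"
    by simp
  also have "\<dots> = g (rev l) - (-1) ^ (length l + 1) * list_bd (\<lambda>m. g (m @ [v])) (rev l)"
    using Cons[of "\<lambda>m. g (m @ [v])"] by simp
  also have "\<dots> = (-1) ^ (length l) * ((-1) ^ length l * g (rev l) + list_bd (\<lambda>m. g (m @ [v])) (rev l))"
    by (simp add: algebra_simps power_mult_distrib[symmetric] flip: power_add)
  also have "\<dots> = (-1) ^ (length (v # l) + 1) * list_bd g (rev (v # l))"
    by (simp add: list_bd_append_last algebra_simps)
  finally show ?case .
qed simp

text \<open>The transpose of the chain homotopy that sends \<open>(v\<^sub>0, \<dots>, v\<^sub>m)\<close> to the sum of the lists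
  \<open>(v\<^sub>0, \<dots>, v\<^sub>i, v\<^sub>m, \<dots>, v\<^sub>i)\<close> with signs. The first clause of the recursion is the term \<open>i = 0\<close>.\<close>

fun list_prism :: "('v list \<Rightarrow> int) \<Rightarrow> 'v list \<Rightarrow> int" where
  "list_prism f [] = 0"
| "list_prism f (v # l) =
     flip_sign (Suc (length l)) * f (v # rev l @ [v]) - list_prism (\<lambda>l'. f (v # l')) l"

lemma list_prism_diff: "list_prism (\<lambda>l. f l - g l) l = list_prism f l - list_prism g l"
  by (induction l arbitrary: f g) (auto simp: algebra_simps)

lemma list_prism_map: "list_prism (\<lambda>l'. f (map h l')) l = list_prism f (map h l)"
proof (induction l arbitrary: f)
  case (Cons v l)
  then show ?case using Cons[of "\<lambda>l'. f (h v # l')"] by (simp add: rev_map)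
qed simp

lemma list_prism_dvd:
  assumes "\<And>l'. \<lbrakk>length l' = Suc (length l); set l' \<subseteq> set l\<rbrakk> \<Longrightarrow> q dvd f l'"
  shows "q dvd list_prism f l"
  using assms
proof (induction l arbitrary: f)
  case (Cons v l)
  have "q dvd list_prism (\<lambda>l'. f (v # l')) l"
    by (rule Cons.IH, rule Cons.prems) auto
  moreover have "q dvd f (v # rev l @ [v])" using Cons.prems[of "v # rev l @ [v]"] by auto
  ultimately show ?case by simp
qed simp

lemma list_prism_cong:
  assumes "\<And>l'. \<lbrakk>length l' = Suc (length l); set l' \<subseteq> set l\<rbrakk> \<Longrightarrow> f l' = g l'"
  shows "list_prism f l = list_prism g l"
  using list_prism_dvd[of l 0 "\<lambda>l. f l - g l"] assms by (simp add: list_prism_diff)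

text \<open>Reversing the order of the vertices, with the sign of the reversal, is homotopic to the identity.\<close>

lemma list_prism_homotopy:
  assumes "l \<noteq> []"
  shows "list_bd (list_prism f) l + list_prism (list_bd f) l = flip_sign (length l) * f (rev l) - f l"
  using assms
proof (induction l arbitrary: f)
  case (Cons v l)
  \<comment> \<open>The boundary of \<open>v # l\<close> consists of \<open>l\<close> and of the lists \<open>v # l'\<close> with \<open>l'\<close> a face of \<open>l\<close>.\<close>
  define h where "h = (\<lambda>l. f (v # l))"
  let ?s = "flip_sign (Suc (length l))"
  have 1: "list_bd (list_prism f) (v # l) = list_prism f l
      - (list_bd (\<lambda>l'. flip_sign (Suc (length l')) * h (rev l' @ [v])) l - list_bd (list_prism h) l)"
    by (simp add: h_def list_bd_diff)
  have 2: "list_prism (list_bd f) (v # l) = ?s * list_bd f (v # rev l @ [v])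
      - (list_prism f l - list_prism (list_bd h) l)"
    by (simp add: h_def list_prism_diff)
  have 3: "list_bd f (v # rev l @ [v]) = f (rev l @ [v]) - list_bd h (rev l @ [v])"
    by (simp add: h_def)
  have 4: "list_bd (\<lambda>l'. flip_sign (Suc (length l')) * h (rev l' @ [v])) l
      = flip_sign (length l) * list_bd (\<lambda>l'. h (rev l' @ [v])) l"
    by (subst list_bd_mult[symmetric], rule list_bd_cong) simp
  have 5: "list_bd (\<lambda>l'. h (rev l' @ [v])) l = (-1) ^ (length l + 1) * list_bd (\<lambda>m. h (m @ [v])) (rev l)"
    using list_bd_rev[of "\<lambda>m. h (m @ [v])" l] by simp
  have sq: "(-1) ^ length l * ((-1) ^ length l * y) = (y::int)" for y
    by (simp flip: mult.assoc power_mult_distrib)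
  have 6: "?s * list_bd h (rev l @ [v])
      = - list_bd (\<lambda>l'. flip_sign (Suc (length l')) * h (rev l' @ [v])) l + flip_sign (length l) * h (rev l)"
    unfolding 4 5 by (simp add: list_bd_append_last flip_sign_Suc algebra_simps sq)
  have IH: "list_bd (list_prism h) l + list_prism (list_bd h) l = flip_sign (length l) * h (rev l) - h l"
  proof (cases "l = []")
    case True then show ?thesis by (simp add: flip_sign_def)
  next
    case False then show ?thesis by (rule Cons.IH)
  qed
  show ?case
    using 1 2 3 6 IH by (simp add: h_def algebra_simps)
qed simp

section \<open>Singular cochains with integer values\<close>

text \<open>The affine map of standard simplices that sends the \<open>j\<close>-th vertex to the vertex with number \<open>l ! j\<close>.
  The list may repeat vertices.\<close>

definition vertex_map :: "nat list \<Rightarrow> (nat \<Rightarrow> real) \<Rightarrow> nat \<Rightarrow> real" where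
  "vertex_map l t = (\<lambda>i. \<Sum>j<length l. if l ! j = i then t j else 0)"

definition vertex_face :: "nat list \<Rightarrow> ((nat \<Rightarrow> real) \<Rightarrow> 'a) \<Rightarrow> (nat \<Rightarrow> real) \<Rightarrow> 'a" where
  "vertex_face l \<sigma> = restrict (\<sigma> \<circ> vertex_map l) (standard_simplex (length l - 1))"

lemma vertex_map_in_standard_simplex:
  assumes "l \<noteq> []" "set l \<subseteq> {..q}" and t: "t \<in> standard_simplex (length l - 1)"
  shows "vertex_map l t \<in> standard_simplex q"
proof -
  have len: "{..length l - 1} = {..<length l}" using assms(1) by (cases l) (auto simp: less_Suc_eq_le)
  have pos: "0 \<le> vertex_map l t i" for i
    using t by (auto simp: vertex_map_def standard_simplex_def intro!: sum_nonneg)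
  have zero: "vertex_map l t i = 0" if "i > q" for i
    using that assms(2) by (auto simp: vertex_map_def intro!: sum.neutral) (metis nth_mem atMost_iff leD subsetD)
  have "(\<Sum>i\<le>q. vertex_map l t i) = (\<Sum>j<length l. \<Sum>i\<le>q. if l ! j = i then t j else 0)"
    unfolding vertex_map_def by (rule sum.swap)
  also have "\<dots> = (\<Sum>j<length l. t j)"
    using assms(2) by (intro sum.cong) (auto simp: sum.delta dest: nth_mem)
  also have "\<dots> = 1" using t unfolding standard_simplex_def len[symmetric] by simp
  finally have s: "(\<Sum>i\<le>q. vertex_map l t i) = 1" .
  have "vertex_map l t i \<le> 1" for i
    using member_le_sum[of i "{..q}" "vertex_map l t"] pos s zero[of i] by (cases "i \<le> q") auto
  then show ?thesis using pos zero s by (auto simp: standard_simplex_def)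
qed

lemma singular_simplex_vertex_face:
  assumes \<sigma>: "singular_simplex q X \<sigma>" and l: "l \<noteq> []" "set l \<subseteq> {..q}"
  shows "singular_simplex (length l - 1) X (vertex_face l \<sigma>)"
proof -
  let ?S = "\<lambda>p. subtopology (powertop_real UNIV) (standard_simplex p)"
  have "continuous_map (?S (length l - 1)) (?S q) (vertex_map l)"
    unfolding continuous_map_in_subtopology continuous_map_componentwise
  proof (intro conjI)
    show "\<forall>k\<in>UNIV. continuous_map (?S (length l - 1)) euclideanreal (\<lambda>x. vertex_map l x k)"
      unfolding vertex_map_def
      by (auto intro!: continuous_map_sum continuous_map_from_subtopology continuous_map_product_projection)
  qed (use vertex_map_in_standard_simplex[OF l] in auto)
  moreover have "continuous_map (?S q) X \<sigma>" using \<sigma> by (simp add: singular_simplex_def)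
  ultimately show ?thesis
    by (simp add: singular_simplex_def vertex_face_def continuous_map_compose)
qed

lemma vertex_map_vertex_map:
  assumes "set l' \<subseteq> {..<length l}"
  shows "vertex_map l (vertex_map l' t) = vertex_map (map ((!) l) l') t"
proof
  fix i
  have "vertex_map l (vertex_map l' t) i =
      (\<Sum>j<length l. \<Sum>j'<length l'. if l ! j = i \<and> l' ! j' = j then t j' else 0)"
    unfolding vertex_map_def by (intro sum.cong) auto
  also have "\<dots> = (\<Sum>j'<length l'. \<Sum>j<length l. if l ! j = i \<and> l' ! j' = j then t j' else 0)"
    by (rule sum.swap)
  also have "\<dots> = (\<Sum>j'<length l'. if map ((!) l) l' ! j' = i then t j' else 0)"
  proof (rule sum.cong)
    fix j' assume "j' \<in> {..<length l'}"
    then have "l' ! j' \<in> set l'" by simp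
    then have "l' ! j' < length l" using assms by auto
    moreover have "(\<Sum>j<length l. if l ! j = i \<and> l' ! j' = j then t j' else 0)
        = (\<Sum>j<length l. if l' ! j' = j then (if l ! j = i then t j' else 0) else 0)"
      by (intro sum.cong) auto
    ultimately show "(\<Sum>j<length l. if l ! j = i \<and> l' ! j' = j then t j' else 0)
        = (if map ((!) l) l' ! j' = i then t j' else 0)"
      using \<open>j' \<in> {..<length l'}\<close> by (simp add: sum.delta)
  qed simp
  finally show "vertex_map l (vertex_map l' t) i = vertex_map (map ((!) l) l') t i"
    by (simp add: vertex_map_def)
qed

lemma vertex_face_vertex_face:
  assumes "l' \<noteq> []" "set l' \<subseteq> {..<length l}"
  shows "vertex_face l' (vertex_face l \<sigma>) = vertex_face (map ((!) l) l') \<sigma>"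
proof -
  have "vertex_map l' t \<in> standard_simplex (length l - 1)" if "t \<in> standard_simplex (length l' - 1)" for t
    by (rule vertex_map_in_standard_simplex) (use assms that in \<open>auto simp: less_Suc_eq_le\<close>)
  then show ?thesis
    using assms by (auto simp: vertex_face_def restrict_def vertex_map_vertex_map)
qed

lemma vertex_map_shift:
  assumes "\<And>i. i > j \<Longrightarrow> t i = 0"
  shows "vertex_map [i..<Suc (i + j)] t = (\<lambda>l. if l < i then 0 else t (l - i))"
proof
  fix l
  have "vertex_map [i..<Suc (i + j)] t l = (\<Sum>m<Suc j. if i + m = l then t m else 0)"
    unfolding vertex_map_def by (intro sum.cong) (auto simp del: upt_Suc)
  also have "\<dots> = (\<Sum>m<Suc j. if m = l - i then (if l < i then 0 else t m) else 0)"
    by (intro sum.cong) auto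
  also have "\<dots> = (if l < i then 0 else t (l - i))"
    using assms[of "l - i"] by (subst sum.delta) auto
  finally show "vertex_map [i..<Suc (i + j)] t l = (if l < i then 0 else t (l - i))" .
qed

lemma back_face_eq: "back_face i j \<sigma> = vertex_face [i..<Suc (i + j)] \<sigma>"
proof
  fix t
  show "back_face i j \<sigma> t = vertex_face [i..<Suc (i + j)] \<sigma> t"
    using vertex_map_shift[of j t i]
    by (auto simp: back_face_def vertex_face_def standard_simplex_def simp del: upt_Suc)
qed

lemma front_face_eq: "front_face i \<sigma> = vertex_face [0..<Suc i] \<sigma>"
proof
  fix t
  show "front_face i \<sigma> t = vertex_face [0..<Suc i] \<sigma> t"
    using vertex_map_shift[of i t 0]
    by (auto simp: front_face_def vertex_face_def standard_simplex_def simp del: upt_Suc)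
qed

lemma singular_face_eq:
  assumes "i \<le> Suc k"
  shows "singular_face (Suc k) i \<sigma> =
    vertex_face (take i [0..<Suc (Suc k)] @ drop (Suc i) [0..<Suc (Suc k)]) \<sigma>"
proof
  fix t
  let ?l = "take i [0..<Suc (Suc k)] @ drop (Suc i) [0..<Suc (Suc k)]"
  have len: "length ?l = Suc k" using assms by (simp del: upt_Suc)
  have "vertex_map ?l t = simplical_face i t" if t: "t \<in> standard_simplex k"
  proof
    fix m
    have tz: "t j = 0" if "j > k" for j using t that by (auto simp: standard_simplex_def)
    have "vertex_map ?l t m = (\<Sum>j<Suc k. if (if j < i then j else Suc j) = m then t j else 0)"
      unfolding vertex_map_def len
      by (intro sum.cong) (use assms in \<open>auto simp: nth_append simp del: upt_Suc\<close>)
    also have "\<dots> = (\<Sum>j<Suc k. if j = (if m < i then m else m - 1) then (if m = i then 0 else t j) else 0)"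
      by (intro sum.cong) auto
    also have "\<dots> = simplical_face i t m"
      using assms tz[of m] tz[of "m - 1"] by (subst sum.delta) (auto simp: simplical_face_def)
    finally show "vertex_map ?l t m = simplical_face i t m" .
  qed
  then show "singular_face (Suc k) i \<sigma> t = vertex_face ?l \<sigma> t"
    unfolding vertex_face_def len by (auto simp: singular_face_def)
qed

definition int_coboundary :: "nat \<Rightarrow> ('a, int) cochain \<Rightarrow> ((nat \<Rightarrow> real) \<Rightarrow> 'a) \<Rightarrow> int" where
  "int_coboundary k a \<sigma> = (\<Sum>i\<le>Suc k. (-1) ^ i * a (singular_face (Suc k) i \<sigma>))"

definition int_cup :: "nat \<Rightarrow> nat \<Rightarrow> ('a, int) cochain \<Rightarrow> ('a, int) cochain
    \<Rightarrow> ((nat \<Rightarrow> real) \<Rightarrow> 'a) \<Rightarrow> int" where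
  "int_cup i j a b \<sigma> = a (front_face i \<sigma>) * b (back_face i j \<sigma>)"

lemma int_coboundary_add: "int_coboundary k (\<lambda>\<sigma>. a \<sigma> + b \<sigma>) \<sigma> = int_coboundary k a \<sigma> + int_coboundary k b \<sigma>"
  by (simp add: int_coboundary_def distrib_left sum.distrib del: sum.atMost_Suc)

lemma int_coboundary_diff: "int_coboundary k (\<lambda>\<sigma>. a \<sigma> - b \<sigma>) \<sigma> = int_coboundary k a \<sigma> - int_coboundary k b \<sigma>"
  by (simp add: int_coboundary_def right_diff_distrib sum_subtractf del: sum.atMost_Suc)

lemma int_coboundary_mult: "int_coboundary k (\<lambda>\<sigma>. c * a \<sigma>) \<sigma> = c * int_coboundary k a \<sigma>"
  by (simp add: int_coboundary_def sum_distrib_left algebra_simps del: sum.atMost_Suc)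

lemma int_coboundary_list:
  "int_coboundary k a \<sigma> = list_bd (\<lambda>l. a (vertex_face l \<sigma>)) [0..<Suc (Suc k)]"
  unfolding int_coboundary_def list_bd_sum
  by (intro sum.cong) (auto simp: singular_face_eq simp del: upt_Suc)

text \<open>On the faces of a fixed simplex \<open>\<sigma>\<close> a cochain becomes a function of vertex lists. This and
  \<open>int_cup_vertex_face\<close> reduce identities between singular cochains to identities between such functions.\<close>

lemma int_coboundary_vertex_face:
  assumes "length l = Suc (Suc k)"
  shows "int_coboundary k a (vertex_face l \<sigma>) = list_bd (\<lambda>l. a (vertex_face l \<sigma>)) l"
proof -
  have "int_coboundary k a (vertex_face l \<sigma>)
      = list_bd (\<lambda>l'. a (vertex_face l' (vertex_face l \<sigma>))) [0..<length l]"
    by (simp add: int_coboundary_list assms del: upt_Suc)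
  also have "\<dots> = list_bd (\<lambda>l'. a (vertex_face (map ((!) l) l') \<sigma>)) [0..<length l]"
  proof (rule list_bd_cong)
    fix l' assume "length [0..<length l] = Suc (length l')" "set l' \<subseteq> set [0..<length l]"
    then have "l' \<noteq> []" "set l' \<subseteq> {..<length l}" using assms by auto
    then show "a (vertex_face l' (vertex_face l \<sigma>)) = a (vertex_face (map ((!) l) l') \<sigma>)"
      by (simp add: vertex_face_vertex_face)
  qed
  also have "\<dots> = list_bd (\<lambda>l. a (vertex_face l \<sigma>)) l"
    using list_bd_map[of "\<lambda>l. a (vertex_face l \<sigma>)" "(!) l" "[0..<length l]"] by (simp add: map_nth)
  finally show ?thesis .
qed

lemma int_cup_list:
  "int_cup i j a b \<sigma> = list_cup i (\<lambda>l. a (vertex_face l \<sigma>)) (\<lambda>l. b (vertex_face l \<sigma>)) [0..<Suc (i + j)]"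
  by (simp add: int_cup_def list_cup_def front_face_eq back_face_eq take_upt del: upt_Suc)

lemma int_cup_vertex_face:
  assumes "length l = Suc (i + j)"
  shows "int_cup i j a b (vertex_face l \<sigma>) =
    list_cup i (\<lambda>l. a (vertex_face l \<sigma>)) (\<lambda>l. b (vertex_face l \<sigma>)) l"
proof -
  have 1: "vertex_face [0..<Suc i] (vertex_face l \<sigma>) = vertex_face (map ((!) l) [0..<Suc i]) \<sigma>"
    using assms by (intro vertex_face_vertex_face) auto
  have 2: "vertex_face [i..<Suc (i + j)] (vertex_face l \<sigma>) = vertex_face (map ((!) l) [i..<Suc (i + j)]) \<sigma>"
    using assms by (intro vertex_face_vertex_face) auto
  have 3: "map ((!) l) [0..<Suc i] = take (Suc i) l" "map ((!) l) [i..<Suc (i + j)] = drop i l"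
    using assms by (auto intro!: nth_equalityI simp del: upt_Suc)
  show ?thesis
    unfolding int_cup_def list_cup_def front_face_eq back_face_eq 1 2 3 by simp
qed

lemma int_coboundary_int_coboundary: "int_coboundary (Suc k) (int_coboundary k a) \<sigma> = 0"
proof -
  have "int_coboundary (Suc k) (int_coboundary k a) \<sigma>
      = list_bd (list_bd (\<lambda>l. a (vertex_face l \<sigma>))) [0..<Suc (Suc (Suc k))]"
    unfolding int_coboundary_list[of "Suc k"]
    by (rule list_bd_cong) (simp add: int_coboundary_vertex_face)
  then show ?thesis by (simp only: list_bd_list_bd)
qed

lemma int_coboundary_int_cup:
  "int_coboundary (i + j) (int_cup i j a b) \<sigma> =
     int_cup (Suc i) j (int_coboundary i a) b \<sigma> + (-1) ^ i * int_cup i (Suc j) a (int_coboundary j b) \<sigma>"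
proof -
  let ?a = "\<lambda>l. a (vertex_face l \<sigma>)" and ?b = "\<lambda>l. b (vertex_face l \<sigma>)"
  let ?l = "[0..<Suc (Suc (i + j))]"
  have "int_coboundary (i + j) (int_cup i j a b) \<sigma> = list_bd (list_cup i ?a ?b) ?l"
    unfolding int_coboundary_list by (rule list_bd_cong) (simp add: int_cup_vertex_face)
  also have "\<dots> = list_bd ?a (take (i + 2) ?l) * ?b (drop (i + 1) ?l)
      + (-1) ^ i * (?a (take (i + 1) ?l) * list_bd ?b (drop i ?l))"
    by (rule list_bd_list_cup) simp
  also have "\<dots> = int_cup (Suc i) j (int_coboundary i a) b \<sigma>
      + (-1) ^ i * int_cup i (Suc j) a (int_coboundary j b) \<sigma>"
    by (simp add: int_cup_list list_cup_def int_coboundary_vertex_face take_upt del: upt_Suc)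
  finally show ?thesis .
qed

lemma int_cup_assoc:
  "int_cup (i + j) l (int_cup i j a b) c \<sigma> = int_cup i (j + l) a (int_cup j l b c) \<sigma>"
  by (simp add: int_cup_list[of _ _ _ _ \<sigma>] list_cup_def int_cup_vertex_face take_upt
      add.assoc del: upt_Suc)

text \<open>Integer valued functions represent cochains modulo \<open>q\<close>: cocycles modulo \<open>q\<close> are closed, and cochains
  that agree modulo \<open>q\<close> with a coboundary are exact. In degree 0 the only coboundary is zero.\<close>

definition int_closed :: "int \<Rightarrow> 'a topology \<Rightarrow> nat \<Rightarrow> ('a, int) cochain \<Rightarrow> bool" where
  "int_closed q X k f \<longleftrightarrow> (\<forall>\<sigma>. singular_simplex (Suc k) X \<sigma> \<longrightarrow> q dvd int_coboundary k f \<sigma>)"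

definition int_exact :: "int \<Rightarrow> 'a topology \<Rightarrow> nat \<Rightarrow> ('a, int) cochain \<Rightarrow> bool" where
  "int_exact q X k f \<longleftrightarrow>
     (case k of 0 \<Rightarrow> \<forall>\<sigma>. singular_simplex 0 X \<sigma> \<longrightarrow> q dvd f \<sigma>
      | Suc j \<Rightarrow> \<exists>b. \<forall>\<sigma>. singular_simplex k X \<sigma> \<longrightarrow> q dvd f \<sigma> - int_coboundary j b \<sigma>)"

lemma singular_simplex_front_face:
  "singular_simplex (i + j) X \<sigma> \<Longrightarrow> singular_simplex i X (front_face i \<sigma>)"
  using singular_simplex_vertex_face[of "i + j" X \<sigma> "[0..<Suc i]"]
  by (force simp: front_face_eq simp del: upt_Suc)

lemma singular_simplex_back_face:
  "singular_simplex (i + j) X \<sigma> \<Longrightarrow> singular_simplex j X (back_face i j \<sigma>)"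
  using singular_simplex_vertex_face[of "i + j" X \<sigma> "[i..<Suc (i + j)]"]
  by (force simp: back_face_eq simp del: upt_Suc)

lemma singular_simplex_face:
  "singular_simplex (Suc k) X \<sigma> \<Longrightarrow> i \<le> Suc k \<Longrightarrow> singular_simplex k X (singular_face (Suc k) i \<sigma>)"
  using singular_simplex_singular_face[of "Suc k" X \<sigma> i] by simp

lemma int_coboundary_dvd:
  assumes "singular_simplex (Suc k) X \<sigma>" "\<And>\<tau>. singular_simplex k X \<tau> \<Longrightarrow> q dvd a \<tau>"
  shows "q dvd int_coboundary k a \<sigma>"
  unfolding int_coboundary_def
  by (intro dvd_sum dvd_mult assms(2) singular_simplex_face[OF assms(1)]) simp

lemma int_closed_cong:
  assumes "\<And>\<sigma>. singular_simplex k X \<sigma> \<Longrightarrow> q dvd f \<sigma> - g \<sigma>" "int_closed q X k f"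
  shows "int_closed q X k g"
  unfolding int_closed_def
proof (intro allI impI)
  fix \<sigma> assume \<sigma>: "singular_simplex (Suc k) X \<sigma>"
  have "q dvd int_coboundary k (\<lambda>\<sigma>. f \<sigma> - g \<sigma>) \<sigma>" using \<sigma> assms(1) by (rule int_coboundary_dvd)
  moreover have "q dvd int_coboundary k f \<sigma>" using assms(2) \<sigma> by (simp add: int_closed_def)
  ultimately show "q dvd int_coboundary k g \<sigma>"
    by (simp add: int_coboundary_diff) (metis dvd_diff_commute dvd_diff_left_iff)
qed

lemma int_closed_add: "int_closed q X k f \<Longrightarrow> int_closed q X k g \<Longrightarrow> int_closed q X k (\<lambda>\<sigma>. f \<sigma> + g \<sigma>)"
  by (simp add: int_closed_def int_coboundary_add)

lemma int_closed_diff: "int_closed q X k f \<Longrightarrow> int_closed q X k g \<Longrightarrow> int_closed q X k (\<lambda>\<sigma>. f \<sigma> - g \<sigma>)"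
  by (simp add: int_closed_def int_coboundary_diff)

lemma int_closed_mult: "int_closed q X k f \<Longrightarrow> int_closed q X k (\<lambda>\<sigma>. c * f \<sigma>)"
  by (simp add: int_closed_def int_coboundary_mult)

lemma int_exact_cong:
  assumes "\<And>\<sigma>. singular_simplex k X \<sigma> \<Longrightarrow> q dvd f \<sigma> - g \<sigma>" "int_exact q X k f"
  shows "int_exact q X k g"
proof (cases k)
  case 0
  then show ?thesis using assms by (auto simp: int_exact_def) (metis dvd_diff_commute dvd_diff_left_iff)
next
  case (Suc j)
  then obtain b where b: "\<And>\<sigma>. singular_simplex k X \<sigma> \<Longrightarrow> q dvd f \<sigma> - int_coboundary j b \<sigma>"
    using assms(2) by (auto simp: int_exact_def)
  have "q dvd g \<sigma> - int_coboundary j b \<sigma>" if "singular_simplex k X \<sigma>" for \<sigma>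
    using dvd_diff[OF b[OF that] assms(1)[OF that]] by simp
  then show ?thesis using Suc by (auto simp: int_exact_def)
qed

lemma int_exact_zero:
  assumes "\<And>\<sigma>. singular_simplex k X \<sigma> \<Longrightarrow> q dvd f \<sigma>"
  shows "int_exact q X k f"
  using assms by (auto simp: int_exact_def int_coboundary_def split: nat.split intro!: exI[of _ "\<lambda>_. 0"])

lemma int_exact_coboundary: "int_exact q X (Suc k) (int_coboundary k b)"
  by (auto simp: int_exact_def intro!: exI[of _ b])

lemma int_exact_add:
  assumes "int_exact q X k f" "int_exact q X k g"
  shows "int_exact q X k (\<lambda>\<sigma>. f \<sigma> + g \<sigma>)"
proof (cases k)
  case 0 then show ?thesis using assms by (simp add: int_exact_def)
next
  case (Suc j)
  then obtain b c where "\<And>\<sigma>. singular_simplex k X \<sigma> \<Longrightarrow> q dvd f \<sigma> - int_coboundary j b \<sigma>"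
    "\<And>\<sigma>. singular_simplex k X \<sigma> \<Longrightarrow> q dvd g \<sigma> - int_coboundary j c \<sigma>"
    using assms by (auto simp: int_exact_def)
  then have "q dvd (f \<sigma> + g \<sigma>) - int_coboundary j (\<lambda>\<sigma>. b \<sigma> + c \<sigma>) \<sigma>" if "singular_simplex k X \<sigma>" for \<sigma>
    unfolding int_coboundary_add using dvd_add that by (metis add_diff_add)
  then show ?thesis using Suc by (auto simp: int_exact_def)
qed

lemma int_exact_mult:
  assumes "int_exact q X k f"
  shows "int_exact q X k (\<lambda>\<sigma>. c * f \<sigma>)"
proof (cases k)
  case 0 then show ?thesis using assms by (simp add: int_exact_def)
next
  case (Suc j)
  then obtain b where "\<And>\<sigma>. singular_simplex k X \<sigma> \<Longrightarrow> q dvd f \<sigma> - int_coboundary j b \<sigma>"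
    using assms by (auto simp: int_exact_def)
  then have "q dvd c * f \<sigma> - int_coboundary j (\<lambda>\<sigma>. c * b \<sigma>) \<sigma>" if "singular_simplex k X \<sigma>" for \<sigma>
    unfolding int_coboundary_mult right_diff_distrib[symmetric] using that by simp
  then show ?thesis using Suc by (auto simp: int_exact_def)
qed

lemma int_exact_diff:
  "int_exact q X k f \<Longrightarrow> int_exact q X k g \<Longrightarrow> int_exact q X k (\<lambda>\<sigma>. f \<sigma> - g \<sigma>)"
  using int_exact_add[of q X k f "\<lambda>\<sigma>. -1 * g \<sigma>"] int_exact_mult[of q X k g "-1"] by simp

lemma int_exact_imp_closed:
  assumes "int_exact q X k f"
  shows "int_closed q X k f"
proof (cases k)
  case 0
  then show ?thesis using assms int_coboundary_dvd[of 0 X _ q f] by (auto simp: int_closed_def int_exact_def)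
next
  case (Suc j)
  then obtain b where b: "\<And>\<sigma>. singular_simplex k X \<sigma> \<Longrightarrow> q dvd f \<sigma> - int_coboundary j b \<sigma>"
    using assms by (auto simp: int_exact_def)
  have "int_closed q X k (int_coboundary j b)"
    by (simp add: int_closed_def Suc int_coboundary_int_coboundary)
  then show ?thesis
    by (rule int_closed_cong[rotated]) (metis b dvd_diff_commute)
qed

lemma int_closed_cup:
  assumes "int_closed q X i f" "int_closed q X j g"
  shows "int_closed q X (i + j) (int_cup i j f g)"
  unfolding int_closed_def
proof (intro allI impI)
  fix \<sigma> assume \<sigma>: "singular_simplex (Suc (i + j)) X \<sigma>"
  then have "singular_simplex (Suc i) X (front_face (Suc i) \<sigma>)" "singular_simplex (Suc j) X (back_face i (Suc j) \<sigma>)"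
    using singular_simplex_front_face[of "Suc i" j X \<sigma>] singular_simplex_back_face[of i "Suc j" X \<sigma>] by auto
  then show "q dvd int_coboundary (i + j) (int_cup i j f g) \<sigma>"
    unfolding int_coboundary_int_cup int_cup_def using assms by (simp add: int_closed_def)
qed

lemma int_exact_cup_left:
  assumes f: "int_exact q X i f" and g: "int_closed q X j g"
  shows "int_exact q X (i + j) (int_cup i j f g)"
proof (cases i)
  case 0
  then show ?thesis using f singular_simplex_front_face[of i j X]
    by (intro int_exact_zero) (auto simp: int_cup_def int_exact_def)
next
  case (Suc m)
  then obtain b where b: "\<And>\<sigma>. singular_simplex i X \<sigma> \<Longrightarrow> q dvd f \<sigma> - int_coboundary m b \<sigma>"
    using f by (auto simp: int_exact_def)
  show ?thesis
  proof (rule int_exact_cong)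
    show "int_exact q X (i + j) (int_coboundary (m + j) (int_cup m j b g))"
      using int_exact_coboundary Suc by simp
    fix \<sigma> assume \<sigma>: "singular_simplex (i + j) X \<sigma>"
    have 1: "q dvd f (front_face i \<sigma>) - int_coboundary m b (front_face i \<sigma>)"
      using b singular_simplex_front_face[OF \<sigma>] .
    have 2: "q dvd int_coboundary j g (back_face m (Suc j) \<sigma>)"
      using g singular_simplex_back_face[of m "Suc j" X \<sigma>] \<sigma> Suc by (simp add: int_closed_def)
    have "int_coboundary (m + j) (int_cup m j b g) \<sigma> - int_cup i j f g \<sigma>
        = (-1) ^ m * b (front_face m \<sigma>) * int_coboundary j g (back_face m (Suc j) \<sigma>)
          - (f (front_face i \<sigma>) - int_coboundary m b (front_face i \<sigma>)) * g (back_face i j \<sigma>)"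
      unfolding int_coboundary_int_cup int_cup_def by (simp add: Suc algebra_simps)
    then show "q dvd int_coboundary (m + j) (int_cup m j b g) \<sigma> - int_cup i j f g \<sigma>"
      using 1 2 by simp
  qed
qed

lemma int_exact_cup_right:
  assumes f: "int_closed q X i f" and g: "int_exact q X j g"
  shows "int_exact q X (i + j) (int_cup i j f g)"
proof (cases j)
  case 0
  then show ?thesis using g singular_simplex_back_face[of i j X]
    by (intro int_exact_zero) (auto simp: int_cup_def int_exact_def)
next
  case (Suc m)
  then obtain b where b: "\<And>\<sigma>. singular_simplex j X \<sigma> \<Longrightarrow> q dvd g \<sigma> - int_coboundary m b \<sigma>"
    using g by (auto simp: int_exact_def)
  show ?thesis
  proof (rule int_exact_cong)
    show "int_exact q X (i + j) (\<lambda>\<sigma>. (-1) ^ i * int_coboundary (i + m) (int_cup i m f b) \<sigma>)"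
      using int_exact_coboundary Suc by (intro int_exact_mult) simp
    fix \<sigma> assume \<sigma>: "singular_simplex (i + j) X \<sigma>"
    have 1: "q dvd g (back_face i j \<sigma>) - int_coboundary m b (back_face i j \<sigma>)"
      using b singular_simplex_back_face[OF \<sigma>] .
    have 2: "q dvd int_coboundary i f (front_face (Suc i) \<sigma>)"
      using f singular_simplex_front_face[of "Suc i" m X \<sigma>] \<sigma> Suc by (simp add: int_closed_def)
    have sq: "(-1) ^ i * ((-1) ^ i * y) = (y::int)" for y
      by (simp flip: mult.assoc power_mult_distrib)
    have "(-1) ^ i * int_coboundary (i + m) (int_cup i m f b) \<sigma> - int_cup i j f g \<sigma>
        = (-1) ^ i * int_coboundary i f (front_face (Suc i) \<sigma>) * b (back_face (Suc i) m \<sigma>)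
          - f (front_face i \<sigma>) * (g (back_face i j \<sigma>) - int_coboundary m b (back_face i j \<sigma>))"
      unfolding int_coboundary_int_cup int_cup_def by (simp add: Suc algebra_simps sq)
    then show "q dvd (-1) ^ i * int_coboundary (i + m) (int_cup i m f b) \<sigma> - int_cup i j f g \<sigma>"
      using 1 2 by simp
  qed
qed

definition int_flip :: "nat \<Rightarrow> ('a, int) cochain \<Rightarrow> ((nat \<Rightarrow> real) \<Rightarrow> 'a) \<Rightarrow> int" where
  "int_flip k a \<sigma> = flip_sign (Suc k) * a (vertex_face (rev [0..<Suc k]) \<sigma>)"

definition int_prism :: "nat \<Rightarrow> ('a, int) cochain \<Rightarrow> ((nat \<Rightarrow> real) \<Rightarrow> 'a) \<Rightarrow> int" where
  "int_prism k a \<sigma> = list_prism (\<lambda>l. a (vertex_face l \<sigma>)) [0..<Suc k]"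

lemma int_prism_vertex_face:
  assumes "length l = Suc k"
  shows "int_prism k a (vertex_face l \<sigma>) = list_prism (\<lambda>l. a (vertex_face l \<sigma>)) l"
proof -
  have "int_prism k a (vertex_face l \<sigma>)
      = list_prism (\<lambda>l'. a (vertex_face (map ((!) l) l') \<sigma>)) [0..<length l]"
    unfolding int_prism_def assms[symmetric]
  proof (rule list_prism_cong)
    fix l' assume "length l' = Suc (length [0..<length l])" "set l' \<subseteq> set [0..<length l]"
    then have "l' \<noteq> []" "set l' \<subseteq> {..<length l}" using assms by auto
    then show "a (vertex_face l' (vertex_face l \<sigma>)) = a (vertex_face (map ((!) l) l') \<sigma>)"
      by (simp add: vertex_face_vertex_face)
  qed
  also have "\<dots> = list_prism (\<lambda>l. a (vertex_face l \<sigma>)) l"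
    using list_prism_map[of "\<lambda>l. a (vertex_face l \<sigma>)" "(!) l" "[0..<length l]"] by (simp add: map_nth)
  finally show ?thesis .
qed

lemma vertex_face_self: "singular_simplex k X \<sigma> \<Longrightarrow> vertex_face [0..<Suc k] \<sigma> = \<sigma>"
  unfolding front_face_eq[symmetric] front_face_def singular_simplex_def
  by (simp add: extensional_restrict)

text \<open>The homotopy for vertex lists is natural in the list, so it induces one on singular cochains.\<close>

lemma int_exact_flip_diff:
  assumes "int_closed q X k a"
  shows "int_exact q X k (\<lambda>\<sigma>. int_flip k a \<sigma> - a \<sigma>)"
proof -
  let ?l = "[0..<Suc k]"
  let ?d = "\<lambda>\<sigma>. list_bd (list_prism (\<lambda>l. a (vertex_face l \<sigma>))) ?l"
  have hom: "q dvd ?d \<sigma> - (int_flip k a \<sigma> - a \<sigma>)" if \<sigma>: "singular_simplex k X \<sigma>" for \<sigma>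
  proof -
    have "q dvd list_prism (list_bd (\<lambda>l. a (vertex_face l \<sigma>))) ?l"
    proof (rule list_prism_dvd)
      fix l' assume l': "length l' = Suc (length ?l)" "set l' \<subseteq> set ?l"
      then have "singular_simplex (Suc k) X (vertex_face l' \<sigma>)"
        using singular_simplex_vertex_face[OF \<sigma>, of l'] by force
      then show "q dvd list_bd (\<lambda>l. a (vertex_face l \<sigma>)) l'"
        using assms l'(1) int_coboundary_vertex_face[of l' k a \<sigma>]
        unfolding int_closed_def by (metis length_upt diff_zero)
    qed
    moreover have "?d \<sigma> + list_prism (list_bd (\<lambda>l. a (vertex_face l \<sigma>))) ?l = int_flip k a \<sigma> - a \<sigma>"
      using list_prism_homotopy[of ?l "\<lambda>l. a (vertex_face l \<sigma>)"] vertex_face_self[OF \<sigma>]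
      by (simp add: int_flip_def del: upt_Suc)
    ultimately show ?thesis by (metis add_diff_cancel_left' dvd_minus_iff minus_diff_eq)
  qed
  show ?thesis
  proof (cases k)
    case 0
    then show ?thesis using hom by (auto simp: int_exact_def) (metis dvd_minus_iff minus_diff_eq)
  next
    case (Suc m)
    have "?d = int_coboundary m (int_prism m a)"
      unfolding int_coboundary_list Suc
      by (intro ext list_bd_cong) (simp add: int_prism_vertex_face)
    then have "int_exact q X k ?d" using int_exact_coboundary[of q X m "int_prism m a"] Suc by simp
    then show ?thesis using hom by (rule int_exact_cong[rotated])
  qed
qed

lemma flip_sign_product: "flip_sign (Suc (i + j)) = (-1) ^ (i * j) * (flip_sign (Suc i) * flip_sign (Suc j))"
proof (induction j)
  case 0
  then show ?case by (simp add: flip_sign_def)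
next
  case (Suc j)
  then show ?case
    by (simp add: flip_sign_Suc[of "Suc (i + j)"] flip_sign_Suc[of "Suc j"] power_add algebra_simps)
qed

lemma int_flip_cup: "int_flip (i + j) (int_cup i j a b) \<sigma> = (-1) ^ (i * j) * int_cup j i (int_flip j b) (int_flip i a) \<sigma>"
proof -
  let ?l = "[0..<Suc (i + j)]"
  have 1: "rev (drop j ?l) = take (Suc i) (rev ?l)" "rev (take (Suc j) ?l) = drop i (rev ?l)"
    by (simp_all add: rev_drop rev_take del: upt_Suc drop_upt take_upt)
  have f: "int_flip k c (vertex_face l \<sigma>) = flip_sign (Suc k) * c (vertex_face (rev l) \<sigma>)"
    if "length l = Suc k" for k c l
  proof -
    have "vertex_face (rev [0..<length l]) (vertex_face l \<sigma>) = vertex_face (map ((!) l) (rev [0..<length l])) \<sigma>"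
      using that by (intro vertex_face_vertex_face) auto
    also have "map ((!) l) (rev [0..<length l]) = rev l"
      by (simp add: rev_map[symmetric] map_nth)
    finally show ?thesis using that
      by (simp add: int_flip_def del: upt_Suc)
  qed
  have "int_flip (i + j) (int_cup i j a b) \<sigma>
     = flip_sign (Suc (i + j)) * (a (vertex_face (take (Suc i) (rev ?l)) \<sigma>) * b (vertex_face (drop i (rev ?l)) \<sigma>))"
    by (simp add: int_flip_def int_cup_vertex_face list_cup_def del: upt_Suc)
  also have "\<dots> = (-1) ^ (i * j) * (int_flip j b (vertex_face (take (Suc j) ?l) \<sigma>) * int_flip i a (vertex_face (drop j ?l) \<sigma>))"
    unfolding 1[symmetric] flip_sign_product by (simp add: f del: upt_Suc)
  also have "\<dots> = (-1) ^ (i * j) * int_cup j i (int_flip j b) (int_flip i a) \<sigma>"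
    by (simp add: int_cup_list list_cup_def add.commute[of j i] del: upt_Suc)
  finally show ?thesis .
qed

text \<open>Reversing the vertices of simplices interchanges the two factors of a cup product up to the sign
  \<open>(-1)\<^sup>i\<^sup>j\<close>, and it acts as the identity on cohomology.\<close>

lemma int_cup_graded_commute:
  assumes a: "int_closed q X i a" and b: "int_closed q X j b"
  shows "int_exact q X (i + j) (\<lambda>\<sigma>. int_cup i j a b \<sigma> - (-1) ^ (i * j) * int_cup j i b a \<sigma>)"
proof -
  have fb: "int_closed q X j (int_flip j b)"
    using int_closed_add[OF int_exact_imp_closed[OF int_exact_flip_diff[OF b]] b] by simp
  have "int_exact q X (j + i) (int_cup j i (int_flip j b) (\<lambda>\<sigma>. int_flip i a \<sigma> - a \<sigma>))"
    by (intro int_exact_cup_right fb int_exact_flip_diff a)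
  moreover have "int_exact q X (j + i) (int_cup j i (\<lambda>\<sigma>. int_flip j b \<sigma> - b \<sigma>) a)"
    by (intro int_exact_cup_left int_exact_flip_diff a b)
  ultimately have "int_exact q X (j + i) (\<lambda>\<sigma>. int_cup j i (int_flip j b) (\<lambda>\<sigma>. int_flip i a \<sigma> - a \<sigma>) \<sigma>
      + int_cup j i (\<lambda>\<sigma>. int_flip j b \<sigma> - b \<sigma>) a \<sigma>)" by (rule int_exact_add)
  then have 1: "int_exact q X (i + j) (\<lambda>\<sigma>. (-1) ^ (i * j) *
      (int_cup j i (int_flip j b) (int_flip i a) \<sigma> - int_cup j i b a \<sigma>))"
    by (intro int_exact_mult) (simp add: int_cup_def algebra_simps)
  have 2: "int_exact q X (i + j) (\<lambda>\<sigma>. int_flip (i + j) (int_cup i j a b) \<sigma> - int_cup i j a b \<sigma>)"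
    by (intro int_exact_flip_diff int_closed_cup a b)
  from int_exact_diff[OF 1 2] show ?thesis
    by (simp add: int_flip_cup algebra_simps)
qed

section \<open>Small simplices and contractible spaces\<close>

definition chain_eval :: "('v \<Rightarrow> int) \<Rightarrow> ('v \<Rightarrow>\<^sub>0 int) \<Rightarrow> int" where
  "chain_eval f z = (\<Sum>\<sigma>\<in>Poly_Mapping.keys z. Poly_Mapping.lookup z \<sigma> * f \<sigma>)"

lemma chain_eval_superset:
  assumes "finite S" "Poly_Mapping.keys z \<subseteq> S"
  shows "chain_eval f z = (\<Sum>\<sigma>\<in>S. Poly_Mapping.lookup z \<sigma> * f \<sigma>)"
  unfolding chain_eval_def
  by (rule sum.mono_neutral_left) (use assms in \<open>auto simp: in_keys_iff\<close>)

lemma chain_eval_0 [simp]: "chain_eval f 0 = 0"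
  by (simp add: chain_eval_def)

lemma chain_eval_of [simp]: "chain_eval f (frag_of \<sigma>) = f \<sigma>"
  by (simp add: chain_eval_def)

lemma chain_eval_diff: "chain_eval f (z - w) = chain_eval f z - chain_eval f w"
proof -
  let ?S = "Poly_Mapping.keys z \<union> Poly_Mapping.keys w"
  have "chain_eval f u = (\<Sum>\<sigma>\<in>?S. Poly_Mapping.lookup u \<sigma> * f \<sigma>)"
    if "Poly_Mapping.keys u \<subseteq> ?S" for u
    using that by (intro chain_eval_superset) auto
  then show ?thesis
    using keys_diff[of z w] by (simp add: lookup_minus left_diff_distrib sum_subtractf)
qed

lemma chain_eval_uminus: "chain_eval f (- z) = - chain_eval f z"
  using chain_eval_diff[of f 0 z] by simp

lemma chain_eval_add: "chain_eval f (z + w) = chain_eval f z + chain_eval f w"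
  using chain_eval_diff[of f z "- w"] by (simp add: chain_eval_uminus)

lemma chain_eval_cmul: "chain_eval f (frag_cmul c z) = c * chain_eval f z"
proof (cases "c = 0")
  case False
  have "chain_eval f (frag_cmul c z) = (\<Sum>\<sigma>\<in>Poly_Mapping.keys z. Poly_Mapping.lookup (frag_cmul c z) \<sigma> * f \<sigma>)"
    by (rule chain_eval_superset) (auto simp: keys_cmul)
  then show ?thesis by (simp add: chain_eval_def sum_distrib_left mult.assoc)
qed simp

lemma chain_eval_sum: "chain_eval f (\<Sum>i\<in>I. z i) = (\<Sum>i\<in>I. chain_eval f (z i))"
  by (induction I rule: infinite_finite_induct) (auto simp: chain_eval_add)

lemma chain_eval_extend: "chain_eval f (frag_extend g z) = chain_eval (\<lambda>\<sigma>. chain_eval f (g \<sigma>)) z"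
  by (simp add: frag_extend_def chain_eval_sum chain_eval_cmul) (simp add: chain_eval_def)

lemma chain_eval_dvd: "(\<And>\<sigma>. \<sigma> \<in> Poly_Mapping.keys z \<Longrightarrow> q dvd f \<sigma>) \<Longrightarrow> q dvd chain_eval f z"
  by (simp add: chain_eval_def dvd_sum)

lemma chain_eval_boundary:
  "chain_eval f (chain_boundary (Suc k) z) = chain_eval (int_coboundary k f) z"
  by (simp add: chain_boundary_def chain_eval_extend chain_eval_sum chain_eval_cmul
      int_coboundary_def[abs_def] del: sum.atMost_Suc)

lemma int_closed_boundary:
  assumes "int_closed q X k f" "singular_chain (Suc k) X z"
  shows "q dvd chain_eval f (chain_boundary (Suc k) z)"
  unfolding chain_eval_boundary
  using assms by (intro chain_eval_dvd) (auto simp: int_closed_def singular_chain_def)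

text \<open>The theorem on small simplices, for cochains. Let \<open>T\<close> be the homotopy from the identity to
  barycentric subdivision \<open>S\<close>; the sum of \<open>T S\<^sup>i\<close> over \<open>i < m\<close> is then a homotopy to \<open>S\<^sup>m\<close>. The number of
  subdivisions that makes a simplex small depends on the simplex, so the primitive of \<open>f\<close> is the
  evaluation of \<open>f\<close> on this homotopy with \<open>m = N \<tau>\<close> depending on \<open>\<tau>\<close>. Any larger number gives the same
  value modulo \<open>q\<close>, because the extra terms are \<open>T\<close> of small chains, where \<open>f\<close> vanishes.\<close>

proposition int_exact_if_small_vanish:
  assumes opn: "\<And>U. U \<in> \<C> \<Longrightarrow> openin X U" and cov: "topspace X \<subseteq> \<Union>\<C>"
    and closed: "int_closed q X k f"
    and vanish: "\<And>U \<sigma>. U \<in> \<C> \<Longrightarrow> singular_simplex k (subtopology X U) \<sigma> \<Longrightarrow> q dvd f \<sigma>"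
  shows "int_exact q X k f"
proof (cases k)
  case 0
  have "q dvd f \<sigma>" if \<sigma>: "singular_simplex 0 X \<sigma>" for \<sigma>
  proof -
    have "\<sigma> ` standard_simplex 0 \<subseteq> topspace X"
      using \<sigma> by (fastforce simp: singular_simplex_def continuous_map_def)
    then obtain U where "U \<in> \<C>" "\<sigma> ` standard_simplex 0 \<subseteq> U"
      using cov by (auto simp: standard_simplex_0)
    then show ?thesis using vanish \<sigma> 0 by (auto simp: singular_simplex_subtopology)
  qed
  then show ?thesis using 0 by (simp add: int_exact_def)
next
  case (Suc j)
  obtain T where T0: "\<And>p. T p 0 = (0 :: 'a chain)"
    and Td: "\<And>p c1 c2. T p (c1 - c2) = T p c1 - T p c2"
    and Tc: "\<And>p Y c. singular_chain p Y c \<Longrightarrow> singular_chain (Suc p) Y (T p c)"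
    and Tb: "\<And>p Y c. singular_chain p Y c \<Longrightarrow>
         chain_boundary (Suc p) (T p c) + T (p - Suc 0) (chain_boundary p c) = singular_subdivision p c - c"
    by (rule chain_homotopic_singular_subdivision) blast
  define S where "S = (\<lambda>p::nat. (singular_subdivision p :: 'a chain \<Rightarrow> 'a chain))"
  have Sd: "(S p ^^ i) (a - b) = (S p ^^ i) a - (S p ^^ i) b" for p i a b
    unfolding S_def by (rule singular_subdivision_power_diff)
  have S0: "(S p ^^ i) 0 = 0" for p i unfolding S_def by (rule singular_subdivision_power_0)
  have Sc: "singular_chain p Y ((S p ^^ i) c)" if "singular_chain p Y c" for p Y i c
    using that by (induction i) (auto simp: S_def singular_chain_singular_subdivision)
  have Sb: "chain_boundary p ((S p ^^ i) c) = (S (p - Suc 0) ^^ i) (chain_boundary p c)"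
    if "singular_chain p X c" for p i c
  proof (induction i)
    case (Suc i)
    then show ?case using chain_boundary_singular_subdivision[OF Sc[OF that, of i]] by (simp add: S_def)
  qed simp
  define D where "D p m z = (\<Sum>i<m. T p ((S p ^^ i) z))" for p m z
  have D0: "D p m 0 = 0" for p m by (simp add: D_def S0 T0)
  have Dd: "D p m (a - b) = D p m a - D p m b" for p m a b
    by (simp add: D_def Sd Td sum_subtractf)
  have Dc: "singular_chain (Suc p) X (D p m z)" if "singular_chain p X z" for p m z
    unfolding D_def by (intro singular_chain_sum Tc Sc that)
  have Db: "chain_boundary (Suc p) (D p m z) + D (p - Suc 0) m (chain_boundary p z) = (S p ^^ m) z - z"
    if z: "singular_chain p X z" for p m z
  proof (induction m)
    case (Suc m)
    have "chain_boundary (Suc p) (T p ((S p ^^ m) z)) + T (p - Suc 0) ((S (p - Suc 0) ^^ m) (chain_boundary p z))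
        = S p ((S p ^^ m) z) - (S p ^^ m) z"
      using Tb[OF Sc[OF z, of m]] Sb[OF z, of m] by (simp add: S_def)
    moreover have "chain_boundary (Suc p) (D p (Suc m) z) + D (p - Suc 0) (Suc m) (chain_boundary p z) =
        (chain_boundary (Suc p) (D p m z) + D (p - Suc 0) m (chain_boundary p z)) +
        (chain_boundary (Suc p) (T p ((S p ^^ m) z)) + T (p - Suc 0) ((S (p - Suc 0) ^^ m) (chain_boundary p z)))"
      by (simp add: D_def chain_boundary_add add_ac)
    ultimately show ?case unfolding Suc by simp
  qed (simp add: D_def)
  define small where "small p \<tau> \<longleftrightarrow> (\<exists>U\<in>\<C>. singular_simplex p (subtopology X U) \<tau>)" for p \<tau>
  have "\<exists>N. \<forall>m\<ge>N. \<forall>\<rho>\<in>Poly_Mapping.keys ((S p ^^ m) (frag_of \<tau>)). small p \<rho>"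
    if \<tau>: "singular_simplex p X \<tau>" for p \<tau>
  proof -
    have c: "singular_chain p X (frag_of \<tau>)" using \<tau> by (simp add: singular_chain_of)
    obtain N where N: "\<And>m \<rho>. N \<le> m \<Longrightarrow> \<rho> \<in> Poly_Mapping.keys ((singular_subdivision p ^^ m) (frag_of \<tau>))
        \<Longrightarrow> \<exists>V \<in> \<C>. \<rho> \<in> standard_simplex p \<rightarrow> V"
      using sufficient_iterated_singular_subdivision_exists[OF opn cov c] by blast
    show ?thesis
    proof (intro exI[of _ N] allI impI ballI)
      fix m \<rho> assume m: "N \<le> m" "\<rho> \<in> Poly_Mapping.keys ((S p ^^ m) (frag_of \<tau>))"
      then obtain V where "V \<in> \<C>" "\<rho> \<in> standard_simplex p \<rightarrow> V"
        using N[of m \<rho>] by (auto simp: S_def)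
      moreover have "singular_simplex p X \<rho>"
        using Sc[OF c, of m] m by (auto simp: singular_chain_def)
      ultimately show "small p \<rho>"
        by (auto simp: small_def singular_simplex_subtopology image_subset_iff Pi_iff)
    qed
  qed
  then obtain N where N: "\<And>p \<tau> m \<rho>. \<lbrakk>singular_simplex p X \<tau>; N p \<tau> \<le> m;
      \<rho> \<in> Poly_Mapping.keys ((S p ^^ m) (frag_of \<tau>))\<rbrakk> \<Longrightarrow> small p \<rho>"
    by metis
  have T_small: "q dvd chain_eval f (T j z)" if "Poly_Mapping.keys z \<subseteq> Collect (small j)" for z
    using that
  proof (induction rule: frag_induction)
    case (one \<rho>)
    then obtain U where U: "U \<in> \<C>" "singular_simplex j (subtopology X U) \<rho>" by (auto simp: small_def)
    then have "singular_chain k (subtopology X U) (T j (frag_of \<rho>))"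
      using Tc[of j "subtopology X U" "frag_of \<rho>"] by (simp add: singular_chain_of Suc)
    then show ?case using vanish[OF U(1)] by (intro chain_eval_dvd) (auto simp: singular_chain_def)
  qed (auto simp: T0 Td chain_eval_diff)
  define g where "g m \<tau> = chain_eval f (D j m (frag_of \<tau>))" for m \<tau>
  have g_stable: "q dvd g M \<tau> - g (N j \<tau>) \<tau>" if \<tau>: "singular_simplex j X \<tau>" and M: "N j \<tau> \<le> M" for \<tau> M
  proof -
    have "(\<Sum>i<M. T j ((S j ^^ i) (frag_of \<tau>))) =
        (\<Sum>i<N j \<tau>. T j ((S j ^^ i) (frag_of \<tau>))) + (\<Sum>i\<in>{N j \<tau>..<M}. T j ((S j ^^ i) (frag_of \<tau>)))"
      using M by (metis atLeast0LessThan le0 sum.atLeastLessThan_concat)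
    then have "g M \<tau> - g (N j \<tau>) \<tau> = (\<Sum>i\<in>{N j \<tau>..<M}. chain_eval f (T j ((S j ^^ i) (frag_of \<tau>))))"
      by (simp add: g_def D_def chain_eval_add chain_eval_sum)
    moreover have "q dvd chain_eval f (T j ((S j ^^ i) (frag_of \<tau>)))" if "i \<in> {N j \<tau>..<M}" for i
      using that N[OF \<tau>] by (intro T_small) auto
    ultimately show ?thesis by (auto intro!: dvd_sum)
  qed
  have g_eval: "chain_eval f (D j m z) = chain_eval (g m) z" for m z
  proof -
    have "Poly_Mapping.keys z \<subseteq> UNIV" by simp
    then show ?thesis
      by (induction rule: frag_induction) (auto simp: D0 Dd chain_eval_diff g_def)
  qed
  have "q dvd f \<sigma> - int_coboundary j (\<lambda>\<tau>. - g (N j \<tau>) \<tau>) \<sigma>" if \<sigma>: "singular_simplex k X \<sigma>" for \<sigma>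
  proof -
    have c: "singular_chain k X (frag_of \<sigma>)" using \<sigma> by (simp add: singular_chain_of)
    have face: "singular_simplex j X (singular_face k i \<sigma>)" if "i \<le> k" for i
      using that singular_simplex_face \<sigma> Suc by blast
    define M where "M = Max (insert (N k \<sigma>) ((\<lambda>i. N j (singular_face k i \<sigma>)) ` {..k}))"
    have M: "N k \<sigma> \<le> M" "\<And>i. i \<le> k \<Longrightarrow> N j (singular_face k i \<sigma>) \<le> M"
      unfolding M_def by (rule Max_ge; simp)+
    have "chain_eval f (chain_boundary (Suc k) (D k M (frag_of \<sigma>))) + chain_eval f (D j M (chain_boundary k (frag_of \<sigma>)))
        = chain_eval f ((S k ^^ M) (frag_of \<sigma>)) - f \<sigma>"
      using arg_cong[OF Db[OF c, of M], of "chain_eval f"] Suc by (simp add: chain_eval_add chain_eval_diff)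
    moreover have "chain_eval f (D j M (chain_boundary k (frag_of \<sigma>))) = int_coboundary j (g M) \<sigma>"
      by (simp add: g_eval Suc chain_eval_boundary)
    moreover have "q dvd chain_eval f (chain_boundary (Suc k) (D k M (frag_of \<sigma>)))"
      by (rule int_closed_boundary[OF closed Dc[OF c]])
    moreover have "q dvd chain_eval f ((S k ^^ M) (frag_of \<sigma>))"
      using N[OF \<sigma> M(1)] vanish by (intro chain_eval_dvd) (auto simp: small_def)
    moreover have "f \<sigma> + b = s - a" if "a + b = s - f \<sigma>" for a b s :: int using that by simp
    ultimately have 1: "q dvd f \<sigma> + int_coboundary j (g M) \<sigma>"
      by (metis dvd_diff)
    have "q dvd int_coboundary j (\<lambda>\<tau>. g M \<tau> - g (N j \<tau>) \<tau>) \<sigma>"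
      unfolding int_coboundary_def Suc[symmetric]
      using g_stable face M(2) by (intro dvd_sum dvd_mult) auto
    then have 2: "q dvd int_coboundary j (g M) \<sigma> - int_coboundary j (\<lambda>\<tau>. g (N j \<tau>) \<tau>) \<sigma>"
      by (simp add: int_coboundary_diff)
    have 3: "int_coboundary j (\<lambda>\<tau>. - g (N j \<tau>) \<tau>) \<sigma> = - int_coboundary j (\<lambda>\<tau>. g (N j \<tau>) \<tau>) \<sigma>"
      using int_coboundary_mult[of j "-1"] by simp
    show ?thesis using dvd_diff[OF 1 2] unfolding 3 by (simp add: algebra_simps)
  qed
  then show ?thesis using Suc by (auto simp: int_exact_def)
qed

text \<open>Cycles of the augmented chain complex, all of which bound in a contractible space.\<close>

definition reduced_cycle :: "nat \<Rightarrow> 'a topology \<Rightarrow> 'a chain \<Rightarrow> bool" where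
  "reduced_cycle p X z \<longleftrightarrow> singular_chain p X z \<and> chain_boundary p z = 0 \<and>
     (p = 0 \<longrightarrow> chain_eval (\<lambda>_. 1) z = 0)"

lemma chain_boundary_extend:
  assumes "\<And>\<sigma>. singular_simplex p X \<sigma> \<Longrightarrow> chain_boundary r (g \<sigma>) = frag_of \<sigma> - h \<sigma>"
    and "singular_chain p X z"
  shows "chain_boundary r (frag_extend g z) = z - frag_extend h z"
  using assms(2) unfolding singular_chain_def
  by (induction rule: frag_induction) (auto simp: assms(1) chain_boundary_diff frag_extend_diff)

lemma reduced_cycle_boundary:
  assumes "singular_chain (Suc p) X z"
  shows "reduced_cycle p X (chain_boundary (Suc p) z)"
proof -
  have "chain_eval (\<lambda>_. 1) (chain_boundary (Suc 0) z) = 0"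
    unfolding chain_eval_boundary by (simp add: int_coboundary_def[abs_def] chain_eval_def)
  then show ?thesis
    using assms chain_boundary_boundary[OF assms] singular_chain_boundary_alt
    by (auto simp: reduced_cycle_def)
qed

lemma contractible_cycle_bounds:
  assumes hom: "homotopic_with (\<lambda>x. True) X X id (\<lambda>x. a)" and a: "a \<in> topspace X"
    and z: "singular_chain p X z" "chain_boundary p z = 0"
  shows "\<exists>w. singular_chain (Suc p) X w \<and>
    chain_boundary (Suc p) w = z - (if p = 0 then chain_map 0 (\<lambda>x. a) z else 0)"
proof -
  have cyc: "singular_relcycle p X {} z" using z by (simp add: singular_cycle)
  have "homologous_rel p X {} (chain_map p id z) (chain_map p (\<lambda>x. a) z)"
    by (rule homotopic_imp_homologous_rel_chain_maps[OF _ cyc]) (use hom in simp)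
  then obtain w where w: "singular_chain (Suc p) X w"
      "chain_boundary (Suc p) w = chain_map p id z - chain_map p (\<lambda>x. a) z"
    unfolding homologous_rel_def singular_boundary by blast
  have id: "chain_map p id z = z" using z(1) by (intro chain_map_id_gen) auto
  show ?thesis
  proof (cases "p = 0")
    case False
    let ?Y = "subtopology X {a}"
    have Y: "topspace ?Y = {a}" using a by auto
    have "singular_relcycle p ?Y {} (chain_map p (\<lambda>x. a) z)"
      by (rule singular_relcycle_chain_map[OF cyc])
        (use a in \<open>auto simp: continuous_map_in_subtopology\<close>)
    then have "singular_relboundary p ?Y {} (chain_map p (\<lambda>x. a) z)"
      using singular_boundary_eq_cycle_singleton[OF Y, of p] False by simp
    then obtain v where v: "singular_chain (Suc p) ?Y v" "chain_boundary (Suc p) v = chain_map p (\<lambda>x. a) z"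
      unfolding singular_boundary by blast
    have "singular_chain (Suc p) X v" using v(1) by (simp add: singular_chain_subtopology)
    then show ?thesis using w v id False
      by (intro exI[of _ "w + v"]) (auto simp: singular_chain_add chain_boundary_add)
  qed (use w id in auto)
qed

text \<open>The universal coefficient argument for a contractible space: since chain groups are free, every
  reduced cycle can be bounded in a linear fashion, degree by degree.\<close>

lemma contractible_linear_filling:
  assumes hom: "homotopic_with (\<lambda>x. True) X X id (\<lambda>x. a)" and a: "a \<in> topspace X"
  shows "\<exists>g. (\<forall>\<sigma>. singular_simplex p X \<sigma> \<longrightarrow> singular_chain (Suc p) X (g \<sigma>)) \<and>
    (\<forall>z. reduced_cycle p X z \<longrightarrow> chain_boundary (Suc p) (frag_extend g z) = z)"
proof (induction p)
  case 0
  define c where "c = (simplex_map 0 (\<lambda>x. a) (undefined :: (nat \<Rightarrow> real) \<Rightarrow> 'a))"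
  have c: "simplex_map 0 (\<lambda>x. a) \<sigma> = c" for \<sigma> :: "(nat \<Rightarrow> real) \<Rightarrow> 'a"
    by (simp add: c_def simplex_map_def o_def)
  have "\<exists>w. singular_chain (Suc 0) X w \<and> chain_boundary (Suc 0) w = frag_of \<sigma> - frag_of c"
    if "singular_simplex 0 X \<sigma>" for \<sigma>
    using contractible_cycle_bounds[OF hom a, of 0 "frag_of \<sigma>"] that
    by (simp add: singular_chain_of chain_boundary_def c)
  then obtain g where g: "\<And>\<sigma>. singular_simplex 0 X \<sigma> \<Longrightarrow>
      singular_chain (Suc 0) X (g \<sigma>) \<and> chain_boundary (Suc 0) (g \<sigma>) = frag_of \<sigma> - frag_of c"
    by metis
  have "chain_boundary (Suc 0) (frag_extend g z) = z" if z: "reduced_cycle 0 X z" for z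
  proof -
    have "chain_boundary (Suc 0) (frag_extend g z) = z - frag_extend (\<lambda>_. frag_of c) z"
      using g z by (intro chain_boundary_extend) (auto simp: reduced_cycle_def)
    also have "frag_extend (\<lambda>_. frag_of c) z = frag_cmul (chain_eval (\<lambda>_. 1) z) (frag_of c)"
    proof -
      have "Poly_Mapping.keys z \<subseteq> UNIV" by simp
      then show ?thesis
        by (induction rule: frag_induction)
          (simp_all add: frag_extend_diff chain_eval_diff frag_cmul_diff_distrib)
    qed
    finally show ?thesis using z by (simp add: reduced_cycle_def)
  qed
  then show ?case using g by auto
next
  case (Suc p)
  then obtain g where g: "\<And>\<sigma>. singular_simplex p X \<sigma> \<Longrightarrow> singular_chain (Suc p) X (g \<sigma>)"
    "\<And>z. reduced_cycle p X z \<Longrightarrow> chain_boundary (Suc p) (frag_extend g z) = z" by blast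
  have "\<exists>w. singular_chain (Suc (Suc p)) X w \<and> chain_boundary (Suc (Suc p)) w
      = frag_of \<sigma> - frag_extend g (chain_boundary (Suc p) (frag_of \<sigma>))"
    if \<sigma>: "singular_simplex (Suc p) X \<sigma>" for \<sigma>
  proof -
    let ?z = "frag_of \<sigma> - frag_extend g (chain_boundary (Suc p) (frag_of \<sigma>))"
    have s: "singular_chain (Suc p) X (frag_of \<sigma>)" using \<sigma> by (simp add: singular_chain_of)
    have "singular_chain (Suc p) X (frag_extend g (chain_boundary (Suc p) (frag_of \<sigma>)))"
      using g(1) singular_chain_boundary_alt[OF s] by (intro singular_chain_extend) (auto simp: singular_chain_def)
    then have "singular_chain (Suc p) X ?z" using s by (rule singular_chain_diff[rotated])
    moreover have "chain_boundary (Suc p) ?z = 0"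
      using g(2)[OF reduced_cycle_boundary[OF s]] by (simp add: chain_boundary_diff)
    ultimately show ?thesis using contractible_cycle_bounds[OF hom a, of "Suc p" ?z] by simp
  qed
  then obtain g' where g': "\<And>\<sigma>. singular_simplex (Suc p) X \<sigma> \<Longrightarrow> singular_chain (Suc (Suc p)) X (g' \<sigma>) \<and>
      chain_boundary (Suc (Suc p)) (g' \<sigma>) = frag_of \<sigma> - frag_extend g (chain_boundary (Suc p) (frag_of \<sigma>))"
    by metis
  have "chain_boundary (Suc (Suc p)) (frag_extend g' z) = z" if z: "reduced_cycle (Suc p) X z" for z
  proof -
    have sz: "singular_chain (Suc p) X z" using z by (simp add: reduced_cycle_def)
    have "frag_extend (\<lambda>\<sigma>. frag_extend g (chain_boundary (Suc p) (frag_of \<sigma>))) z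
        = frag_extend g (chain_boundary (Suc p) z)"
      using sz unfolding singular_chain_def
      by (induction rule: frag_induction) (auto simp: frag_extend_diff chain_boundary_diff)
    then show ?thesis
      using chain_boundary_extend[OF _ sz, of "Suc (Suc p)" g'] g' z by (simp add: reduced_cycle_def)
  qed
  then show ?case using g' by auto
qed

text \<open>The restriction map from the cohomology of \<open>U\<close> to that of \<open>V\<close> in degree \<open>i\<close> has finite image: the classes
  in the image are represented by the members of a finite set.\<close>

definition finite_image :: "int \<Rightarrow> nat \<Rightarrow> 'a topology \<Rightarrow> 'a set \<Rightarrow> 'a set \<Rightarrow> bool" where
  "finite_image q i X V U \<longleftrightarrow> (\<exists>F. finite F \<and>
     (\<forall>f. int_closed q (subtopology X U) i f \<longrightarrow>
        (\<exists>g\<in>F. int_exact q (subtopology X V) i (\<lambda>\<sigma>. f \<sigma> - g \<sigma>))))"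

lemma int_closed_subset: "int_closed q (subtopology X U) i f \<Longrightarrow> V \<subseteq> U \<Longrightarrow> int_closed q (subtopology X V) i f"
  unfolding int_closed_def using singular_simplex_mono by blast

lemma int_exact_subset:
  assumes "int_exact q (subtopology X U) i f" "V \<subseteq> U"
  shows "int_exact q (subtopology X V) i f"
proof (cases i)
  case 0
  then show ?thesis using assms singular_simplex_mono[of 0 X V _ U] by (auto simp: int_exact_def)
next
  case (Suc j)
  then obtain b where "\<And>\<sigma>. singular_simplex i (subtopology X U) \<sigma> \<Longrightarrow> q dvd f \<sigma> - int_coboundary j b \<sigma>"
    using assms(1) by (auto simp: int_exact_def)
  then show ?thesis using Suc singular_simplex_mono[of i X V _ U] assms(2)
    by (auto simp: int_exact_def intro!: exI[of _ b])
qed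

lemma finite_image_mono:
  assumes "finite_image q i X V U" "V' \<subseteq> V" "U \<subseteq> U'"
  shows "finite_image q i X V' U'"
  using assms int_closed_subset int_exact_subset unfolding finite_image_def by metis

text \<open>In positive degrees the transpose of a linear filling of cycles exhibits each cocycle as a
  coboundary. In degree 0 a cocycle is constant modulo \<open>q\<close>, which leaves \<open>q\<close> possibilities.\<close>

lemma finite_image_contractible:
  assumes "contractible_space (subtopology X B)" "B \<subseteq> U" "0 < q"
  shows "finite_image q i X B U"
proof (cases "topspace (subtopology X B) = {}")
  case True
  then show ?thesis unfolding finite_image_def
    by (intro exI[of _ "{\<lambda>_. 0}"]) (auto intro!: int_exact_zero simp: singular_simplex_empty)
next
  case ne: False
  let ?Y = "subtopology X B"
  obtain a where hom: "homotopic_with (\<lambda>x. True) ?Y ?Y id (\<lambda>x. a)"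
    using assms(1) by (auto simp: contractible_space_def)
  have a: "a \<in> topspace ?Y"
    using homotopic_with_imp_continuous_maps[OF hom] ne by (metis continuous_map_const null_topspace_iff_trivial)
  show ?thesis
  proof (cases i)
    case 0
    obtain c where c: "\<And>f \<sigma>. int_closed q ?Y 0 f \<Longrightarrow> singular_simplex 0 ?Y \<sigma> \<Longrightarrow> q dvd f \<sigma> - f c"
    proof
      fix f \<sigma> assume f: "int_closed q ?Y 0 f" and \<sigma>: "singular_simplex 0 ?Y \<sigma>"
      obtain w where "singular_chain (Suc 0) ?Y w"
          "chain_boundary (Suc 0) w = frag_of \<sigma> - frag_of (simplex_map 0 (\<lambda>x. a) \<sigma>)"
        using contractible_cycle_bounds[OF hom a, of 0 "frag_of \<sigma>"] \<sigma>
        by (auto simp: singular_chain_of chain_boundary_def)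
      then show "q dvd f \<sigma> - f (simplex_map 0 (\<lambda>x. a) (undefined :: (nat \<Rightarrow> real) \<Rightarrow> 'a))"
        using int_closed_boundary[OF f, of w] by (simp add: chain_eval_diff simplex_map_def o_def)
    qed
    show ?thesis unfolding finite_image_def
    proof (intro exI[of _ "(\<lambda>r _. r) ` {0..<q}"] conjI allI impI)
      fix f assume "int_closed q (subtopology X U) i f"
      then have f: "int_closed q ?Y 0 f" using int_closed_subset assms(2) 0 by blast
      have "q dvd f \<sigma> - f c mod q" if "singular_simplex 0 ?Y \<sigma>" for \<sigma>
        using c[OF f that] by (simp add: mod_eq_dvd_iff[symmetric])
      then have "int_exact q ?Y i (\<lambda>\<sigma>. f \<sigma> - f c mod q)" by (simp add: int_exact_def 0)
      then show "\<exists>g\<in>(\<lambda>r _. r) ` {0..<q}. int_exact q ?Y i (\<lambda>\<sigma>. f \<sigma> - g \<sigma>)"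
        using assms(3) by (auto intro!: bexI[of _ "f c mod q"])
    qed simp
  next
    case (Suc j)
    obtain g where g: "\<And>\<sigma>. singular_simplex j ?Y \<sigma> \<Longrightarrow> singular_chain (Suc j) ?Y (g \<sigma>)"
        "\<And>z. reduced_cycle j ?Y z \<Longrightarrow> chain_boundary (Suc j) (frag_extend g z) = z"
      using contractible_linear_filling[OF hom a, of j] by blast
    have "int_exact q ?Y i f" if f: "int_closed q (subtopology X U) i f" for f
    proof -
      have f': "int_closed q ?Y i f" using f int_closed_subset assms(2) by blast
      have "q dvd f \<sigma> - int_coboundary j (\<lambda>\<tau>. chain_eval f (g \<tau>)) \<sigma>" if \<sigma>: "singular_simplex i ?Y \<sigma>" for \<sigma>
      proof -
        let ?z = "frag_of \<sigma> - frag_extend g (chain_boundary (Suc j) (frag_of \<sigma>))"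
        have s: "singular_chain (Suc j) ?Y (frag_of \<sigma>)" using \<sigma> Suc by (simp add: singular_chain_of)
        have "singular_chain (Suc j) ?Y (frag_extend g (chain_boundary (Suc j) (frag_of \<sigma>)))"
          using g(1) singular_chain_boundary_alt[OF s] by (intro singular_chain_extend) (auto simp: singular_chain_def)
        then have "singular_chain (Suc j) ?Y ?z" using s by (rule singular_chain_diff[rotated])
        moreover have "chain_boundary (Suc j) ?z = 0"
          using g(2)[OF reduced_cycle_boundary[OF s]] by (simp add: chain_boundary_diff)
        ultimately obtain w where "singular_chain (Suc i) ?Y w" "chain_boundary (Suc i) w = ?z"
          using contractible_cycle_bounds[OF hom a, of "Suc j" ?z] Suc by auto
        then have "q dvd chain_eval f ?z" using int_closed_boundary[OF f', of w] by simp
        then show ?thesis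
          by (simp add: chain_eval_diff chain_eval_extend chain_eval_boundary)
      qed
      then show ?thesis using Suc by (auto simp: int_exact_def)
    qed
    then show ?thesis unfolding finite_image_def by (intro exI[of _ "{\<lambda>_. 0}"]) auto
  qed
qed

section \<open>Finiteness of the cohomology of a closed manifold\<close>

text \<open>The two primitives of \<open>h\<close> differ on the overlap by a coboundary \<open>e\<close>. Subtracting \<open>e\<close> from the first
  one changes no coboundary and makes them agree there, so together they form a primitive of \<open>h\<close> on
  all simplices that lie in one of the two sets; these suffice by the theorem on small simplices.\<close>

lemma int_exact_glue:
  assumes V: "openin X V1" "openin X V2"
    and h: "int_closed q (subtopology X (V1 \<union> V2)) (Suc j) h"
    and h1: "\<And>\<sigma>. singular_simplex (Suc j) (subtopology X V1) \<sigma> \<Longrightarrow> q dvd h \<sigma> - int_coboundary j \<beta>1 \<sigma>"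
    and h2: "\<And>\<sigma>. singular_simplex (Suc j) (subtopology X V2) \<sigma> \<Longrightarrow> q dvd h \<sigma> - int_coboundary j \<beta>2 \<sigma>"
    and ov: "int_exact q (subtopology X (V1 \<inter> V2)) j (\<lambda>\<sigma>. \<beta>1 \<sigma> - \<beta>2 \<sigma>)"
  shows "int_exact q (subtopology X (V1 \<union> V2)) (Suc j) h"
proof -
  \<comment> \<open>In degree 0 exactness on the overlap means agreement, and \<open>e\<close> is zero.\<close>
  obtain e where e: "\<And>\<tau>. singular_simplex j (subtopology X (V1 \<inter> V2)) \<tau> \<Longrightarrow> q dvd \<beta>1 \<tau> - \<beta>2 \<tau> - e \<tau>"
    and e0: "\<And>\<sigma>. int_coboundary j e \<sigma> = 0"
  proof (cases j)
    case 0
    then show ?thesis using ov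
      by (intro that[of "\<lambda>_. 0"]) (auto simp: int_exact_def int_coboundary_def)
  next
    case (Suc i)
    then obtain b where "\<And>\<tau>. singular_simplex j (subtopology X (V1 \<inter> V2)) \<tau> \<Longrightarrow>
        q dvd \<beta>1 \<tau> - \<beta>2 \<tau> - int_coboundary i b \<tau>"
      using ov by (auto simp: int_exact_def)
    then show ?thesis using Suc by (intro that[of "int_coboundary i b"]) (auto simp: int_coboundary_int_coboundary)
  qed
  define \<beta> where "\<beta> \<tau> = (if singular_simplex j (subtopology X V1) \<tau> then \<beta>1 \<tau> - e \<tau> else \<beta>2 \<tau>)" for \<tau>
  let ?Y = "subtopology X (V1 \<union> V2)"
  have sub: "subtopology ?Y V1 = subtopology X V1" "subtopology ?Y V2 = subtopology X V2"
    by (simp_all add: subtopology_subtopology inf_sup_absorb Int_absorb1)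
  have face: "singular_simplex j Z (singular_face (Suc j) i \<sigma>)"
    if "singular_simplex (Suc j) Z \<sigma>" "i \<le> Suc j" for Z \<sigma> i
    using singular_simplex_face that by blast
  have b1: "q dvd int_coboundary j \<beta> \<sigma> - int_coboundary j \<beta>1 \<sigma>"
    if "singular_simplex (Suc j) (subtopology X V1) \<sigma>" for \<sigma>
  proof -
    have "int_coboundary j \<beta> \<sigma> = int_coboundary j (\<lambda>\<tau>. \<beta>1 \<tau> - e \<tau>) \<sigma>"
      unfolding int_coboundary_def by (intro sum.cong) (use face[OF that] in \<open>auto simp: \<beta>_def\<close>)
    then show ?thesis by (simp add: int_coboundary_diff e0)
  qed
  have b2: "q dvd int_coboundary j \<beta> \<sigma> - int_coboundary j \<beta>2 \<sigma>"
    if \<sigma>: "singular_simplex (Suc j) (subtopology X V2) \<sigma>" for \<sigma>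
  proof -
    have "q dvd \<beta> \<tau> - \<beta>2 \<tau>" if "singular_simplex j (subtopology X V2) \<tau>" for \<tau>
      using that e[of \<tau>] by (auto simp: \<beta>_def singular_simplex_subtopology algebra_simps)
    then have "q dvd int_coboundary j (\<lambda>\<tau>. \<beta> \<tau> - \<beta>2 \<tau>) \<sigma>" by (rule int_coboundary_dvd[OF \<sigma>])
    then show ?thesis by (simp add: int_coboundary_diff)
  qed
  have "int_exact q ?Y (Suc j) (\<lambda>\<sigma>. h \<sigma> - int_coboundary j \<beta> \<sigma>)"
  proof (rule int_exact_if_small_vanish[where \<C> = "{V1, V2}"])
    show "openin ?Y U" if "U \<in> {V1, V2}" for U
      using that V by (auto simp: openin_subtopology intro: exI[of _ U])
    show "topspace ?Y \<subseteq> \<Union>{V1, V2}" by auto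
    show "int_closed q ?Y (Suc j) (\<lambda>\<sigma>. h \<sigma> - int_coboundary j \<beta> \<sigma>)"
      by (intro int_closed_diff h int_exact_imp_closed int_exact_coboundary)
    show "q dvd h \<sigma> - int_coboundary j \<beta> \<sigma>"
      if "U \<in> {V1, V2}" "singular_simplex (Suc j) (subtopology ?Y U) \<sigma>" for U \<sigma>
    proof -
      from that consider "singular_simplex (Suc j) (subtopology X V1) \<sigma>"
        | "singular_simplex (Suc j) (subtopology X V2) \<sigma>"
        using sub by auto
      then show ?thesis
      proof cases
        case 1 show ?thesis using dvd_diff[OF h1[OF 1] b1[OF 1]] by (simp add: algebra_simps)
      next
        case 2 show ?thesis using dvd_diff[OF h2[OF 2] b2[OF 2]] by (simp add: algebra_simps)
      qed
    qed
  qed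
  from int_exact_add[OF this int_exact_coboundary[of q ?Y j \<beta>]] show ?thesis by simp
qed

lemma finite_representatives:
  assumes "finite (key ` C)" and "\<And>f f'. \<lbrakk>f \<in> C; f' \<in> C; key f = key f'\<rbrakk> \<Longrightarrow> R f f'"
  shows "\<exists>r. finite (r ` C) \<and> (\<forall>f \<in> C. r f \<in> C \<and> R f (r f))"
proof (intro exI[of _ "\<lambda>f. inv_into C key (key f)"] conjI ballI)
  show "finite ((\<lambda>f. inv_into C key (key f)) ` C)"
    using finite_imageI[OF assms(1), of "inv_into C key"] by (simp add: image_image)
  fix f assume f: "f \<in> C"
  then have "key f \<in> key ` C" by simp
  then have 1: "inv_into C key (key f) \<in> C" "key (inv_into C key (key f)) = key f"
    using inv_into_into[of "key f" key C] f_inv_into_f[of "key f" key C] by auto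
  show "inv_into C key (key f) \<in> C" by (rule 1(1))
  show "R f (inv_into C key (key f))" using assms(2)[OF f 1(1)] 1(2) by simp
qed

text \<open>The Mayer--Vietoris step. Up to finitely many choices, a cocycle on \<open>U\<close> has primitives on \<open>W1\<close> and
  on \<open>W2\<close>. They differ on the overlap by a cocycle of one degree less, whose restriction to
  \<open>V1 \<inter> V2\<close> has only finitely many classes; if that class is trivial, then the primitives can be
  glued.\<close>

lemma finite_image_Un:
  assumes V: "openin X V1" "openin X V2" and VW: "V1 \<subseteq> W1" "V2 \<subseteq> W2" and WU: "W1 \<subseteq> U" "W2 \<subseteq> U"
    and F1: "finite_image q i X W1 U" and F2: "finite_image q i X W2 U"
    and ov: "\<And>j. i = Suc j \<Longrightarrow> finite_image q j X (V1 \<inter> V2) (W1 \<inter> W2)"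
  shows "finite_image q i X (V1 \<union> V2) U"
proof -
  let ?X = "subtopology X"
  define C where "C = {f. int_closed q (?X U) i f}"
  obtain E1 E2 where E: "finite E1" "finite E2"
      "\<And>f. f \<in> C \<Longrightarrow> \<exists>g\<in>E1. int_exact q (?X W1) i (\<lambda>\<sigma>. f \<sigma> - g \<sigma>)"
      "\<And>f. f \<in> C \<Longrightarrow> \<exists>g\<in>E2. int_exact q (?X W2) i (\<lambda>\<sigma>. f \<sigma> - g \<sigma>)"
    using F1 F2 unfolding finite_image_def C_def by auto
  have "\<forall>f\<in>C. \<exists>g. g \<in> E1 \<and> int_exact q (?X W1) i (\<lambda>\<sigma>. f \<sigma> - g \<sigma>)"
    "\<forall>f\<in>C. \<exists>g. g \<in> E2 \<and> int_exact q (?X W2) i (\<lambda>\<sigma>. f \<sigma> - g \<sigma>)"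
    using E(3,4) by blast+
  from bchoice[OF this(1)] bchoice[OF this(2)] obtain g1 g2
    where g: "\<And>f. f \<in> C \<Longrightarrow> g1 f \<in> E1 \<and> int_exact q (?X W1) i (\<lambda>\<sigma>. f \<sigma> - g1 f \<sigma>)"
      "\<And>f. f \<in> C \<Longrightarrow> g2 f \<in> E2 \<and> int_exact q (?X W2) i (\<lambda>\<sigma>. f \<sigma> - g2 f \<sigma>)"
    by blast
  have close: "int_exact q (?X W) i (\<lambda>\<sigma>. f \<sigma> - f' \<sigma>)"
    if "int_exact q (?X W) i (\<lambda>\<sigma>. f \<sigma> - g \<sigma>)" "int_exact q (?X W) i (\<lambda>\<sigma>. f' \<sigma> - g \<sigma>)" for W f f' g
    using int_exact_diff[OF that] by simp
  define R where "R f f' \<longleftrightarrow> int_exact q (?X W1) i (\<lambda>\<sigma>. f \<sigma> - f' \<sigma>) \<and> int_exact q (?X W2) i (\<lambda>\<sigma>. f \<sigma> - f' \<sigma>)" for f f'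
  have fin: "finite ((\<lambda>f. (g1 f, g2 f)) ` C)"
    by (rule finite_subset[of _ "E1 \<times> E2"]) (use g E in auto)
  have "R f f'" if "f \<in> C" "f' \<in> C" "(g1 f, g2 f) = (g1 f', g2 f')" for f f'
    using that g(1)[of f] g(1)[of f'] g(2)[of f] g(2)[of f']
      close[of W1 f "g1 f" f'] close[of W2 f "g2 f" f'] by (simp add: R_def)
  from finite_representatives[of "\<lambda>f. (g1 f, g2 f)" C R, OF fin this]
  obtain r where r: "finite (r ` C)" "\<And>f. f \<in> C \<Longrightarrow> r f \<in> C \<and> R f (r f)" by blast
  then have r: "finite (r ` C)" "\<And>f. f \<in> C \<Longrightarrow> r f \<in> C"
    "\<And>f. f \<in> C \<Longrightarrow> int_exact q (?X W1) i (\<lambda>\<sigma>. f \<sigma> - r f \<sigma>) \<and> int_exact q (?X W2) i (\<lambda>\<sigma>. f \<sigma> - r f \<sigma>)"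
    by (auto simp: R_def)
  have sub: "\<And>f W. W \<subseteq> U \<Longrightarrow> f \<in> C \<Longrightarrow> int_closed q (?X W) i f"
    using int_closed_subset by (auto simp: C_def)
  have "\<exists>key :: _ \<Rightarrow> ('a, int) cochain \<times> ('a, int) cochain.
    finite (key ` C) \<and> (\<forall>f\<in>C. \<forall>f'\<in>C. key f = key f' \<longrightarrow>
      int_exact q (?X (V1 \<union> V2)) i (\<lambda>\<sigma>. f \<sigma> - f' \<sigma>))"
  proof (cases i)
    case 0
    have "int_exact q (?X (V1 \<union> V2)) i (\<lambda>\<sigma>. f \<sigma> - f' \<sigma>)" if f: "f \<in> C" "f' \<in> C" "r f = r f'" for f f'
    proof -
      have "int_exact q (?X W1) i (\<lambda>\<sigma>. f \<sigma> - f' \<sigma>)" "int_exact q (?X W2) i (\<lambda>\<sigma>. f \<sigma> - f' \<sigma>)"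
        using close[of _ f "r f" f'] r(3)[OF f(1)] r(3)[OF f(2)] f(3) by auto
      then have "int_exact q (?X V1) i (\<lambda>\<sigma>. f \<sigma> - f' \<sigma>)" "int_exact q (?X V2) i (\<lambda>\<sigma>. f \<sigma> - f' \<sigma>)"
        using int_exact_subset VW by blast+
      then show ?thesis using 0 by (auto simp: int_exact_def singular_simplex_subtopology standard_simplex_0)
    qed
    moreover have "finite ((\<lambda>f. (r f, r f)) ` C)"
      using finite_imageI[OF r(1), of "\<lambda>h. (h, h)"] by (simp add: image_image)
    ultimately show ?thesis by (intro exI[of _ "\<lambda>f. (r f, r f)"]) auto
  next
    case (Suc j)
    have "\<exists>b. \<forall>\<sigma>. singular_simplex i (?X W) \<sigma> \<longrightarrow> q dvd (f \<sigma> - r f \<sigma>) - int_coboundary j b \<sigma>"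
      if "f \<in> C" "W = W1 \<or> W = W2" for f W
      using r(3)[OF that(1)] that(2) Suc by (auto simp: int_exact_def)
    then obtain b where b: "\<And>f W \<sigma>. \<lbrakk>f \<in> C; W = W1 \<or> W = W2; singular_simplex i (?X W) \<sigma>\<rbrakk>
        \<Longrightarrow> q dvd (f \<sigma> - r f \<sigma>) - int_coboundary j (b f W) \<sigma>"
      by metis
    have cl: "int_closed q (?X (W1 \<inter> W2)) j (\<lambda>\<tau>. b f W1 \<tau> - b f W2 \<tau>)" if f: "f \<in> C" for f
      unfolding int_closed_def
    proof (intro allI impI)
      fix \<sigma> assume "singular_simplex (Suc j) (?X (W1 \<inter> W2)) \<sigma>"
      then have "singular_simplex i (?X W1) \<sigma>" "singular_simplex i (?X W2) \<sigma>"
        using Suc by (auto simp: singular_simplex_subtopology)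
      then have "q dvd (f \<sigma> - r f \<sigma>) - int_coboundary j (b f W2) \<sigma> - ((f \<sigma> - r f \<sigma>) - int_coboundary j (b f W1) \<sigma>)"
        using b[OF f, of W1 \<sigma>] b[OF f, of W2 \<sigma>] by (simp only: dvd_diff simp_thms)
      then show "q dvd int_coboundary j (\<lambda>\<tau>. b f W1 \<tau> - b f W2 \<tau>) \<sigma>"
        by (simp add: int_coboundary_diff)
    qed
    obtain E where E: "finite E" "\<And>f. int_closed q (?X (W1 \<inter> W2)) j f \<Longrightarrow>
        \<exists>g\<in>E. int_exact q (?X (V1 \<inter> V2)) j (\<lambda>\<sigma>. f \<sigma> - g \<sigma>)"
      using ov[OF Suc] unfolding finite_image_def by blast
    have "\<forall>f\<in>C. \<exists>g. g \<in> E \<and> int_exact q (?X (V1 \<inter> V2)) j (\<lambda>\<tau>. (b f W1 \<tau> - b f W2 \<tau>) - g \<tau>)"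
      using E(2)[OF cl] by blast
    from bchoice[OF this] obtain g where g: "\<And>f. f \<in> C \<Longrightarrow> g f \<in> E \<and>
        int_exact q (?X (V1 \<inter> V2)) j (\<lambda>\<tau>. (b f W1 \<tau> - b f W2 \<tau>) - g f \<tau>)"
      by blast
    have "finite ((\<lambda>f. (r f, g f)) ` C)"
      by (rule finite_subset[of _ "r ` C \<times> E"]) (use g E r in auto)
    moreover have "int_exact q (?X (V1 \<union> V2)) i (\<lambda>\<sigma>. f \<sigma> - f' \<sigma>)"
      if f: "f \<in> C" "f' \<in> C" and key: "(r f, g f) = (r f', g f')" for f f'
    proof -
      have "q dvd (f \<sigma> - f' \<sigma>) - int_coboundary j (\<lambda>\<tau>. b f W \<tau> - b f' W \<tau>) \<sigma>"
        if "W = W1 \<or> W = W2" "singular_simplex (Suc j) (?X W) \<sigma>" for W \<sigma>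
      proof -
        have s: "singular_simplex i (?X W) \<sigma>" using that(2) Suc by simp
        show ?thesis
          using dvd_diff[OF b[OF f(1) that(1) s] b[OF f(2) that(1) s]] key
          by (simp add: int_coboundary_diff algebra_simps)
      qed
      moreover have "singular_simplex (Suc j) (?X W1) \<sigma>" if "singular_simplex (Suc j) (?X V1) \<sigma>" for \<sigma>
        using that VW singular_simplex_mono by blast
      moreover have "singular_simplex (Suc j) (?X W2) \<sigma>" if "singular_simplex (Suc j) (?X V2) \<sigma>" for \<sigma>
        using that VW singular_simplex_mono by blast
      moreover have "int_exact q (?X (V1 \<inter> V2)) j
          (\<lambda>\<tau>. (b f W1 \<tau> - b f' W1 \<tau>) - (b f W2 \<tau> - b f' W2 \<tau>))"
        using int_exact_diff[OF conjunct2[OF g[OF f(1)]] conjunct2[OF g[OF f(2)]]] key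
        by (simp add: algebra_simps)
      moreover have "int_closed q (?X (V1 \<union> V2)) (Suc j) (\<lambda>\<sigma>. f \<sigma> - f' \<sigma>)"
      proof -
        have "V1 \<union> V2 \<subseteq> U" using VW WU by blast
        from sub[OF this] show ?thesis using f Suc by (intro int_closed_diff) auto
      qed
      ultimately show ?thesis
        unfolding Suc using int_exact_glue[OF V, of q j "\<lambda>\<sigma>. f \<sigma> - f' \<sigma>"
          "\<lambda>\<tau>. b f W1 \<tau> - b f' W1 \<tau>" "\<lambda>\<tau>. b f W2 \<tau> - b f' W2 \<tau>"] by blast
    qed
    ultimately show ?thesis by (intro exI[of _ "\<lambda>f. (r f, g f)"]) blast
  qed
  then obtain key :: "('a, int) cochain \<Rightarrow>
      ('a, int) cochain \<times> ('a, int) cochain" where key: "finite (key ` C)" "\<And>f f'. \<lbrakk>f \<in> C; f' \<in> C; key f = key f'\<rbrakk> \<Longrightarrow>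
      int_exact q (?X (V1 \<union> V2)) i (\<lambda>\<sigma>. f \<sigma> - f' \<sigma>)" by blast
  from finite_representatives[of key C "\<lambda>f f'. int_exact q (?X (V1 \<union> V2)) i (\<lambda>\<sigma>. f \<sigma> - f' \<sigma>)", OF key]
  obtain r' where "finite (r' ` C)" "\<forall>f\<in>C. r' f \<in> C \<and> int_exact q (?X (V1 \<union> V2)) i (\<lambda>\<sigma>. f \<sigma> - r' f \<sigma>)"
    by blast
  then show ?thesis unfolding finite_image_def C_def by (intro exI[of _ "r' ` C"]) (auto simp: C_def)
qed

text \<open>Induction on the degree. For fixed \<open>U\<close>, the closed sets \<open>K\<close> with the claimed property are closed under
  finite unions by the Mayer--Vietoris step, where shrinking the neighbourhoods by normality provides
  room for the induction hypothesis on the overlap. Compactness reduces the claim to closed sets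
  inside contractible neighbourhoods.\<close>

lemma finite_image_compact:
  assumes comp: "compact_space X" and haus: "Hausdorff_space X"
    and base: "\<And>U x. \<lbrakk>openin X U; x \<in> U\<rbrakk> \<Longrightarrow>
        \<exists>B. openin X B \<and> x \<in> B \<and> B \<subseteq> U \<and> contractible_space (subtopology X B)"
    and q: "0 < q" and "openin X U" "closedin X K" "K \<subseteq> U"
  shows "\<exists>V. openin X V \<and> K \<subseteq> V \<and> V \<subseteq> U \<and> finite_image q i X V U"
  using assms(5-7)
proof (induction i arbitrary: U K rule: less_induct)
  case (less i)
  note IH = less.IH and U = less.prems(1) and K = less.prems(2,3)
  have norm: "\<exists>V. openin X V \<and> S \<subseteq> V \<and> X closure_of V \<subseteq> W" if "closedin X S" "openin X W" "S \<subseteq> W" for S W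
    using compact_Hausdorff_or_regular_imp_normal_space[OF comp] haus that unfolding normal_space_alt by blast
  define good where "good K \<longleftrightarrow> (\<exists>V. openin X V \<and> K \<subseteq> V \<and> V \<subseteq> U \<and> finite_image q i X V U)" for K
  have good_Un: "good (K1 \<union> K2)" if K: "closedin X K1" "closedin X K2" "good K1" "good K2" for K1 K2
  proof -
    obtain W1 W2 where W: "openin X W1" "K1 \<subseteq> W1" "W1 \<subseteq> U" "finite_image q i X W1 U"
      "openin X W2" "K2 \<subseteq> W2" "W2 \<subseteq> U" "finite_image q i X W2 U"
      using K(3,4) unfolding good_def by blast
    obtain V1 V2 where V: "openin X V1" "K1 \<subseteq> V1" "X closure_of V1 \<subseteq> W1"
      "openin X V2" "K2 \<subseteq> V2" "X closure_of V2 \<subseteq> W2"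
      using norm K W by meson
    have VW: "V1 \<subseteq> X closure_of V1" "V2 \<subseteq> X closure_of V2"
      using V closure_of_subset openin_subset by metis+
    have "finite_image q j X (V1 \<inter> V2) (W1 \<inter> W2)" if "i = Suc j" for j
    proof -
      have "openin X (W1 \<inter> W2)" "closedin X (X closure_of V1 \<inter> X closure_of V2)"
        "X closure_of V1 \<inter> X closure_of V2 \<subseteq> W1 \<inter> W2"
        using W V by auto
      from IH[OF _ this, of j] that obtain V' where
        "X closure_of V1 \<inter> X closure_of V2 \<subseteq> V'" "finite_image q j X V' (W1 \<inter> W2)" by blast
      then show ?thesis using VW by (meson Int_mono finite_image_mono order_refl order_trans)
    qed
    then have "finite_image q i X (V1 \<union> V2) U"
      using V W VW by (intro finite_image_Un[of X V1 V2 W1 W2 U q i]) auto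
    then show ?thesis unfolding good_def using V W VW by (intro exI[of _ "V1 \<union> V2"]) auto
  qed
  have good_empty: "good {}"
    unfolding good_def finite_image_def
    by (intro exI[of _ "{}"] conjI exI[of _ "{\<lambda>_. 0}"])
      (auto intro!: int_exact_zero simp: singular_simplex_empty)
  have "\<exists>N. openin X N \<and> x \<in> N \<and> good (X closure_of N)" if "x \<in> K" for x
  proof -
    have "x \<in> U" using K(2) that by (rule subsetD)
    from base[OF U this] obtain B where B: "openin X B" "x \<in> B" "B \<subseteq> U"
      "contractible_space (subtopology X B)"
      by (elim exE conjE)
    have "x \<in> topspace X" using openin_subset[OF B(1)] B(2) by auto
    with haus have "closedin X {x}" by (rule closedin_Hausdorff_singleton)
    then obtain N where N: "openin X N" "{x} \<subseteq> N" "X closure_of N \<subseteq> B"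
      using norm[OF _ B(1)] B(2) by (metis empty_subsetI insert_subset)
    have "finite_image q i X B U"
      using B q by (intro finite_image_contractible)
    then have "good (X closure_of N)" using B N(3) unfolding good_def by blast
    then show ?thesis using N by blast
  qed
  then obtain N where N: "\<And>x. x \<in> K \<Longrightarrow> openin X (N x) \<and> x \<in> N x \<and> good (X closure_of N x)" by metis
  have "compactin X K" using closedin_compact_space[OF comp K(1)] .
  then obtain \<F> where \<F>: "finite \<F>" "\<F> \<subseteq> N ` K" "K \<subseteq> \<Union>\<F>"
    unfolding compactin_def using N by (auto elim!: allE[of _ "N ` K"])
  have "good (\<Union>W\<in>\<F>. X closure_of W) \<and> closedin X (\<Union>W\<in>\<F>. X closure_of W)"
    using \<F>(1,2)
  proof (induction \<F> rule: finite_induct)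
    case (insert W \<F>)
    then have "good (X closure_of W)" using N by auto
    then show ?case using good_Un insert by auto
  qed (use good_empty in auto)
  moreover have "K \<subseteq> (\<Union>W\<in>\<F>. X closure_of W)"
    proof
    fix x assume "x \<in> K"
    then obtain W where W: "W \<in> \<F>" "x \<in> W" using \<F>(3) by blast
    then have "openin X W" using \<F>(2) N by blast
    then have "W \<subseteq> X closure_of W" by (intro closure_of_subset openin_subset)
    then show "x \<in> (\<Union>W\<in>\<F>. X closure_of W)" using W by blast
  qed
  ultimately show ?case
    unfolding good_def by (meson order_trans)
qed

text \<open>The box is convex, so the straight-line homotopy to its centre stays inside.\<close>

lemma contractible_space_box:
  assumes x: "x \<in> topspace (Euclidean_space n)"
  shows "contractible_space (subtopology (Euclidean_space n) {y. \<forall>i<n. dist (x i) (y i) < r i})"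
proof -
  let ?B = "{y. \<forall>i<n. dist (x i) (y i) < r i}"
  let ?Y = "subtopology (Euclidean_space n) ?B"
  let ?h = "\<lambda>(t, y) i. if i < n then (1 - t) * y i + t * x i else (0::real)"
  show ?thesis
  proof (cases "x \<in> ?B")
    case False
    then have "topspace ?Y = {}" by (force simp: zero_less_dist_iff intro: le_less_trans[OF zero_le_dist])
    then have "?Y = trivial_topology" by (simp only: null_topspace_iff_trivial)
    then show ?thesis by simp
  next
    case True
    have xz: "x i = 0" if "i \<ge> n" for i using x that by (simp add: topspace_Euclidean_space)
    have P: "continuous_map (prod_topology (top_of_set {0..1::real}) ?Y) (Euclidean_space n) (snd)"
      using continuous_map_snd by (rule continuous_map_into_fulltopology)
    have comp: "continuous_map (Euclidean_space n) euclideanreal (\<lambda>y. y i)" for i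
      unfolding Euclidean_space_def
    by (intro continuous_map_from_subtopology continuous_map_product_projection) simp
    have ci: "continuous_map (prod_topology (top_of_set {0..1::real}) ?Y) euclideanreal (\<lambda>z. snd z i)" for i
      using continuous_map_compose[OF P comp[of i]] by (simp add: o_def)
    have ct: "continuous_map (prod_topology (top_of_set {0..1::real}) ?Y) euclideanreal fst"
      by (rule continuous_map_into_fulltopology[OF continuous_map_fst])
    have "continuous_map (prod_topology (top_of_set {0..1::real}) ?Y) (Euclidean_space n)
        (\<lambda>z i. if i < n then (1 - fst z) * snd z i + fst z * x i else 0)"
      unfolding continuous_map_componentwise_Euclidean_space
      by (intro allI impI continuous_intros ct ci)
    moreover have "(\<lambda>z i. if i < n then (1 - fst z) * snd z i + fst z * x i else 0) = ?h" by (auto simp: fun_eq_iff)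
    ultimately have cont: "continuous_map (prod_topology (top_of_set {0..1::real}) ?Y) (Euclidean_space n) ?h"
      by simp
    have "?h z \<in> ?B" if "z \<in> topspace (prod_topology (top_of_set {0..1::real}) ?Y)" for z
    proof -
      obtain t y where z: "z = (t, y)" by (cases z)
      have t: "0 \<le> t" "t \<le> 1" and y: "\<And>i. i < n \<Longrightarrow> dist (x i) (y i) < r i"
        using that by (auto simp: z)
      have "dist (x i) ((1 - t) * y i + t * x i) < r i" if i: "i < n" for i
      proof -
        have "dist (x i) ((1 - t) * y i + t * x i) = \<bar>(1 - t) * (x i - y i)\<bar>"
          by (simp add: dist_real_def algebra_simps)
        also have "\<dots> \<le> \<bar>x i - y i\<bar>" using t by (simp add: abs_mult mult_left_le_one_le)
        also have "\<dots> < r i" using y[OF i] by (simp add: dist_real_def)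
        finally show ?thesis .
      qed
      then show ?thesis by (simp add: z)
    qed
    with cont have "continuous_map (prod_topology (top_of_set {0..1::real}) ?Y) ?Y ?h"
      by (auto simp: continuous_map_in_subtopology)
    moreover have "?h (0, y) = y" if "y \<in> topspace ?Y" for y
      using that by (auto simp: topspace_Euclidean_space)
    moreover have "?h (1, y) = x" for y using xz by auto
    ultimately have "homotopic_with (\<lambda>_. True) ?Y ?Y id (\<lambda>_. x)"
      by (subst homotopic_with) (auto intro!: exI[of _ ?h])
    then show ?thesis by (auto simp: contractible_space_def)
  qed
qed

lemma openin_box:
  "openin (Euclidean_space n) {y \<in> topspace (Euclidean_space n). \<forall>i<n. dist (x i) (y i) < r i}"
proof -
  have comp: "continuous_map (Euclidean_space n) euclideanreal (\<lambda>y. y i)" for i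
    unfolding Euclidean_space_def
    by (intro continuous_map_from_subtopology continuous_map_product_projection) simp
  let ?E = "Euclidean_space n"
  have "openin ?E ((\<Inter>i<n. {y \<in> topspace ?E. y i \<in> ball (x i) (r i)}) \<inter> topspace ?E)"
    by (intro openin_INT openin_continuous_map_preimage[OF comp]) auto
  moreover have "(\<Inter>i<n. {y \<in> topspace ?E. y i \<in> ball (x i) (r i)}) \<inter> topspace ?E
      = {y \<in> topspace ?E. \<forall>i<n. dist (x i) (y i) < r i}"
    by auto
  ultimately show ?thesis by simp
qed

lemma box_neighbourhood:
  assumes V: "openin (Euclidean_space n) V" and x: "x \<in> V"
  obtains r where "\<And>i. 0 < r i"
    "{y \<in> topspace (Euclidean_space n). \<forall>i<n. dist (x i) (y i) < r i} \<subseteq> V"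
proof -
  obtain W where W: "openin (powertop_real UNIV) W" "V = W \<inter> {y. \<forall>i\<ge>n. y i = 0}"
    using V by (auto simp: Euclidean_space_def openin_subtopology)
  obtain P where P: "x \<in> (\<Pi>\<^sub>E i\<in>UNIV. P i)" "\<And>i. open (P i)" "(\<Pi>\<^sub>E i\<in>UNIV. P i) \<subseteq> W"
    using product_topology_open_contains_basis[OF W(1), of x] x W(2) by auto
  have "\<exists>e>0. ball (x i) e \<subseteq> P i" for i
    using P(1) P(2)[of i] by (auto simp: open_contains_ball)
  then obtain r where r: "\<And>i. 0 < r i" "\<And>i. ball (x i) (r i) \<subseteq> P i" by metis
  have "y \<in> V" if y: "y \<in> topspace (Euclidean_space n)" "\<forall>i<n. dist (x i) (y i) < r i" for y
  proof -
    have "y i \<in> P i" for i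
    proof (cases "i < n")
      case True then show ?thesis using r(2)[of i] y(2) by auto
    next
      case False
      then have "y i = x i" using y(1) x W(2) by (auto simp: topspace_Euclidean_space)
      then show ?thesis using P(1) by auto
    qed
    then show ?thesis using P(3) W(2) y(1) by (auto simp: topspace_Euclidean_space)
  qed
  then show ?thesis using r(1) by (intro that[of r]) auto
qed

lemma manifold_contractible_neighbourhood:
  assumes M: "topological_manifold n M" and U: "openin M U" "x \<in> U"
  shows "\<exists>B. openin M B \<and> x \<in> B \<and> B \<subseteq> U \<and> contractible_space (subtopology M B)"
proof -
  let ?E = "Euclidean_space n"
  have "x \<in> topspace M" using openin_subset[OF U(1)] U(2) by auto
  then obtain W V where W: "openin M W" "x \<in> W" and V: "openin ?E V"
    and hom: "subtopology M W homeomorphic_space subtopology ?E V"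
    using M unfolding topological_manifold_def by blast
  then obtain f g where fg: "homeomorphic_maps (subtopology M W) (subtopology ?E V) f g"
    unfolding homeomorphic_space_def by blast
  then have f: "homeomorphic_map (subtopology M W) (subtopology ?E V) f"
    and g: "homeomorphic_map (subtopology ?E V) (subtopology M W) g"
    and gf: "\<And>y. y \<in> W \<Longrightarrow> g (f y) = y"
    using homeomorphic_maps_map[of "subtopology M W" "subtopology ?E V" f g] openin_subset[OF W(1)]
    by (auto simp: homeomorphic_maps_def)
  have "openin (subtopology M W) (U \<inter> W)" using U by (simp add: openin_subtopology_Int)
  then have "openin (subtopology ?E V) (f ` (U \<inter> W))"
    using f by (meson homeomorphic_map_openness_eq)
  then have fo: "openin ?E (f ` (U \<inter> W))" using V openin_trans_full by blast
  obtain r where r: "\<And>i. 0 < r i"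
      "{y \<in> topspace ?E. \<forall>i<n. dist (f x i) (y i) < r i} \<subseteq> f ` (U \<inter> W)"
    using box_neighbourhood[OF fo, of "f x"] U W by blast
  define C where "C = {y \<in> topspace ?E. \<forall>i<n. dist (f x i) (y i) < r i}"
  have fx: "f x \<in> topspace ?E" using openin_subset[OF fo] U W by blast
  have C: "openin ?E C" "f x \<in> C" "C \<subseteq> f ` (U \<inter> W)" "C \<subseteq> V"
    using openin_box[of n "f x" r] r fx openin_subset[OF \<open>openin (subtopology ?E V) (f ` (U \<inter> W))\<close>]
    by (auto simp: C_def)
  have cC: "contractible_space (subtopology ?E C)"
  proof -
    have "subtopology ?E C = subtopology ?E {y. \<forall>i<n. dist (f x i) (y i) < r i}"
    proof -
      have "C = topspace ?E \<inter> {y. \<forall>i<n. dist (f x i) (y i) < r i}" unfolding C_def by blast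
      then show ?thesis by (simp only: subtopology_restrict)
    qed
    then show ?thesis using contractible_space_box[OF fx] by simp
  qed
  have oC: "openin (subtopology ?E V) C" using C by (simp add: openin_open_subtopology V)
  have gC: "g ` C \<subseteq> U \<inter> W" using C(3) gf by force
  have "openin (subtopology M W) (g ` C)" using g oC by (meson homeomorphic_map_openness_eq)
  then have oB: "openin M (g ` C)" using W openin_trans_full by blast
  have "homeomorphic_map (subtopology (subtopology ?E V) C) (subtopology (subtopology M W) (g ` C)) g"
  proof (rule homeomorphic_map_subtopologies[OF g])
    have "topspace (subtopology ?E V) \<inter> C = C" using openin_subset[OF oC] by auto
    moreover have "topspace (subtopology M W) \<inter> g ` C = g ` C"
      using openin_subset[OF W(1)] gC by auto
    ultimately show "g ` (topspace (subtopology ?E V) \<inter> C) = topspace (subtopology M W) \<inter> g ` C"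
      by simp
  qed
  then have "subtopology (subtopology ?E V) C homeomorphic_space subtopology (subtopology M W) (g ` C)"
    using homeomorphic_map_imp_homeomorphic_space by blast
  moreover have "subtopology (subtopology ?E V) C = subtopology ?E C"
    using C(4) by (simp add: subtopology_subtopology Int_absorb1)
  moreover have "subtopology (subtopology M W) (g ` C) = subtopology M (g ` C)"
    using gC by (simp add: subtopology_subtopology Int_absorb1)
  ultimately have "contractible_space (subtopology M (g ` C))"
    using cC homeomorphic_space_contractibility by metis
  moreover have "x \<in> g ` C" using C(2) gf[OF W(2)] by force
  ultimately show ?thesis using oB gC by blast
qed

theorem finitely_many_classes:
  assumes "closed_manifold n M" "0 < q"
  shows "\<exists>F. finite F \<and> (\<forall>f. int_closed q M k f \<longrightarrow> (\<exists>g\<in>F. int_exact q M k (\<lambda>\<sigma>. f \<sigma> - g \<sigma>)))"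
proof -
  have M: "topological_manifold n M" "compact_space M" "Hausdorff_space M"
    using assms(1) by (auto simp: closed_manifold_def topological_manifold_def)
  obtain V where V: "topspace M \<subseteq> V" "V \<subseteq> topspace M" "finite_image q k M V (topspace M)"
    using finite_image_compact[OF M(2,3) manifold_contractible_neighbourhood[OF M(1)] assms(2)
        openin_topspace closedin_topspace order_refl] by blast
  then have "V = topspace M" by blast
  with V(3) show ?thesis by (simp add: finite_image_def)
qed

section \<open>The cohomology algebra\<close>

text \<open>The cochain with values in the residue ring that an integer valued function represents. Every such
  cochain arises in this way, so the module laws and the properties of the cup product are inherited
  from the integers.\<close>

definition reduce :: "int \<Rightarrow> 'a topology \<Rightarrow> nat \<Rightarrow> ('a, int) cochain \<Rightarrow> ('a, int) cochain" where
  "reduce q X k f = (\<lambda>\<sigma>\<in>singular_simplex_set k X. f \<sigma> mod q)"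

lemma reduce_eq_iff:
  "reduce q X k f = reduce q X k g \<longleftrightarrow> (\<forall>\<sigma>. singular_simplex k X \<sigma> \<longrightarrow> q dvd f \<sigma> - g \<sigma>)"
  by (auto simp: reduce_def fun_eq_iff restrict_def mod_eq_dvd_iff)

context
  fixes q :: int and R :: "int ring" and X :: "'a topology"
  assumes q: "1 < q" and R_def: "R = residue_ring q"
begin

interpretation residues q R
  by unfold_locales (use q R_def in auto)

lemma residue_finsum:
  assumes "finite I" "\<And>i. i \<in> I \<Longrightarrow> f i \<in> carrier R"
  shows "(\<Oplus>\<^bsub>R\<^esub>i\<in>I. f i) = (\<Sum>i\<in>I. f i) mod q"
  using assms
proof (induction I rule: finite_induct)
  case (insert i I)
  then show ?case by (simp add: finsum_insert Pi_def res_add_eq mod_simps)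
qed (simp add: res_zero_eq)

lemma reduce_closed: "reduce q X k f \<in> carrier (cochain_module R X k)"
  using q by (auto simp: reduce_def cochain_module_def res_carrier_eq)

lemma reduce_ex:
  assumes "c \<in> carrier (cochain_module R X k)"
  shows "\<exists>f. c = reduce q X k f"
proof -
  have "c = reduce q X k c"
    using assms by (auto simp: cochain_module_def reduce_def res_carrier_eq fun_eq_iff PiE_iff extensional_def)
  then show ?thesis by blast
qed

lemma reduce_zero: "\<zero>\<^bsub>cochain_module R X k\<^esub> = reduce q X k (\<lambda>_. 0)"
  by (simp add: reduce_def cochain_module_def res_zero_eq)

lemma reduce_add:
  "reduce q X k f \<oplus>\<^bsub>cochain_module R X k\<^esub> reduce q X k g = reduce q X k (\<lambda>\<sigma>. f \<sigma> + g \<sigma>)"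
  by (auto simp: reduce_def cochain_module_def res_add_eq mod_simps fun_eq_iff)

lemma reduce_smult:
  "r \<odot>\<^bsub>cochain_module R X k\<^esub> reduce q X k f = reduce q X k (\<lambda>\<sigma>. r * f \<sigma>)"
  by (auto simp: reduce_def cochain_module_def res_mult_eq mod_simps fun_eq_iff)

lemma reduce_coboundary:
  "coboundary R X k (reduce q X k f) = reduce q X (Suc k) (int_coboundary k f)"
proof
  fix \<sigma>
  show "coboundary R X k (reduce q X k f) \<sigma> = reduce q X (Suc k) (int_coboundary k f) \<sigma>"
  proof (cases "singular_simplex (Suc k) X \<sigma>")
    case True
    let ?c = "\<lambda>i. reduce q X k f (singular_face (Suc k) i \<sigma>)"
    have c: "?c i = f (singular_face (Suc k) i \<sigma>) mod q" if "i \<le> Suc k" for i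
      using singular_simplex_face[OF True that] by (simp add: reduce_def)
    have cl: "(if even i then ?c i else \<ominus>\<^bsub>R\<^esub> ?c i) \<in> carrier R" if "i \<le> Suc k" for i
      using q by (simp add: c that res_neg_eq res_carrier_eq)
    have "coboundary R X k (reduce q X k f) \<sigma> = (\<Oplus>\<^bsub>R\<^esub>i\<in>{..Suc k}. if even i then ?c i else \<ominus>\<^bsub>R\<^esub> ?c i)"
      using True unfolding coboundary_def restrict_def by (simp only: mem_Collect_eq if_True)
    also have "\<dots> = (\<Sum>i\<le>Suc k. if even i then ?c i else \<ominus>\<^bsub>R\<^esub> ?c i) mod q"
      by (rule residue_finsum) (use cl in auto)
    also have "\<dots> = (\<Sum>i\<le>Suc k. ((-1) ^ i * f (singular_face (Suc k) i \<sigma>)) mod q) mod q"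
      by (intro arg_cong[where f = "\<lambda>s. s mod q"] sum.cong)
        (auto simp: c res_neg_eq mod_minus_eq)
    also have "\<dots> = int_coboundary k f \<sigma> mod q"
      by (simp add: int_coboundary_def mod_sum_eq del: sum.atMost_Suc)
    finally show ?thesis using True by (simp add: reduce_def)
  qed (simp add: coboundary_def reduce_def)
qed

lemma reduce_cup:
  "cochain_cup R X i j (reduce q X i f) (reduce q X j g) = reduce q X (i + j) (int_cup i j f g)"
  using singular_simplex_front_face[of i j X] singular_simplex_back_face[of i j X]
  by (auto simp: cochain_cup_def reduce_def int_cup_def res_mult_eq mod_simps fun_eq_iff)

lemma module_cochain: "module R (cochain_module R X k)"
proof (rule moduleI)
  let ?C = "cochain_module R X k"
  show "cring R" by (rule cring)
  show "abelian_group ?C"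
  proof (rule abelian_groupI)
    show "\<exists>y\<in>carrier ?C. y \<oplus>\<^bsub>?C\<^esub> a = \<zero>\<^bsub>?C\<^esub>" if a: "a \<in> carrier ?C" for a
    proof -
      obtain f where "a = reduce q X k f" using reduce_ex[OF a] by blast
      then show ?thesis
        by (intro bexI[of _ "reduce q X k (\<lambda>\<sigma>. - f \<sigma>)"]) (simp_all add: reduce_add reduce_zero reduce_closed)
    qed
  qed (auto dest!: reduce_ex simp: reduce_add reduce_zero reduce_closed add_ac)
qed (auto dest!: reduce_ex simp: reduce_add reduce_smult reduce_closed reduce_eq_iff res_add_eq res_mult_eq
      res_one_eq distrib_left distrib_right mod_eq_dvd_iff[symmetric] mod_simps mult.assoc)

lemma reduce_minus: "\<ominus>\<^bsub>cochain_module R X k\<^esub> reduce q X k f = reduce q X k (\<lambda>\<sigma>. - f \<sigma>)"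
proof -
  interpret M: module R "cochain_module R X k" by (rule module_cochain)
  show ?thesis
    by (rule M.minus_equality) (simp_all add: reduce_add reduce_zero reduce_closed)
qed

lemma reduce_in_cocycles: "reduce q X k f \<in> cocycles R X k \<longleftrightarrow> int_closed q X k f"
  by (simp add: cocycles_def reduce_closed reduce_coboundary reduce_zero reduce_eq_iff int_closed_def)

lemma reduce_in_coboundaries: "reduce q X k f \<in> coboundaries R X k \<longleftrightarrow> int_exact q X k f"
proof (cases k)
  case 0
  then show ?thesis by (simp add: coboundaries_def int_exact_def reduce_zero reduce_eq_iff)
next
  case (Suc j)
  have "coboundaries R X k = range (\<lambda>b. reduce q X k (int_coboundary j b))"
    using Suc reduce_closed by (fastforce simp: coboundaries_def reduce_coboundary[symmetric] image_iff dest!: reduce_ex)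
  then show ?thesis using Suc by (auto simp: image_iff reduce_eq_iff int_exact_def)
qed

lemma cocycles_ex: "c \<in> cocycles R X k \<Longrightarrow> \<exists>f. int_closed q X k f \<and> c = reduce q X k f"
  using reduce_ex reduce_in_cocycles by (fastforce simp: cocycles_def)

lemma coboundaries_ex: "c \<in> coboundaries R X k \<Longrightarrow> \<exists>f. int_exact q X k f \<and> c = reduce q X k f"
proof -
  assume c: "c \<in> coboundaries R X k"
  then have "c \<in> carrier (cochain_module R X k)"
    by (cases k) (auto simp: coboundaries_def reduce_zero reduce_closed reduce_coboundary dest!: reduce_ex)
  then show ?thesis using c reduce_ex reduce_in_coboundaries by metis
qed

lemma graded_quotient_cochains:
  "graded_quotient R (cochain_module R X) (cocycles R X) (coboundaries R X) (cochain_cup R X)"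
proof (rule graded_quotient.intro)
  fix d
  show "submodule_pair R (cochain_module R X d) (cocycles R X d) (coboundaries R X d)"
  proof (intro submodule_pair.intro module_cochain submodule_pair_axioms.intro)
    show "submodule (cocycles R X d) R (cochain_module R X d)"
      by (rule module.submoduleI[OF module_cochain])
        (auto dest!: cocycles_ex simp: reduce_closed reduce_zero reduce_in_cocycles reduce_minus reduce_add reduce_smult
          intro: int_closed_add int_closed_mult int_closed_mult[of _ _ _ _ "-1", simplified]
            int_exact_imp_closed int_exact_zero)
    show "submodule (coboundaries R X d) R (cochain_module R X d)"
      by (rule module.submoduleI[OF module_cochain])
        (auto dest!: coboundaries_ex simp: reduce_closed reduce_zero reduce_in_coboundaries reduce_minus reduce_add reduce_smult
          intro: int_exact_add int_exact_mult int_exact_mult[of _ _ _ _ "-1", simplified] int_exact_zero)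
    show "coboundaries R X d \<subseteq> cocycles R X d"
      by (auto dest!: coboundaries_ex simp: reduce_in_cocycles int_exact_imp_closed)
  qed
next
  fix i j a b assume "a \<in> cocycles R X i" "b \<in> cocycles R X j"
  then obtain f g where fg: "int_closed q X i f" "a = reduce q X i f" "int_closed q X j g" "b = reduce q X j g"
    using cocycles_ex by metis
  interpret M: module R "cochain_module R X (i + j)" by (rule module_cochain)
  show "cochain_cup R X i j a b \<in> cocycles R X (i + j)"
    using fg by (simp add: reduce_cup reduce_in_cocycles int_closed_cup)
  have ji: "cochain_cup R X j i b a = reduce q X (i + j) (int_cup j i g f)"
    using reduce_cup[of j i g f] fg by (simp add: add.commute)
  have ij: "cochain_cup R X i j a b = reduce q X (i + j) (int_cup i j f g)"
    using fg by (simp add: reduce_cup)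
  have "int_exact q X (i + j) (\<lambda>\<sigma>. int_cup i j f g \<sigma> - (-1) ^ (i * j) * int_cup j i g f \<sigma>)"
    using int_cup_graded_commute fg by blast
  then show "cochain_cup R X i j a b \<ominus>\<^bsub>cochain_module R X (i + j)\<^esub>
      (if even (i * j) then cochain_cup R X j i b a
       else \<ominus>\<^bsub>cochain_module R X (i + j)\<^esub> cochain_cup R X j i b a) \<in> coboundaries R X (i + j)"
    by (cases "even (i * j)")
      (simp_all add: ij ji a_minus_def reduce_minus reduce_add reduce_in_coboundaries)
  show "cochain_cup R X i j a (r \<odot>\<^bsub>cochain_module R X j\<^esub> b) = r \<odot>\<^bsub>cochain_module R X (i + j)\<^esub> cochain_cup R X i j a b" for r
    using fg by (simp add: reduce_cup reduce_smult int_cup_def[abs_def] mult.left_commute)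
  show "cochain_cup R X i j (a \<oplus>\<^bsub>cochain_module R X i\<^esub> a') b =
      cochain_cup R X i j a b \<oplus>\<^bsub>cochain_module R X (i + j)\<^esub> cochain_cup R X i j a' b"
    if "a' \<in> cocycles R X i" for a'
    using fg cocycles_ex[OF that] by (auto simp: reduce_cup reduce_add int_cup_def[abs_def] distrib_right)
  show "cochain_cup R X i j a (b \<oplus>\<^bsub>cochain_module R X j\<^esub> b') =
      cochain_cup R X i j a b \<oplus>\<^bsub>cochain_module R X (i + j)\<^esub> cochain_cup R X i j a b'"
    if "b' \<in> cocycles R X j" for b'
    using fg cocycles_ex[OF that] by (auto simp: reduce_cup reduce_add int_cup_def[abs_def] distrib_left)
  show "cochain_cup R X (i + j) l (cochain_cup R X i j a b) c = cochain_cup R X i (j + l) a (cochain_cup R X j l b c)"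
    if c: "c \<in> cocycles R X l" for c l
  proof -
    obtain h where h: "c = reduce q X l h" using cocycles_ex[OF c] by blast
    have "int_cup (i + j) l (int_cup i j f g) h = int_cup i (j + l) f (int_cup j l g h)"
      by (rule ext) (rule int_cup_assoc)
    then show ?thesis by (simp only: fg(2,4) h reduce_cup add.assoc)
  qed
next
  fix i j a b assume "a \<in> coboundaries R X i" "b \<in> cocycles R X j"
  then show "cochain_cup R X i j a b \<in> coboundaries R X (i + j)"
    by (auto dest!: coboundaries_ex cocycles_ex simp: reduce_cup reduce_in_coboundaries int_exact_cup_left)
next
  fix i j a b assume "a \<in> cocycles R X i" "b \<in> coboundaries R X j"
  then show "cochain_cup R X i j a b \<in> coboundaries R X (i + j)"
    by (auto dest!: coboundaries_ex cocycles_ex simp: reduce_cup reduce_in_coboundaries int_exact_cup_right)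
qed

lemma graded_commutative_cohomology: "graded_commutative_algebra R (cohomology_algebra R X)"
proof -
  interpret G: graded_quotient R "cochain_module R X" "cocycles R X" "coboundaries R X" "cochain_cup R X"
    by (rule graded_quotient_cochains)
  show ?thesis
    by (rule G.graded_commutative_algebra_quotient)
      (simp_all add: cohomology_algebra_def cohomology_def cup_def G.coset_product)
qed

lemma finite_cohomology:
  assumes "closed_manifold n X"
  shows "finite (carrier (part (cohomology_algebra R X) k))"
proof -
  interpret G: graded_quotient R "cochain_module R X" "cocycles R X" "coboundaries R X" "cochain_cup R X"
    by (rule graded_quotient_cochains)
  let ?c = "\<lambda>f. coboundaries R X k +>\<^bsub>cochain_module R X k\<^esub> reduce q X k f"
  obtain F where F: "finite F" "\<And>f. int_closed q X k f \<Longrightarrow> \<exists>g\<in>F. int_exact q X k (\<lambda>\<sigma>. f \<sigma> - g \<sigma>)"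
    using finitely_many_classes[OF assms, of q k] q by auto
  have "carrier (part (cohomology_algebra R X) k) \<subseteq> ?c ` F"
  proof
    fix A assume "A \<in> carrier (part (cohomology_algebra R X) k)"
    then obtain f where f: "int_closed q X k f" "A = ?c f"
      using cocycles_ex unfolding cohomology_algebra_def cohomology_def graded_algebra.simps G.P.Q_carrier by blast
    obtain g where g: "g \<in> F" "int_exact q X k (\<lambda>\<sigma>. f \<sigma> - g \<sigma>)" using F(2)[OF f(1)] by blast
    have "?c f = ?c g"
      using g(2) by (subst G.P.coset_eq_iff)
        (simp_all add: reduce_closed a_minus_def reduce_minus reduce_add reduce_in_coboundaries)
    then show "A \<in> ?c ` F" using f g by blast
  qed
  then show ?thesis using F(1) finite_surj by blast
qed

end

section \<open>The decomposition\<close>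

theorem lemma3p2:
  fixes p n k :: nat and M :: "'a topology" and x :: "('a, int) cochain set"
  defines "H \<equiv> cohomology_algebra (residue_ring (int p)) M"
  defines "Hbar \<equiv> periodic_subquotient H n k x"
  assumes "prime p"
    and "1 \<le> k" and "3 * k \<le> n - 1"
    and "closed_manifold n M"
    and "induces_periodicity H n k x"
  shows "\<exists>(m :: nat) (xs :: nat \<Rightarrow> ('a, int) cochain set set)
            (S :: nat \<Rightarrow> nat \<Rightarrow> ('a, int) cochain set set set).
      (\<forall>i \<in> {1..m}. xs i \<in> carrier (part Hbar k)) \<and>
      (\<forall>i \<in> {1..m}. graded_subalgebra (residue_ring (int p)) Hbar (S i) \<and>
                     nontrivial_subalgebra Hbar (S i)) \<and>
      internal_direct_sum Hbar m S \<and>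
      (\<forall>i \<in> {1..m}. induces_periodicity_on Hbar n k (xs i) (S i) \<and>
         (\<forall>j \<in> {1..m}. j \<noteq> i \<longrightarrow>
            (\<forall>d. \<forall>s \<in> S j d. gmult Hbar k d (xs i) s = \<zero>\<^bsub>part Hbar (k + d)\<^esub>))) \<and>
      (\<forall>i \<in> {1..m}. \<forall>a \<in> carrier (part Hbar k). \<forall>b \<in> carrier (part Hbar k).
         xs i = a \<oplus>\<^bsub>part Hbar k\<^esub> b \<longrightarrow>
           induces_periodicity_on Hbar n k a (S i) \<or> induces_periodicity_on Hbar n k b (S i))"
proof -
  let ?R = "residue_ring (int p)"
  have p: "1 < int p" using assms(3) prime_gt_1_nat by simp
  have "field ?R"
    by (rule residues_prime.is_field) (simp add: residues_prime_def assms(3))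
  moreover have "finite (carrier (part H k))"
    unfolding H_def by (rule finite_cohomology[OF p refl assms(6)])
  moreover have "periodicity_inducing ?R H n k x"
    using graded_commutative_cohomology[OF p refl, of M] assms(4,7)
    by (intro periodicity_inducing.intro periodicity_inducing_axioms.intro) (auto simp: H_def)
  ultimately have "periodic_algebra ?R Hbar n k (psq_denominator H k x k +>\<^bsub>part H k\<^esub> x)"
    unfolding Hbar_def by (intro periodicity_inducing.periodic_algebra_psq)
  from periodic_algebra.decomposition[OF this] show ?thesis
    unfolding periodic_decomposition_def .
qed

end
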